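(* Let $n\ge2$ be an integer, $\lambda=\frac{n-1}{2}$, and $m\in\mathbb N=\{1,2,\dots\}$. The normalized Poisson wavelets $$G_a^m=\sum_{l=0}^\infty\psi_m(al)\,\mathcal K_l^\lambda,\quad a\in\mathbb R_+,\qquad\text{with}\qquad \psi_m(t)=\frac{2^m}{\sqrt{\Gamma(2m)}}\,t^me^{-t},$$ form a spherical wavelet; that is, $\{G_a^m\}_{a\in\mathbb R_+}$ is a family of $\mathcal L^1(\mathcal S^n)$-functions satisfying 1. $\displaystyle\int_0^\infty|\psi_m(t)|^2\,\frac{dt}{t}=1$; 2. there is a constant $\mathfrak c$ such that for all $R\in\mathbb R_+$ $$\int_{-1}^1\left|\int_R^\infty\bigl(\overline{G_a^m}\ast G_a^m\bigr)(t)\,\frac{da}{a}\right|\left(1-t^2\right)^{\lambda-1/2}dt\le\mathfrak c .$$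
   Context: $\mathcal S^n$ is the unit sphere in $\mathbb R^{n+1}$ with rotation-invariant measure $d\sigma$ of total mass $\Sigma_n=\frac{2\pi^{\lambda+1}}{\Gamma(\lambda+1)}$; $\hat e=(1,0,\dots,0)$. The Gegenbauer polynomials $C_l^\lambda$ are defined by $\sum_{l=0}^\infty C_l^\lambda(t)\,r^l=(1-2tr+r^2)^{-\lambda}$ for $t\in[-1,1]$, $|r|<1$, and $\mathcal K_l^\lambda=\frac{\lambda+l}{\lambda}\,C_l^\lambda$. Zonal functions on $\mathcal S^n$ (functions of $t=\hat e\cdot x$ only) are identified with functions on $[-1,1]$. For $f,g\in\mathcal L^1(\mathcal S^n)$ with $g$ zonal, the convolution is $(f\ast g)(x)=\frac{1}{\Sigma_n}\int_{\mathcal S^n}f(y)\,g(x\cdot y)\,d\sigma(y)$; if $f$ is also zonal, so is $f\ast g$. *)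

theory Defs
  imports "HOL-Analysis.Analysis"
begin

section \<open>The unit sphere and its surface measure\<close>

text \<open>
  The ambient space \<open>\<real>\<^sup>n\<^sup>+\<^sup>1\<close> is rendered as \<^typ>\<open>real \<times> (real ^ 'n)\<close> with \<open>n = CARD('n)\<close>; the
  product type carries the Euclidean inner product, and \<open>(1, 0, \<dots>, 0)\<close> is \<^term>\<open>pole\<close>.
\<close>

definition pole :: "real \<times> (real ^ 'n)" where
  "pole = (1, 0)"

definition sphere_area :: "real \<Rightarrow> real" where
  "sphere_area lam = 2 * pi powr (lam + 1) / Gamma (lam + 1)"

text \<open>
  Surface measure as cone measure: \<open>\<sigma>(A) = DIM \<cdot> vol {r x | 0 < r \<le> 1, x \<in> A}\<close>.
  The lemmas below show that it is the rotation-invariant measure of the required total mass.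
\<close>

definition sphere_measure :: "'a::euclidean_space measure" where
  "sphere_measure =
     scale_measure (of_nat DIM('a))
       (distr (restrict_space lborel (cball 0 1 - {0})) (restrict_space borel (sphere 0 1)) sgn)"

lemma space_sphere_measure [simp]: "space sphere_measure = (sphere 0 1 :: 'a::euclidean_space set)"
  by (simp add: sphere_measure_def space_scale_measure space_restrict_space)

lemma sets_sphere_measure [measurable_cong]:
  "sets sphere_measure = sets (restrict_space borel (sphere 0 1 :: 'a::euclidean_space set))"
  by (simp add: sphere_measure_def)

lemma measurable_sgn_sphere:
  "sgn \<in> restrict_space lborel (cball 0 1 - {0}) \<rightarrow>\<^sub>M
     restrict_space borel (sphere 0 1 :: 'a::euclidean_space set)"
proof (rule measurable_restrict_space2)
  show "sgn \<in> space (restrict_space lborel (cball 0 1 - {0})) \<rightarrow> (sphere 0 1 :: 'a set)"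
    by (auto simp: space_restrict_space norm_sgn)
  have "(\<lambda>x::'a. x /\<^sub>R norm x) \<in> restrict_space lborel (cball 0 1 - {0}) \<rightarrow>\<^sub>M borel"
    by (intro measurable_restrict_space1) measurable
  then show "sgn \<in> restrict_space lborel (cball 0 1 - {0 :: 'a}) \<rightarrow>\<^sub>M borel"
    by (simp add: sgn_div_norm[abs_def])
qed

lemma emeasure_sphere_measure:
  fixes A :: "'a::euclidean_space set"
  assumes "A \<in> sets borel" "A \<subseteq> sphere 0 1"
  shows "emeasure sphere_measure A =
           of_nat DIM('a) * emeasure lborel {x \<in> cball 0 1 - {0}. sgn x \<in> A}"
proof -
  have A: "A \<in> sets (restrict_space borel (sphere 0 1))"
    using assms by (auto simp: sets_restrict_space)
  let ?C = "{x \<in> cball 0 1 - {0}. sgn x \<in> A}"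
  have "sgn -` A \<inter> (cball 0 1 - {0}) = ?C" by auto
  moreover have "emeasure (restrict_space lborel (cball 0 1 - {0})) ?C = emeasure lborel ?C"
    by (rule emeasure_restrict_space) auto
  ultimately show ?thesis
    by (simp only: sphere_measure_def emeasure_scale_measure
        emeasure_distr[OF measurable_sgn_sphere A] space_restrict_space)
      (simp add: Int_absorb2)
qed

lemma emeasure_sphere_measure_space:
  "emeasure sphere_measure (sphere 0 1 :: 'a::euclidean_space set) =
     ennreal (sphere_area ((real DIM('a) - 2) / 2))"
proof -
  let ?d = "real DIM('a)"
  have d: "?d > 0" by simp
  have eq: "{x \<in> cball 0 1 - {0 :: 'a}. sgn x \<in> sphere 0 1} = cball 0 1 - {0}"
    by (auto simp: norm_sgn)
  have "emeasure lborel (cball 0 1 - {0 :: 'a}) = emeasure lborel (cball 0 1 :: 'a set)"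
    by (subst emeasure_Diff) auto
  also have "\<dots> = ennreal (unit_ball_vol ?d)"
    by (simp add: emeasure_cball)
  finally have 1: "emeasure lborel (cball 0 1 - {0 :: 'a}) = ennreal (unit_ball_vol ?d)" .
  have G: "Gamma (?d / 2 + 1) = ?d / 2 * Gamma (?d / 2)"
    by (rule Gamma_plus1) (use d in \<open>auto dest: nonpos_Ints_nonpos\<close>)
  have lam: "(?d - 2) / 2 + 1 = ?d / 2" by (simp add: field_simps)
  have 2: "?d * unit_ball_vol ?d = sphere_area ((?d - 2) / 2)"
    unfolding sphere_area_def lam unit_ball_vol_def G using d by (simp add: field_simps)
  have "(of_nat DIM('a) :: ennreal) = ennreal ?d" by (simp add: ennreal_of_nat_eq_real_of_nat)
  then show ?thesis
    by (subst emeasure_sphere_measure)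
      (simp_all only: eq 1 ennreal_mult[symmetric] 2 subset_refl borel_closed closed_sphere
        of_nat_0_le_iff unit_ball_vol_nonneg)
qed

lemma lborel_distr_orthogonal:
  fixes f :: "'a::euclidean_space \<Rightarrow> 'a"
  assumes f: "orthogonal_transformation f"
  shows "distr lborel borel f = lborel"
proof -
  have lin: "linear f" using f by (rule orthogonal_transformation_linear)
  have [measurable]: "f \<in> borel_measurable borel"
    using lin by (intro borel_measurable_continuous_onI linear_continuous_on)
      (simp add: linear_conv_bounded_linear)
  define M where "M = distr lborel borel f"
  have [simp, measurable_cong]: "sets M = sets borel" by (simp add: M_def)
  have [simp]: "space M = UNIV" by (simp add: M_def)
  have bnd: "bij f" using f by (rule orthogonal_transformation_bij)
  have nrm: "norm (f x) = norm x" for x using f by (rule orthogonal_transformation_norm)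
  have vB: "f -` cball 0 r = cball 0 r" for r by (auto simp: nrm)
  have eB: "emeasure M (cball 0 r) = emeasure lborel (cball (0::'a) r)" for r
    by (simp add: M_def emeasure_distr vB)
  interpret sM: sigma_finite_measure M
  proof
    show "\<exists>A. countable A \<and> A \<subseteq> sets M \<and> \<Union>A = space M \<and> (\<forall>a\<in>A. emeasure M a \<noteq> \<infinity>)"
    proof (intro exI conjI)
      show "\<Union>(range (\<lambda>n::nat. cball (0::'a) (real n))) = space M"
        using real_arch_simple by auto
    qed (use emeasure_lborel_cball_finite[of "0::'a"] in \<open>auto simp: eB less_top\<close>)
  qed
  interpret lM: pair_sigma_finite lborel M ..
  have trans: "(\<integral>\<^sup>+ x. h (x + y) \<partial>M) = (\<integral>\<^sup>+ x. h x \<partial>M)"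
    if [measurable]: "h \<in> borel_measurable borel" for h y
  proof -
    obtain z where z: "y = f z" using bnd by (metis bij_pointE)
    have "(\<integral>\<^sup>+ x. h (x + y) \<partial>M) = (\<integral>\<^sup>+ x. h (f (z + x)) \<partial>lborel)"
      unfolding M_def
      by (simp add: nn_integral_distr z linear_add[OF lin] add.commute)
    also have "\<dots> = (\<integral>\<^sup>+ x. h (f x) \<partial>distr lborel borel ((+) z))"
      by (simp add: nn_integral_distr)
    also have "\<dots> = (\<integral>\<^sup>+ x. h x \<partial>M)"
      by (simp add: lborel_distr_plus M_def nn_integral_distr)
    finally show ?thesis .
  qed
  have transl: "(\<integral>\<^sup>+ x. h (x + y) \<partial>lborel) = (\<integral>\<^sup>+ x. h x \<partial>lborel)"
    if [measurable]: "h \<in> borel_measurable borel" for h :: "'a \<Rightarrow> ennreal" and y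
  proof -
    have "(\<integral>\<^sup>+ x. h (x + y) \<partial>lborel) = (\<integral>\<^sup>+ x. h x \<partial>distr lborel borel ((+) y))"
      by (simp add: nn_integral_distr add.commute)
    then show ?thesis by (simp add: lborel_distr_plus)
  qed
  let ?B = "cball (0::'a) 1"
  have main: "emeasure M A = emeasure lborel A" if A [measurable]: "A \<in> sets borel" for A
  proof -
    have mB [measurable]: "?B \<in> sets borel" by simp
    have "emeasure M A * emeasure lborel ?B =
      (\<integral>\<^sup>+ x. indicator A x * (\<integral>\<^sup>+ y. indicator ?B y \<partial>lborel) \<partial>M)"
      by (simp add: nn_integral_multc)
    also have "\<dots> = (\<integral>\<^sup>+ x. indicator A x * (\<integral>\<^sup>+ y. indicator ?B (y + (- x)) \<partial>lborel) \<partial>M)"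
      by (subst transl) auto
    also have "\<dots> = (\<integral>\<^sup>+ x. \<integral>\<^sup>+ y. indicator A x * indicator ?B (y + (- x)) \<partial>lborel \<partial>M)"
      by (subst nn_integral_cmult) auto
    also have "\<dots> = (\<integral>\<^sup>+ y. \<integral>\<^sup>+ x. indicator A x * indicator ?B (y + (- x)) \<partial>M \<partial>lborel)"
      by (rule lM.Fubini') measurable
    also have "\<dots> = (\<integral>\<^sup>+ y. \<integral>\<^sup>+ x. indicator A (x + y) * indicator ?B (y + (- (x + y))) \<partial>M \<partial>lborel)"
    proof (rule nn_integral_cong)
      fix y :: 'a
      show "(\<integral>\<^sup>+ x. indicator A x * indicator ?B (y + (- x)) \<partial>M) =
        (\<integral>\<^sup>+ x. indicator A (x + y) * indicator ?B (y + (- (x + y))) \<partial>M)"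
        by (rule trans[of "\<lambda>x. indicator A x * indicator ?B (y + (- x))" y, symmetric]) measurable
    qed
    also have "\<dots> = (\<integral>\<^sup>+ y. \<integral>\<^sup>+ x. indicator ?B x * indicator A (y + x) \<partial>M \<partial>lborel)"
      by (intro nn_integral_cong) (auto simp: indicator_def add.commute)
    also have "\<dots> = (\<integral>\<^sup>+ x. \<integral>\<^sup>+ y. indicator ?B x * indicator A (y + x) \<partial>lborel \<partial>M)"
      by (rule lM.Fubini'[symmetric]) measurable
    also have "\<dots> = (\<integral>\<^sup>+ x. indicator ?B x * (\<integral>\<^sup>+ y. indicator A (y + x) \<partial>lborel) \<partial>M)"
      by (subst nn_integral_cmult) auto
    also have "\<dots> = (\<integral>\<^sup>+ x. indicator ?B x * (\<integral>\<^sup>+ y. indicator A y \<partial>lborel) \<partial>M)"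
      by (subst transl) auto
    also have "\<dots> = emeasure lborel A * emeasure lborel ?B"
      by (subst nn_integral_multc) (auto simp: eB mult.commute)
    finally have "emeasure M A * emeasure lborel ?B = emeasure lborel A * emeasure lborel ?B" .
    moreover have "emeasure lborel ?B \<noteq> 0" "emeasure lborel ?B \<noteq> \<infinity>"
      by (simp_all add: emeasure_cball ennreal_eq_0_iff not_le)
    ultimately show ?thesis
      using ennreal_mult_cancel_left[of "emeasure lborel ?B" "emeasure M A" "emeasure lborel A"]
      unfolding mult.commute[of "emeasure lborel ?B"] infinity_ennreal_def by blast
  qed
  show ?thesis
    by (rule measure_eqI) (use main in \<open>auto simp: M_def\<close>)
qed

lemma sphere_measure_rotation_invariant:
  fixes f :: "'a::euclidean_space \<Rightarrow> 'a"
  assumes f: "orthogonal_transformation f"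
  shows "distr sphere_measure sphere_measure f = sphere_measure"
proof (rule measure_eqI)
  have lin: "linear f" using f by (rule orthogonal_transformation_linear)
  have mf [measurable]: "f \<in> borel_measurable borel"
    using lin by (intro borel_measurable_continuous_onI linear_continuous_on)
      (simp add: linear_conv_bounded_linear)
  have nrm: "norm (f x) = norm x" for x using f by (rule orthogonal_transformation_norm)
  have sg: "sgn (f x) = f (sgn x)" for x
    by (simp add: sgn_div_norm nrm linear_scale[OF lin])
  have fz: "f x = 0 \<longleftrightarrow> x = 0" for x using nrm[of x] by (metis norm_eq_zero)
  have meas: "f \<in> sphere_measure \<rightarrow>\<^sub>M sphere_measure"
  proof -
    have "f \<in> restrict_space borel (sphere 0 1) \<rightarrow>\<^sub>M restrict_space borel (sphere 0 1)"
      by (rule measurable_restrict_space3) (auto simp: nrm)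
    then show ?thesis
      by (simp add: measurable_cong_sets[OF sets_sphere_measure sets_sphere_measure])
  qed
  fix A assume "A \<in> sets (distr sphere_measure sphere_measure f)"
  then have A: "A \<in> sets borel" "A \<subseteq> sphere 0 1" and As: "A \<in> sets sphere_measure"
    by (auto simp: sets_sphere_measure sets_restrict_space)
  let ?C = "{x \<in> cball 0 1 - {0}. sgn x \<in> A}"
  let ?A' = "f -` A \<inter> sphere 0 1"
  have A': "?A' \<in> sets borel" "?A' \<subseteq> sphere 0 1"
    using A measurable_sets_borel[OF mf A(1)] by auto
  have ms: "(\<lambda>x::'a. sgn x) \<in> borel_measurable borel"
    unfolding sgn_div_norm[abs_def] by measurable
  have C: "?C \<in> sets borel"
  proof -
    have "?C = (cball 0 1 - {0}) \<inter> (sgn -` A)" by auto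
    then show ?thesis using measurable_sets_borel[OF ms A(1)] by simp
  qed
  have "emeasure (distr sphere_measure sphere_measure f) A = emeasure sphere_measure ?A'"
    by (simp add: emeasure_distr[OF meas As])
  also have "\<dots> = of_nat DIM('a) * emeasure lborel {x \<in> cball 0 1 - {0}. sgn x \<in> ?A'}"
    by (rule emeasure_sphere_measure[OF A'])
  also have "{x \<in> cball 0 1 - {0}. sgn x \<in> ?A'} = f -` ?C"
    by (auto simp: nrm sg norm_sgn fz)
  also have "emeasure lborel (f -` ?C) = emeasure (distr lborel borel f) ?C"
    using C by (simp add: emeasure_distr)
  also have "\<dots> = emeasure lborel ?C"
    by (simp add: lborel_distr_orthogonal[OF f])
  also have "of_nat DIM('a) * \<dots> = emeasure sphere_measure A"
    by (rule emeasure_sphere_measure[OF A, symmetric])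
  finally show "emeasure (distr sphere_measure sphere_measure f) A = emeasure sphere_measure A" .
qed simp


section \<open>Zonal functions and convolution\<close>

text \<open>
  The two directions of the identification of zonal functions on the sphere with functions
  on \<open>[-1, 1]\<close>. The second is meaningful for \<^term>\<open>t \<in> {-1..1}\<close> and zonal \<open>F\<close>.
\<close>

definition zonal :: "(real \<Rightarrow> 'b) \<Rightarrow> real \<times> (real ^ 'n) \<Rightarrow> 'b" where
  "zonal g x = g (pole \<bullet> x)"

definition zonal_profile :: "(real \<times> (real ^ 'n) \<Rightarrow> 'b) \<Rightarrow> real \<Rightarrow> 'b" where
  "zonal_profile F t = (THE v. \<forall>x\<in>sphere 0 1. pole \<bullet> x = t \<longrightarrow> F x = v)"

definition sphere_convolution ::
    "(real \<times> (real ^ 'n) \<Rightarrow> complex) \<Rightarrow> (real \<Rightarrow> complex) \<Rightarrow> real \<times> (real ^ 'n) \<Rightarrow> complex" where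
  "sphere_convolution f g x =
     1 / of_real (sphere_area ((real CARD('n) - 1) / 2)) *
       (LINT y|sphere_measure. f y * g (x \<bullet> y))"

lemma ex_sphere_pole_inner:
  assumes "t \<in> {-1..1}"
  shows "\<exists>x\<in>sphere 0 1. (pole :: real \<times> (real ^ 'n)) \<bullet> x = t"
proof -
  have "t\<^sup>2 \<le> 1" using assms by (simp add: abs_le_iff abs_square_le_1)
  then have "(t, axis undefined (sqrt (1 - t\<^sup>2))) \<in> sphere (0 :: real \<times> (real ^ 'n)) 1"
    by (simp add: norm_prod_def power2_norm_eq_inner inner_axis_axis flip: power2_eq_square)
  then show ?thesis
    by (rule bexI[rotated]) (simp add: pole_def)
qed

lemma zonal_profile_eq:
  fixes F :: "real \<times> (real ^ 'n) \<Rightarrow> 'b"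
  assumes z: "\<And>x y. \<lbrakk>x \<in> sphere 0 1; y \<in> sphere 0 1; pole \<bullet> x = pole \<bullet> y\<rbrakk> \<Longrightarrow> F x = F y"
    and x: "x \<in> sphere 0 1"
  shows "zonal_profile F (pole \<bullet> x) = F x"
  unfolding zonal_profile_def
proof (rule the_equality)
  show "\<forall>y\<in>sphere 0 1. pole \<bullet> y = pole \<bullet> x \<longrightarrow> F y = F x"
    using z x by blast
qed (use x in blast)

lemma zonal_profile_zonal:
  assumes "t \<in> {-1..1}"
  shows "zonal_profile (zonal g :: real \<times> (real ^ 'n) \<Rightarrow> 'b) t = g t"
proof -
  obtain x :: "real \<times> (real ^ 'n)" where x: "x \<in> sphere 0 1" "pole \<bullet> x = t"
    using ex_sphere_pole_inner[OF assms] by blast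
  show ?thesis
    using zonal_profile_eq[of "zonal g" x] x by (auto simp: zonal_def)
qed

lemma sphere_convolution_zonal:
  fixes x x' :: "real \<times> (real ^ 'n)"
  assumes x: "x \<in> sphere 0 1" "x' \<in> sphere 0 1" "pole \<bullet> x = pole \<bullet> x'"
    and meas: "h \<in> borel_measurable borel" "g \<in> borel_measurable borel"
  shows "sphere_convolution (zonal h) g x = sphere_convolution (zonal h) g x'"
proof -
  have fst_eq: "fst x = fst x'" using x(3) by (simp add: pole_def inner_prod_def)
  have "(norm x)\<^sup>2 = (norm x')\<^sup>2" using x by simp
  then have "norm (snd x) = norm (snd x')"
    using fst_eq by (simp add: norm_prod_def)
  then obtain k where k: "orthogonal_transformation k" "k (snd x) = snd x'"
    by (rule orthogonal_transformation_exists)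
  define f where "f = (\<lambda>y :: real \<times> (real ^ 'n). (fst y, k (snd y)))"
  have klin: "linear k" using k(1) by (rule orthogonal_transformation_linear)
  have f: "orthogonal_transformation f"
    unfolding orthogonal_transformation_def
  proof
    show "linear f"
      by (rule linearI) (simp_all add: f_def linear_add[OF klin] linear_scale[OF klin])
    show "\<forall>v w. f v \<bullet> f w = v \<bullet> w"
      using k(1) by (simp add: f_def inner_prod_def orthogonal_transformation_def)
  qed
  have fx: "f x = x'" using fst_eq k(2) by (simp add: f_def prod_eq_iff)
  have fin: "f v \<bullet> f w = v \<bullet> w" for v w using f unfolding orthogonal_transformation_def by blast
  have pf: "pole \<bullet> f y = pole \<bullet> y" for y by (simp add: f_def pole_def inner_prod_def)
  have nrm: "norm (f y) = norm y" for y using f by (rule orthogonal_transformation_norm)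
  have mf [measurable]: "f \<in> borel_measurable borel"
    using orthogonal_transformation_linear[OF f]
    by (intro borel_measurable_continuous_onI linear_continuous_on)
      (simp add: linear_conv_bounded_linear)
  have mfs: "f \<in> sphere_measure \<rightarrow>\<^sub>M sphere_measure"
  proof -
    have "f \<in> restrict_space borel (sphere 0 1) \<rightarrow>\<^sub>M restrict_space borel (sphere 0 1)"
      by (rule measurable_restrict_space3) (auto simp: nrm)
    then show ?thesis
      by (simp add: measurable_cong_sets[OF sets_sphere_measure sets_sphere_measure])
  qed
  have mi: "(\<lambda>y. zonal h y * g (x' \<bullet> y)) \<in> borel_measurable sphere_measure"
  proof -
    note [measurable] = meas
    have "(\<lambda>y. zonal h y * g (x' \<bullet> y)) \<in> borel_measurable borel"
      unfolding zonal_def by measurable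
    then have "(\<lambda>y. zonal h y * g (x' \<bullet> y)) \<in> borel_measurable (restrict_space borel (sphere 0 1))"
      by (rule measurable_restrict_space1)
    then show ?thesis
      by (simp add: measurable_cong_sets[OF sets_sphere_measure refl])
  qed
  have "(LINT y|sphere_measure. zonal h y * g (x' \<bullet> y)) =
      (LINT y|distr sphere_measure sphere_measure f. zonal h y * g (x' \<bullet> y))"
    by (simp add: sphere_measure_rotation_invariant[OF f])
  also have "\<dots> = (LINT y|sphere_measure. zonal h (f y) * g (x' \<bullet> f y))"
    by (rule integral_distr[OF mfs mi])
  also have "\<dots> = (LINT y|sphere_measure. zonal h y * g (x \<bullet> y))"
    by (simp add: zonal_def pf fx[symmetric] fin)
  finally show ?thesis by (simp add: sphere_convolution_def)
qed


section \<open>Gegenbauer polynomials and Poisson wavelets\<close>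

text \<open>
  Gegenbauer polynomials, defined on \<^term>\<open>{-1..1}\<close> as the coefficients of their generating function.
\<close>

definition gegenbauer :: "real \<Rightarrow> nat \<Rightarrow> real \<Rightarrow> real" where
  "gegenbauer lam l t =
     (THE c. \<forall>r. \<bar>r\<bar> < 1 \<longrightarrow> (\<lambda>k. c k * r ^ k) sums ((1 - 2 * t * r + r\<^sup>2) powr (- lam))) l"

lemma powser_coeffs_unique:
  fixes c d :: "nat \<Rightarrow> real"
  assumes c: "\<And>r. \<bar>r\<bar> < 1 \<Longrightarrow> (\<lambda>k. c k * r ^ k) sums F r"
    and d: "\<And>r. \<bar>r\<bar> < 1 \<Longrightarrow> (\<lambda>k. d k * r ^ k) sums F r"
  shows "c = d"
proof -
  define e where "e k = c k - d k" for k
  have e: "(\<lambda>k. e k * r ^ k) sums 0" if "\<bar>r\<bar> < 1" for r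
    using sums_diff[OF c[OF that] d[OF that]] by (simp add: e_def algebra_simps)
  have "e k = 0" for k
  proof (induction k rule: less_induct)
    case (less k)
    have s: "(\<lambda>j. e (j + k) * r ^ j) sums 0" if r: "\<bar>r\<bar> < 1" "r \<noteq> 0" for r
    proof -
      have "(\<lambda>j. e (j + k) * r ^ (j + k)) sums (0 - (\<Sum>i<k. e i * r ^ i))"
        by (subst sums_iff_shift) (use e[OF r(1)] in simp)
      also have "(\<Sum>i<k. e i * r ^ i) = 0" using less by simp
      finally have "(\<lambda>j. e (j + k) * r ^ (j + k) / r ^ k) sums (0 / r ^ k)"
        by (intro sums_divide) simp
      then show ?thesis using r by (simp add: power_add)
    qed
    have "((\<lambda>r :: real. 0 :: real) \<longlongrightarrow> e (0 + k)) (at 0)"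
      using powser_limit_0_strong[of 1 "\<lambda>j. e (j + k)" "\<lambda>_. 0"] s by auto
    then show ?case using tendsto_const_iff[of "at (0::real)" 0 "e k"] by simp
  qed
  then show ?thesis by (auto simp: e_def fun_eq_iff)
qed

lemma gegenbauer_generating_exists:
  fixes t lam :: real
  assumes t: "t \<in> {-1..1}"
  obtains c where "\<And>r. \<bar>r\<bar> < 1 \<Longrightarrow> (\<lambda>k. c k * r ^ k) sums ((1 - 2 * t * r + r\<^sup>2) powr (- lam))"
proof -
  define z where "z = cis (arccos t)"
  have nz: "norm z = 1" by (simp add: z_def)
  have Rez: "Re z = t" using t by (simp add: z_def)
  define a :: complex where "a = of_real (- lam)"
  define b where "b w k = (a gchoose k) * (- w) ^ k" for w k
  have pm: "(- (w * x)) ^ k = (- w) ^ k * x ^ k" for w x :: complex and k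
    by (metis mult_minus_left power_mult_distrib)
  define cc where "cc k = (\<Sum>i\<le>k. b z i * b (cnj z) (k - i))" for k
  have main: "(\<lambda>k. Re (cc k) * r ^ k) sums ((1 - 2 * t * r + r\<^sup>2) powr (- lam))"
    if r: "\<bar>r\<bar> < 1" for r
  proof -
    have ser: "(\<lambda>k. b w k * of_real r ^ k) sums (1 - w * of_real r) powr a"
      if "norm w = 1" for w
    proof -
      have "norm (- (w * of_real r)) < 1" using r that by (simp add: norm_mult)
      from gen_binomial_complex[OF this, of a] show ?thesis
        by (simp only: b_def pm mult.assoc add_uminus_conv_diff)
    qed
    have abs: "summable (\<lambda>k. norm (b w k * of_real r ^ k))" if "norm w = 1" for w
    proof -
      obtain s where s: "\<bar>r\<bar> < s" "s < 1" using r dense by blast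
      have "norm (- (w * of_real s)) < 1" using s that by (simp add: norm_mult)
      from gen_binomial_complex[OF this, of a]
      have "summable (\<lambda>k. b w k * of_real s ^ k)"
        by (simp only: b_def pm mult.assoc sums_iff)
      then show ?thesis by (rule powser_insidea) (use s in simp)
    qed
    have nz': "norm (cnj z) = 1" using nz by simp
    have "(\<lambda>k. \<Sum>i\<le>k. (b z i * of_real r ^ i) * (b (cnj z) (k - i) * of_real r ^ (k - i))) sums
       ((\<Sum>k. b z k * of_real r ^ k) * (\<Sum>k. b (cnj z) k * of_real r ^ k))"
      by (rule Cauchy_product_sums[OF abs[OF nz] abs[OF nz']])
    also have "(\<lambda>k. \<Sum>i\<le>k. (b z i * of_real r ^ i) * (b (cnj z) (k - i) * of_real r ^ (k - i))) =
       (\<lambda>k. cc k * of_real r ^ k)"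
    proof
      fix k
      have "(b z i * of_real r ^ i) * (b (cnj z) (k - i) * of_real r ^ (k - i)) =
          b z i * b (cnj z) (k - i) * of_real r ^ k" if "i \<le> k" for i
        using that power_add[of "complex_of_real r" i "k - i"] by simp
      then show "(\<Sum>i\<le>k. (b z i * of_real r ^ i) * (b (cnj z) (k - i) * of_real r ^ (k - i))) =
          cc k * of_real r ^ k"
        unfolding cc_def sum_distrib_right by (intro sum.cong) auto
    qed
    also have "(\<Sum>k. b z k * of_real r ^ k) = (1 - z * of_real r) powr a"
      using ser[OF nz] by (simp add: sums_iff)
    also have "(\<Sum>k. b (cnj z) k * of_real r ^ k) = (1 - cnj z * of_real r) powr a"
      using ser[OF nz'] by (simp add: sums_iff)
    also have "(1 - z * of_real r) powr a * (1 - cnj z * of_real r) powr a =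
        of_real ((1 - 2 * t * r + r\<^sup>2) powr (- lam))"
    proof -
      define w where "w = 1 - z * of_real r"
      have "norm (z * of_real r) < 1" using r nz by (simp add: norm_mult)
      then have Rew: "Re w > 0"
        using complex_Re_le_cmod[of "z * of_real r"] by (simp add: w_def)
      then have w0: "w \<noteq> 0" "w \<notin> \<real>\<^sub>\<le>\<^sub>0" by (auto simp: complex_nonpos_Reals_iff)
      have cw: "1 - cnj z * of_real r = cnj w" by (simp add: w_def)
      have zz: "(Re z)\<^sup>2 + (Im z)\<^sup>2 = 1" using nz by (metis cmod_power2 one_power2)
      have "(norm w)\<^sup>2 = 1 - 2 * Re z * r + ((Re z)\<^sup>2 + (Im z)\<^sup>2) * r\<^sup>2"
        by (simp add: w_def cmod_power2) (simp add: power2_eq_square algebra_simps)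
      then have nw: "(norm w)\<^sup>2 = 1 - 2 * t * r + r\<^sup>2" by (simp only: zz[unfolded Rez] Rez mult_1)
      have "w powr a * cnj w powr a = exp (a * (Ln w + cnj (Ln w)))"
        using w0 by (simp add: powr_def cnj_Ln[OF w0(2)] ring_distribs exp_add)
      also have "Ln w + cnj (Ln w) = of_real (2 * Re (Ln w))" by (rule complex_add_cnj)
      also have "Re (Ln w) = ln (norm w)" using w0 by simp
      also have "exp (a * of_real (2 * ln (norm w))) = of_real (exp (- lam * (2 * ln (norm w))))"
        by (simp add: a_def exp_of_real flip: of_real_mult of_real_minus)
      also have "exp (- lam * (2 * ln (norm w))) = ((norm w)\<^sup>2) powr (- lam)"
      proof -
        have "ln ((norm w)\<^sup>2) = 2 * ln (norm w)"
          using w0 ln_realpow[of "norm w" 2] by simp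
        moreover have "(norm w)\<^sup>2 \<noteq> 0" using w0 by simp
        ultimately show ?thesis unfolding powr_def by (simp only: if_False)
      qed
      finally show ?thesis unfolding nw cw w_def[symmetric] .
    qed
    finally have "(\<lambda>k. Re (cc k * of_real r ^ k)) sums
        Re (of_real ((1 - 2 * t * r + r\<^sup>2) powr (- lam)))"
      by (rule sums_Re)
    then show ?thesis by (simp flip: of_real_power)
  qed
  then show thesis by (rule that)
qed

lemma gegenbauer_generating:
  assumes t: "t \<in> {-1..1}" and r: "\<bar>r\<bar> < 1"
  shows "(\<lambda>l. gegenbauer lam l t * r ^ l) sums ((1 - 2 * t * r + r\<^sup>2) powr (- lam))"
proof -
  obtain c where c:
    "\<And>r. \<bar>r\<bar> < 1 \<Longrightarrow> (\<lambda>k. c k * r ^ k) sums ((1 - 2 * t * r + r\<^sup>2) powr (- lam))"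
    using gegenbauer_generating_exists[OF t, of lam] by blast
  have "(THE c. \<forall>r. \<bar>r\<bar> < 1 \<longrightarrow> (\<lambda>k. c k * r ^ k) sums ((1 - 2 * t * r + r\<^sup>2) powr (- lam))) = c"
  proof (rule the_equality)
    fix d assume "\<forall>r. \<bar>r\<bar> < 1 \<longrightarrow> (\<lambda>k. d k * r ^ k) sums ((1 - 2 * t * r + r\<^sup>2) powr (- lam))"
    then show "d = c"
      using powser_coeffs_unique[of d "\<lambda>r. (1 - 2 * t * r + r\<^sup>2) powr (- lam)" c] c by simp
  qed (use c in blast)
  then show ?thesis using c[OF r] by (simp add: gegenbauer_def)
qed

definition gegenbauer_kernel :: "real \<Rightarrow> nat \<Rightarrow> real \<Rightarrow> real" where
  "gegenbauer_kernel lam l t = (lam + real l) / lam * gegenbauer lam l t"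

definition poisson_psi :: "nat \<Rightarrow> real \<Rightarrow> real" where
  "poisson_psi m t = 2 ^ m / sqrt (Gamma (2 * real m)) * t ^ m * exp (- t)"

definition poisson_wavelet :: "real \<Rightarrow> nat \<Rightarrow> real \<Rightarrow> real \<Rightarrow> complex" where
  "poisson_wavelet lam m a t =
     (\<Sum>l. complex_of_real (poisson_psi m (a * real l) * gegenbauer_kernel lam l t))"

lemma summable_poisson_wavelet:
  assumes t: "t \<in> {-1..1}" and a: "a > 0"
  shows "summable (\<lambda>l. norm (complex_of_real (poisson_psi m (a * real l) * gegenbauer_kernel lam l t)))"
proof -
  define q s where "q = exp (- a / 2)" and "s = exp (- a / 4)"
  have q: "0 < q" "q < s" "s < 1" using a by (auto simp: q_def s_def)
  define K where "K = 2 ^ m / sqrt (Gamma (2 * real m))"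
  have "summable (\<lambda>l. gegenbauer lam l t * s ^ l)"
    using gegenbauer_generating[OF t, of s] q by (simp add: sums_iff)
  then have sq: "summable (\<lambda>l. norm (gegenbauer lam l t * q ^ l))"
    by (rule powser_insidea) (use q in simp)
  have lim: "(\<lambda>l. K * (a * real l) ^ m * ((lam + real l) / lam) * q ^ l) \<longlonglongrightarrow> 0"
  proof -
    have p: "(\<lambda>l. real l ^ j * q ^ l) \<longlonglongrightarrow> 0" for j
    proof -
      have "filterlim (\<lambda>l::nat. a / 2 * real l) at_top sequentially"
        using a by (intro filterlim_tendsto_pos_mult_at_top[OF tendsto_const] filterlim_real_sequentially) simp
      from tendsto_mult_left[OF filterlim_compose[OF tendsto_power_div_exp_0[of j] this], of "(2 / a) ^ j"]
      have "(\<lambda>l. (2 / a) ^ j * ((a / 2 * real l) ^ j / exp (a / 2 * real l))) \<longlonglongrightarrow> 0"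
        by simp
      also have "(\<lambda>l. (2 / a) ^ j * ((a / 2 * real l) ^ j / exp (a / 2 * real l))) =
          (\<lambda>l. real l ^ j * q ^ l)"
      proof
        fix l :: nat
        have "q ^ l = exp (real l * (- a / 2))"
          unfolding q_def by (rule exp_of_nat_mult[symmetric])
        also have "\<dots> = inverse (exp (a / 2 * real l))"
          unfolding exp_minus[symmetric] by (simp add: mult.commute)
        finally have ql: "q ^ l = inverse (exp (a / 2 * real l))" .
        have "(2 / a) ^ j * (a / 2 * real l) ^ j = (2 / a * (a / 2 * real l)) ^ j"
          by (rule power_mult_distrib[symmetric])
        also have "2 / a * (a / 2 * real l) = real l" using a by simp
        finally have "(2 / a) ^ j * (a / 2 * real l) ^ j = real l ^ j" .
        then show "(2 / a) ^ j * ((a / 2 * real l) ^ j / exp (a / 2 * real l)) = real l ^ j * q ^ l"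
          unfolding ql divide_inverse mult.assoc[symmetric] by simp
      qed
      finally show ?thesis .
    qed
    have "(\<lambda>l. K * a ^ m * (lam / lam * (real l ^ m * q ^ l) + 1 / lam * (real l ^ Suc m * q ^ l)))
      \<longlonglongrightarrow> K * a ^ m * (lam / lam * 0 + 1 / lam * 0)"
      by (intro tendsto_intros p)
    moreover have "K * a ^ m * (lam / lam * (real l ^ m * q ^ l) + 1 / lam * (real l ^ Suc m * q ^ l)) =
        K * (a * real l) ^ m * ((lam + real l) / lam) * q ^ l" for l
      unfolding power_mult_distrib add_divide_distrib by (simp add: ring_distribs)
    ultimately show ?thesis by simp
  qed
  then have "Bseq (\<lambda>l. K * (a * real l) ^ m * ((lam + real l) / lam) * q ^ l)"
    by (intro convergent_imp_Bseq convergentI)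
  then obtain B where B: "\<And>l. norm (K * (a * real l) ^ m * ((lam + real l) / lam) * q ^ l) \<le> B"
    by (auto simp: Bseq_def)
  show ?thesis
  proof (rule summable_comparison_test')
    show "summable (\<lambda>l. B * norm (gegenbauer lam l t * q ^ l))"
      using sq by (rule summable_mult)
    fix l :: nat
    have "q ^ l * q ^ l = (q * q) ^ l"
      by (rule power_mult_distrib[symmetric])
    also have "q * q = exp (- a)"
      unfolding q_def exp_add[symmetric] by simp
    also have "exp (- a) ^ l = exp (real l * (- a))"
      by (rule exp_of_nat_mult[symmetric])
    finally have e: "exp (- (a * real l)) = q ^ l * q ^ l"
      by (simp add: mult.commute)
    have "poisson_psi m (a * real l) * gegenbauer_kernel lam l t =
      (K * (a * real l) ^ m * ((lam + real l) / lam) * q ^ l) * (gegenbauer lam l t * q ^ l)"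
      by (simp add: poisson_psi_def gegenbauer_kernel_def K_def e)
    then have "\<bar>poisson_psi m (a * real l) * gegenbauer_kernel lam l t\<bar> =
        \<bar>K * (a * real l) ^ m * ((lam + real l) / lam) * q ^ l\<bar> * \<bar>gegenbauer lam l t * q ^ l\<bar>"
      by (simp only: abs_mult)
    also have "\<dots> \<le> B * \<bar>gegenbauer lam l t * q ^ l\<bar>"
      using B[of l] by (intro mult_right_mono) (simp_all only: real_norm_def abs_ge_zero)
    finally show "norm (norm (complex_of_real (poisson_psi m (a * real l) * gegenbauer_kernel lam l t)))
        \<le> B * norm (gegenbauer lam l t * q ^ l)"
      by (simp only: norm_of_real real_norm_def abs_abs)
  qed
qed

end

theory Submission
  imports Defs
begin

text \<open>
  Write \<open>p\<^sub>r(t) = (1 - r\<^sup>2) (1 - 2tr + r\<^sup>2)\<^bsup>-\<lambda>-1\<^esup>\<close> for the Poisson density. Its expansion in powers of \<open>r\<close>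
  has the kernels \<open>K\<^sub>l\<close> of the wavelets as coefficients (\<open>gegenbauer_kernel_sums\<close>), and everything
  below is read off from \<open>p\<^sub>r\<close>.

  \<^emph>\<open>The convolution.\<close> For a unit vector \<open>y\<close>, the function \<open>r x \<mapsto> p\<^sub>r(x \<bullet> y)\<close> is the Poisson kernel of the
  unit ball, \<open>(1 - |z|\<^sup>2) |z - y|\<^bsup>-n-1\<^esup>\<close>. It is harmonic in \<open>z\<close>, has mean one and concentrates at the
  boundary point, so by the maximum principle it reproduces every harmonic function that is
  continuous on the closed ball (\<open>poisson_integral_formula\<close>). Applied to a dilated Poisson kernel this
  says \<open>p\<^sub>r * p\<^sub>s = p\<^sub>r\<^sub>s\<close>, and comparing coefficients in \<open>r\<close> and \<open>s\<close> gives \<open>K\<^sub>l * K\<^sub>k = 0\<close> for \<open>l \<noteq> k\<close> and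
  \<open>K\<^sub>l * K\<^sub>l = K\<^sub>l\<close> (\<open>gegenbauer_kernel_convolution\<close>). Hence the wavelet at scale \<open>a\<close>, convolved with its
  conjugate, is \<open>\<Sum>\<^sub>l \<psi>(al)\<^sup>2 K\<^sub>l\<close>.

  \<^emph>\<open>The integral over scales.\<close> Since \<open>\<psi>(s)\<^sup>2 / s\<close> is a Gamma density of integral order \<open>2m\<close>, for \<open>l > 0\<close> the
  integral of \<open>\<psi>(al)\<^sup>2 / a\<close> over \<open>a \<ge> R\<close> is \<open>e\<^bsup>-\<rho>l\<^esup> \<Sum>\<^sub>k\<^sub><\<^sub>2\<^sub>m (\<rho>l)\<^sup>k / k!\<close> with \<open>\<rho> = 2R\<close>; its value 1 at
  \<open>R = 0\<close>, \<open>l = 1\<close> is the admissibility condition. The integral over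
  scales is therefore, up to the missing term \<open>l = 0\<close>, a combination of the \<open>2m\<close> functions \<open>S\<^sub>k = \<rho>\<^sup>k \<Sum>\<^sub>l l\<^sup>k e\<^bsup>-\<rho>l\<^esup> K\<^sub>l\<close>.

  \<^emph>\<open>The uniform bound.\<close> Each \<open>S\<^sub>k\<close> is \<open>\<rho>\<^sup>k\<close> times \<open>(r \<partial>\<^sub>r)\<^sup>k p\<^sub>r\<close> at \<open>r = e\<^bsup>-\<rho>\<^esup>\<close>. The logarithmic derivative of \<open>p\<^sub>r\<close> has
  a power series in \<open>r\<close> with coefficients bounded uniformly in \<open>t\<close>, so for \<open>k \<ge> 1\<close> the function
  \<open>(r \<partial>\<^sub>r)\<^sup>k p\<^sub>r\<close> is \<open>p\<^sub>r\<close> times a series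
  whose \<open>l\<close>-th coefficient is \<open>O(l\<^bsup>k-1\<^esup>)\<close>, and this factor is \<open>O(\<rho>\<^bsup>-k\<^esup>)\<close>. Thus \<open>|S\<^sub>k| \<le> C\<^sub>k p\<^sub>r\<close> pointwise
  (\<open>gegenbauer_kernel_series_bound\<close>). Finally, as \<open>1 - t\<^sup>2 \<le> 1 - 2tr + r\<^sup>2\<close> and \<open>\<lambda> \<ge> 1/2\<close>,
  the Poisson density times the weight is at most \<open>(1 - r\<^sup>2) (1 - 2tr + r\<^sup>2)\<^bsup>-3/2\<^esup>\<close>, whose integral over \<open>[-1, 1]\<close> equals 2 for every \<open>r\<close>.
\<close>

section \<open>The maximum principle for discrete Laplacians\<close>

text \<open>
  Taylor's formula with Lagrange remainder at \<open>h\<close> and at \<open>-h\<close>; the first-order terms cancel.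
\<close>

lemma second_difference_mean_value:
  fixes f f' f'' :: "real \<Rightarrow> real"
  assumes h: "h \<noteq> 0"
    and f: "\<And>x. \<bar>x\<bar> \<le> \<bar>h\<bar> \<Longrightarrow> (f has_real_derivative f' x) (at x)"
    and f': "\<And>x. \<bar>x\<bar> \<le> \<bar>h\<bar> \<Longrightarrow> (f' has_real_derivative f'' x) (at x)"
  obtains \<xi> \<eta> where "\<bar>\<xi>\<bar> \<le> \<bar>h\<bar>" "\<bar>\<eta>\<bar> \<le> \<bar>h\<bar>"
    "(f h + f (- h) - 2 * f 0) / h\<^sup>2 = (f'' \<xi> + f'' \<eta>) / 2"
proof -
  define d where "d = (\<lambda>m::nat. if m = 0 then f else if m = 1 then f' else f'')"
  have T: "\<exists>\<xi>. \<bar>\<xi>\<bar> \<le> \<bar>h\<bar> \<and> f x = f 0 + f' 0 * x + f'' \<xi> / 2 * x\<^sup>2" if x: "x \<noteq> 0" "\<bar>x\<bar> = \<bar>h\<bar>" for x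
  proof -
    have "\<exists>t. (if x < 0 then x < t \<and> t < 0 else 0 < t \<and> t < x) \<and>
      f x = (\<Sum>m<2. d m 0 / fact m * (x - 0) ^ m) + d 2 t / fact 2 * (x - 0) ^ 2"
    proof (rule Taylor[where a = "- \<bar>h\<bar>" and b = "\<bar>h\<bar>"])
      show "\<forall>m t. m < 2 \<and> - \<bar>h\<bar> \<le> t \<and> t \<le> \<bar>h\<bar> \<longrightarrow> (d m has_real_derivative d (Suc m) t) (at t)"
        using f f' by (auto simp: d_def less_2_cases_iff abs_le_iff)
    qed (use x in \<open>auto simp: d_def\<close>)
    then obtain t where t: "if x < 0 then x < t \<and> t < 0 else 0 < t \<and> t < x"
      "f x = (\<Sum>m<2. d m 0 / fact m * (x - 0) ^ m) + d 2 t / fact 2 * (x - 0) ^ 2" by blast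
    have "\<bar>t\<bar> \<le> \<bar>h\<bar>" using t(1) x by (auto split: if_splits)
    moreover have "f x = f 0 + f' 0 * x + f'' t / 2 * x\<^sup>2"
      using t(2) by (simp add: d_def numeral_2_eq_2)
    ultimately show ?thesis by blast
  qed
  obtain \<xi> where xi: "\<bar>\<xi>\<bar> \<le> \<bar>h\<bar>" "f h = f 0 + f' 0 * h + f'' \<xi> / 2 * h\<^sup>2" using T[of h] h by auto
  obtain \<eta> where et: "\<bar>\<eta>\<bar> \<le> \<bar>h\<bar>" "f (- h) = f 0 + f' 0 * (- h) + f'' \<eta> / 2 * (- h)\<^sup>2"
    using T[of "- h"] h by auto
  have "(f h + f (- h) - 2 * f 0) / h\<^sup>2 = (f'' \<xi> + f'' \<eta>) / 2"
    unfolding xi(2) et(2) using h by (simp add: field_simps)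
  then show thesis by (rule that[OF xi(1) et(1)])
qed

text \<open>
  Harmonicity is expressed through second difference quotients instead of second derivatives: these
  commute with integration over a parameter as they stand, and their vanishing in the limit is all
  that the maximum principle uses.
\<close>

definition diff_laplacian :: "('a::euclidean_space \<Rightarrow> real) \<Rightarrow> 'a \<Rightarrow> real \<Rightarrow> real" where
  "diff_laplacian u z h = (\<Sum>b\<in>Basis. (u (z + h *\<^sub>R b) + u (z - h *\<^sub>R b) - 2 * u z) / h\<^sup>2)"

definition harmonic_at :: "('a::euclidean_space \<Rightarrow> real) \<Rightarrow> 'a \<Rightarrow> bool" where
  "harmonic_at u z \<longleftrightarrow> (diff_laplacian u z \<longlongrightarrow> 0) (at 0)"

lemma harmonic_at_const: "harmonic_at (\<lambda>_. c) z"
  by (simp add: harmonic_at_def diff_laplacian_def[abs_def])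

lemma harmonic_at_cmult:
  assumes "harmonic_at u z" shows "harmonic_at (\<lambda>x. c * u x) z"
proof -
  have "diff_laplacian (\<lambda>x. c * u x) z = (\<lambda>h. c * diff_laplacian u z h)"
    by (auto simp: diff_laplacian_def sum_distrib_left algebra_simps intro!: sum.cong)
  then show ?thesis using tendsto_mult_left[of _ 0 _ c] assms by (auto simp: harmonic_at_def)
qed

lemma harmonic_at_diff:
  assumes "harmonic_at u z" "harmonic_at v z" shows "harmonic_at (\<lambda>x. u x - v x) z"
proof -
  have "diff_laplacian (\<lambda>x. u x - v x) z = (\<lambda>h. diff_laplacian u z h - diff_laplacian v z h)"
    unfolding diff_laplacian_def fun_eq_iff sum_subtractf[symmetric] diff_divide_distrib[symmetric]
    by (simp add: algebra_simps)
  then show ?thesis using tendsto_diff[of _ 0 _ _ 0] assms by (auto simp: harmonic_at_def)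
qed

text \<open>
  At an interior maximum of \<open>u + \<delta> |z|\<^sup>2\<close> every second difference is nonpositive, so the discrete
  Laplacian of \<open>u\<close> would be at most \<open>- 2 \<delta> DIM\<close> for all small \<open>h\<close>. The perturbed function thus attains its maximum on the
  boundary sphere; then let \<open>\<delta>\<close> tend to zero.
\<close>

lemma harmonic_maximum_principle:
  fixes u :: "'a::euclidean_space \<Rightarrow> real"
  assumes cont: "continuous_on (cball 0 \<rho>) u"
    and harm: "\<And>z. norm z < \<rho> \<Longrightarrow> harmonic_at u z"
    and bd: "\<And>z. norm z = \<rho> \<Longrightarrow> u z \<le> c"
    and z: "norm z \<le> \<rho>"
  shows "u z \<le> c"
proof -
  have main: "u z \<le> c + \<delta> * \<rho>\<^sup>2" if d: "\<delta> > 0" for \<delta>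
  proof -
    define v where "v w = u w + \<delta> * (w \<bullet> w)" for w
    have "continuous_on (cball 0 \<rho>) v" unfolding v_def by (intro continuous_intros cont)
    moreover have "cball (0::'a) \<rho> \<noteq> {}" using z by (auto simp: cball_eq_empty not_less intro: order_trans[OF norm_ge_zero])
    ultimately obtain z0 where z0: "z0 \<in> cball 0 \<rho>" "\<And>w. w \<in> cball 0 \<rho> \<Longrightarrow> v w \<le> v z0"
      using continuous_attains_sup[OF compact_cball] by blast
    have "norm z0 = \<rho>"
    proof (rule ccontr)
      assume "norm z0 \<noteq> \<rho>"
      then have n: "norm z0 < \<rho>" using z0 by simp
      have "\<forall>\<^sub>F h in at 0. diff_laplacian u z0 h > - (2 * \<delta> * real DIM('a))"
        using harm[OF n] d unfolding harmonic_at_def by (intro order_tendstoD(1)) auto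
      moreover have "\<forall>\<^sub>F h in at 0. \<bar>h\<bar> < \<rho> - norm z0"
        using n by (intro order_tendstoD(2)[of _ 0] tendsto_rabs_zero tendsto_ident_at) auto
      moreover have "\<forall>\<^sub>F h::real in at 0. h \<noteq> 0" by (rule eventually_neq_at_within)
      ultimately have "\<forall>\<^sub>F h::real in at 0. False"
      proof eventually_elim
        case (elim h)
        have "(u (z0 + h *\<^sub>R b) + u (z0 - h *\<^sub>R b) - 2 * u z0) / h\<^sup>2 \<le> - (2 * \<delta>)" if b: "b \<in> Basis" for b
        proof -
          have "norm (z0 + h *\<^sub>R b) \<le> \<rho>" "norm (z0 - h *\<^sub>R b) \<le> \<rho>"
            using norm_triangle_ineq[of z0 "h *\<^sub>R b"] norm_triangle_ineq4[of z0 "h *\<^sub>R b"] elim b by auto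
          then have "v (z0 + h *\<^sub>R b) \<le> v z0" "v (z0 - h *\<^sub>R b) \<le> v z0" by (auto intro: z0)
          moreover have "b \<bullet> b = 1" using b by simp
          ultimately have "u (z0 + h *\<^sub>R b) + u (z0 - h *\<^sub>R b) - 2 * u z0 \<le> - (2 * \<delta>) * h\<^sup>2"
            by (simp add: v_def algebra_simps power2_eq_square)
          then show ?thesis using elim by (simp add: divide_le_eq)
        qed
        then have "diff_laplacian u z0 h \<le> (\<Sum>b\<in>(Basis::'a set). - (2 * \<delta>))"
          unfolding diff_laplacian_def by (rule sum_mono)
        then show False using elim by (simp add: mult_ac)
      qed
      then show False by simp
    qed
    then have "v z0 \<le> c + \<delta> * \<rho>\<^sup>2" using bd by (simp add: v_def dot_square_norm)
    moreover have "u z \<le> v z" using d by (simp add: v_def)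
    moreover have "v z \<le> v z0" using z by (intro z0) simp
    ultimately show ?thesis by linarith
  qed
  show ?thesis
  proof (rule field_le_epsilon)
    fix e :: real assume e: "e > 0"
    have "u z \<le> c + e / (\<rho>\<^sup>2 + 1) * \<rho>\<^sup>2" by (rule main) (use e in \<open>auto intro!: divide_pos_pos add_nonneg_pos\<close>)
    also have "e / (\<rho>\<^sup>2 + 1) * \<rho>\<^sup>2 \<le> e"
    proof -
      have "e * \<rho>\<^sup>2 \<le> e * (\<rho>\<^sup>2 + 1)" using e by (intro mult_left_mono) auto
      moreover have "\<rho>\<^sup>2 + 1 > 0" by (intro add_nonneg_pos) auto
      ultimately show ?thesis by (simp add: divide_le_eq)
    qed
    finally show "u z \<le> c + e" by simp
  qed
qed

section \<open>The Poisson kernel of the ball\<close>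

text \<open>
  The Poisson kernel \<open>(1 - |z|\<^sup>2) / |z - y|\<^bsup>DIM\<^esup>\<close> of the unit ball. The real exponent matches the one
  in the generating function of the Gegenbauer polynomials.
\<close>

definition ball_kernel :: "'a::euclidean_space \<Rightarrow> 'a \<Rightarrow> real" where
  "ball_kernel z y = (1 - z \<bullet> z) * ((z - y) \<bullet> (z - y)) powr (- (real DIM('a) / 2))"

text \<open>
  The first and second derivatives of the Poisson kernel in the direction of a unit vector \<open>b\<close>.
\<close>

definition ball_kernel_deriv :: "'a::euclidean_space \<Rightarrow> 'a \<Rightarrow> 'a \<Rightarrow> real" where
  "ball_kernel_deriv b z y = (let q = real DIM('a) / 2; B = (z - y) \<bullet> (z - y) in
     - 2 * (z \<bullet> b) * B powr (- q) - 2 * q * (1 - z \<bullet> z) * ((z - y) \<bullet> b) * B powr (- q - 1))"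

definition ball_kernel_deriv2 :: "'a::euclidean_space \<Rightarrow> 'a \<Rightarrow> 'a \<Rightarrow> real" where
  "ball_kernel_deriv2 b z y = (let q = real DIM('a) / 2; B = (z - y) \<bullet> (z - y) in
     - 2 * B powr (- q) + 8 * q * (z \<bullet> b) * ((z - y) \<bullet> b) * B powr (- q - 1)
     - 2 * q * (1 - z \<bullet> z) * B powr (- q - 1)
     + 4 * q * (q + 1) * (1 - z \<bullet> z) * ((z - y) \<bullet> b)\<^sup>2 * B powr (- q - 2))"

lemma has_real_derivative_inner_line:
  fixes z y b :: "'a::euclidean_space"
  shows "((\<lambda>x. (z + x *\<^sub>R b) \<bullet> b) has_real_derivative b \<bullet> b) (at x)"
    and "((\<lambda>x. (z + x *\<^sub>R b - y) \<bullet> b) has_real_derivative b \<bullet> b) (at x)"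
    and "((\<lambda>x. 1 - (z + x *\<^sub>R b) \<bullet> (z + x *\<^sub>R b)) has_real_derivative - (2 * ((z + x *\<^sub>R b) \<bullet> b))) (at x)"
    and "z + x *\<^sub>R b \<noteq> y \<Longrightarrow>
      ((\<lambda>x. ((z + x *\<^sub>R b - y) \<bullet> (z + x *\<^sub>R b - y)) powr c) has_real_derivative
        2 * c * ((z + x *\<^sub>R b - y) \<bullet> b) * ((z + x *\<^sub>R b - y) \<bullet> (z + x *\<^sub>R b - y)) powr (c - 1)) (at x)"
proof -
  show "((\<lambda>x. (z + x *\<^sub>R b) \<bullet> b) has_real_derivative b \<bullet> b) (at x)"
    unfolding has_field_derivative_def
    by (rule has_derivative_eq_rhs, (rule derivative_intros)+) (auto simp: mult.commute)
  show "((\<lambda>x. (z + x *\<^sub>R b - y) \<bullet> b) has_real_derivative b \<bullet> b) (at x)"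
    unfolding has_field_derivative_def
    by (rule has_derivative_eq_rhs, (rule derivative_intros)+) (auto simp: mult.commute)
  show "((\<lambda>x. 1 - (z + x *\<^sub>R b) \<bullet> (z + x *\<^sub>R b)) has_real_derivative - (2 * ((z + x *\<^sub>R b) \<bullet> b))) (at x)"
    unfolding has_field_derivative_def
    by (rule has_derivative_eq_rhs, (rule derivative_intros)+) (auto simp: inner_commute algebra_simps)
  assume ne: "z + x *\<^sub>R b \<noteq> y"
  have "((\<lambda>x. (z + x *\<^sub>R b - y) \<bullet> (z + x *\<^sub>R b - y)) has_real_derivative 2 * ((z + x *\<^sub>R b - y) \<bullet> b)) (at x)"
    unfolding has_field_derivative_def
    by (rule has_derivative_eq_rhs, (rule derivative_intros)+) (auto simp: inner_commute algebra_simps)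
  from DERIV_fun_powr[OF this, of c] ne
  show "((\<lambda>x. ((z + x *\<^sub>R b - y) \<bullet> (z + x *\<^sub>R b - y)) powr c) has_real_derivative
        2 * c * ((z + x *\<^sub>R b - y) \<bullet> b) * ((z + x *\<^sub>R b - y) \<bullet> (z + x *\<^sub>R b - y)) powr (c - 1)) (at x)"
    by (simp add: mult_ac)
qed

lemma ball_kernel_has_deriv:
  fixes z y b :: "'a::euclidean_space"
  assumes ne: "z + x *\<^sub>R b \<noteq> y"
  shows "((\<lambda>x. ball_kernel (z + x *\<^sub>R b) y) has_real_derivative ball_kernel_deriv b (z + x *\<^sub>R b) y) (at x)"
proof -
  have alg: "- (2 * wb) * p0 + 2 * - q * wy * p1 * A = - 2 * wb * p0 - 2 * q * A * wy * p1"
    for wb p0 q wy p1 A :: real by (simp add: algebra_simps)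
  note D = has_real_derivative_inner_line(3)
  note P = has_real_derivative_inner_line(4)[OF ne]
  show ?thesis
    unfolding ball_kernel_def ball_kernel_deriv_def Let_def
    by (rule DERIV_cong[OF DERIV_mult[OF D P] alg])
qed

lemma ball_kernel_deriv_has_deriv:
  fixes z y b :: "'a::euclidean_space"
  assumes ne: "z + x *\<^sub>R b \<noteq> y" and b: "b \<in> Basis"
  shows "((\<lambda>x. ball_kernel_deriv b (z + x *\<^sub>R b) y) has_real_derivative ball_kernel_deriv2 b (z + x *\<^sub>R b) y) (at x)"
proof -
  have bb: "b \<bullet> b = 1" using b by simp
  define q where "q = real DIM('a) / 2"
  have e: "- q - 1 - 1 = - q - 2" by simp
  have alg: "- 2 * 1 * p0 + 2 * - q * wy * p1 * (- 2 * wb)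
      - ((2 * q * - (2 * wb) * wy + 1 * (2 * q * A)) * p1 + 2 * (- q - 1) * wy * p2 * (2 * q * A * wy))
     = - 2 * p0 + 8 * q * wb * wy * p1 - 2 * q * A * p1 + 4 * q * (q + 1) * A * wy\<^sup>2 * p2"
    for wb p0 wy p1 p2 A :: real by (simp add: algebra_simps power2_eq_square)
  note L = has_real_derivative_inner_line(1,2)[where b = b, unfolded bb]
  note A = has_real_derivative_inner_line(3)[of z b x]
  note P = has_real_derivative_inner_line(4)[OF ne]
  show ?thesis
    unfolding ball_kernel_deriv_def ball_kernel_deriv2_def Let_def q_def[symmetric]
    by (rule DERIV_cong[OF DERIV_diff[OF DERIV_mult[OF DERIV_cmult[OF L(1), of "- 2"] P[of "- q"]]
        DERIV_mult[OF DERIV_mult[OF DERIV_cmult[OF A, of "2 * q"] L(2)[of _ _ x]] P[of "- q - 1"]]]])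
      (simp only: e alg)
qed

text \<open>
  With \<open>B = |z - y|\<^sup>2\<close> and \<open>q = DIM / 2\<close> the sum is \<open>4 q B\<^bsup>-q-1\<^esup> (- B + 2 z \<bullet> (z - y) + 1 - |z|\<^sup>2)\<close>, and the
  bracket vanishes because \<open>|y| = 1\<close>.
\<close>

lemma ball_kernel_laplacian:
  fixes z y :: "'a::euclidean_space"
  assumes ne: "z \<noteq> y" and y: "norm y = 1"
  shows "(\<Sum>b\<in>Basis. ball_kernel_deriv2 b z y) = 0"
proof -
  define q where "q = real DIM('a) / 2"
  define B where "B = (z - y) \<bullet> (z - y)"
  have B: "B > 0" using ne by (simp add: B_def)
  have yy: "y \<bullet> y = 1" using y by (simp add: dot_square_norm)
  have s1: "(\<Sum>b\<in>Basis. (z \<bullet> b) * ((z - y) \<bullet> b)) = z \<bullet> (z - y)"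
    by (rule euclidean_inner[symmetric])
  have s2: "(\<Sum>b\<in>Basis. ((z - y) \<bullet> b)\<^sup>2) = B"
    unfolding B_def power2_eq_square by (rule euclidean_inner[symmetric])
  have p2: "B powr (- q - 2) = B powr (- q - 1) / B"
  proof -
    have "- q - 2 = - q - 1 - 1" by simp
    then show ?thesis using B by (simp only: powr_diff powr_one)
  qed
  have p1: "B powr (- q) = B * B powr (- q - 1)"
    using B by (simp add: powr_diff)
  have "(\<Sum>b\<in>Basis. ball_kernel_deriv2 b z y) =
      - 2 * B powr (- q) * (2 * q) + 8 * q * B powr (- q - 1) * (\<Sum>b\<in>Basis. (z \<bullet> b) * ((z - y) \<bullet> b))
      - 2 * q * (1 - z \<bullet> z) * B powr (- q - 1) * (2 * q)
      + 4 * q * (q + 1) * (1 - z \<bullet> z) * B powr (- q - 2) * (\<Sum>b\<in>Basis. ((z - y) \<bullet> b)\<^sup>2)"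
    unfolding ball_kernel_deriv2_def Let_def q_def[symmetric] B_def[symmetric]
    by (simp add: sum.distrib sum_subtractf sum_distrib_left sum_distrib_right q_def mult_ac)
  also have "\<dots> = 4 * q * B powr (- q - 1) * (- B + 2 * (z \<bullet> (z - y)) + (1 - z \<bullet> z))"
    unfolding s1 s2 p2 p1 using B by (simp add: field_simps)
  also have "- B + 2 * (z \<bullet> (z - y)) + (1 - z \<bullet> z) = 0"
    by (simp add: B_def yy inner_diff_left inner_diff_right inner_commute)
  finally show ?thesis by simp
qed

lemma ball_sphere_neq:
  assumes "norm w < 1" "norm y = 1" shows "w \<noteq> y"
  using assms by auto

lemma continuous_on_ball_kernel_deriv2:
  fixes b :: "'a::euclidean_space"
  assumes "\<rho> < 1"
  shows "continuous_on (cball 0 \<rho> \<times> sphere 0 1) (\<lambda>(w, y). ball_kernel_deriv2 b w y)"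
  unfolding ball_kernel_deriv2_def Let_def split_beta
  using assms by (intro continuous_intros) auto

lemma continuous_on_ball_kernel:
  assumes "\<rho> < 1"
  shows "continuous_on (cball 0 \<rho> \<times> sphere (0::'a::euclidean_space) 1) (\<lambda>(w, y). ball_kernel w y)"
  unfolding ball_kernel_def split_beta
  using assms by (intro continuous_intros) auto

text \<open>
  Uniformity in \<open>y\<close>, which lets the limit pass under the integral over the sphere, comes from uniform
  continuity of the second derivatives on the product of a smaller closed ball and the sphere.
\<close>

lemma ball_kernel_laplacian_uniform:
  fixes z :: "'a::euclidean_space"
  assumes z: "norm z < 1" and e: "\<epsilon> > 0"
  shows "\<forall>\<^sub>F h in at 0. \<forall>y\<in>sphere 0 1. \<bar>diff_laplacian (\<lambda>w. ball_kernel w y) z h\<bar> \<le> \<epsilon>"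
proof -
  define \<rho> where "\<rho> = (1 + norm z) / 2"
  have \<rho>: "norm z < \<rho>" "\<rho> < 1" using z by (auto simp: \<rho>_def)
  let ?S = "cball 0 \<rho> \<times> sphere (0::'a) 1"
  let ?T = "\<lambda>b y h. (ball_kernel (z + h *\<^sub>R b) y + ball_kernel (z - h *\<^sub>R b) y - 2 * ball_kernel z y) / h\<^sup>2"
  define \<epsilon>' where "\<epsilon>' = \<epsilon> / real DIM('a)"
  have e': "\<epsilon>' > 0" using e by (simp add: \<epsilon>'_def)
  have "\<forall>\<^sub>F h in at 0. \<forall>y\<in>sphere 0 1. \<bar>?T b y h - ball_kernel_deriv2 b z y\<bar> \<le> \<epsilon>'" if b: "b \<in> Basis" for b
  proof -
    have "uniformly_continuous_on ?S (\<lambda>(w, y). ball_kernel_deriv2 b w y)"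
      by (intro compact_uniformly_continuous continuous_on_ball_kernel_deriv2 \<rho> compact_Times) auto
    then obtain d where d: "d > 0"
      "\<And>p p'. p \<in> ?S \<Longrightarrow> p' \<in> ?S \<Longrightarrow> dist p' p < d \<Longrightarrow>
        dist ((\<lambda>(w, y). ball_kernel_deriv2 b w y) p') ((\<lambda>(w, y). ball_kernel_deriv2 b w y) p) < \<epsilon>'"
      using e' unfolding uniformly_continuous_on_def by metis
    have "\<forall>\<^sub>F h in at 0. \<bar>h\<bar> < min d (\<rho> - norm z)"
      using d \<rho> by (intro order_tendstoD(2)[of _ 0] tendsto_rabs_zero tendsto_ident_at) auto
    moreover have "\<forall>\<^sub>F h::real in at 0. h \<noteq> 0" by (rule eventually_neq_at_within)
    ultimately show ?thesis
    proof eventually_elim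
      case (elim h)
      show ?case
      proof
        fix y :: 'a assume y: "y \<in> sphere 0 1"
        have n: "norm (z + x *\<^sub>R b) < \<rho>" if "\<bar>x\<bar> \<le> \<bar>h\<bar>" for x
          using norm_triangle_ineq[of z "x *\<^sub>R b"] that elim b by simp
        then have ne: "z + x *\<^sub>R b \<noteq> y" if "\<bar>x\<bar> \<le> \<bar>h\<bar>" for x
          using ball_sphere_neq[of "z + x *\<^sub>R b" y] that \<rho> y by force
        obtain \<xi> \<eta> where x: "\<bar>\<xi>\<bar> \<le> \<bar>h\<bar>" "\<bar>\<eta>\<bar> \<le> \<bar>h\<bar>"
          "(ball_kernel (z + h *\<^sub>R b) y + ball_kernel (z + (- h) *\<^sub>R b) y - 2 * ball_kernel (z + 0 *\<^sub>R b) y) / h\<^sup>2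
            = (ball_kernel_deriv2 b (z + \<xi> *\<^sub>R b) y + ball_kernel_deriv2 b (z + \<eta> *\<^sub>R b) y) / 2"
          by (rule second_difference_mean_value[OF elim(2),
              where f = "\<lambda>x. ball_kernel (z + x *\<^sub>R b) y" and f' = "\<lambda>x. ball_kernel_deriv b (z + x *\<^sub>R b) y"
              and f'' = "\<lambda>x. ball_kernel_deriv2 b (z + x *\<^sub>R b) y"])
            (use ball_kernel_has_deriv[OF ne] ball_kernel_deriv_has_deriv[OF ne b] in auto)
        have cl: "\<bar>ball_kernel_deriv2 b (z + x *\<^sub>R b) y - ball_kernel_deriv2 b z y\<bar> < \<epsilon>'" if "\<bar>x\<bar> \<le> \<bar>h\<bar>" for x
        proof -
          have "dist (z + x *\<^sub>R b, y) (z, y) < d"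
            using that elim b by (simp add: dist_Pair_Pair dist_norm)
          from d(2)[OF _ _ this] show ?thesis
            using n[OF that] \<rho> y by (auto simp: dist_real_def less_imp_le)
        qed
        have "?T b y h = (ball_kernel_deriv2 b (z + \<xi> *\<^sub>R b) y + ball_kernel_deriv2 b (z + \<eta> *\<^sub>R b) y) / 2"
          using x(3) by simp
        then show "\<bar>?T b y h - ball_kernel_deriv2 b z y\<bar> \<le> \<epsilon>'"
          using cl[OF x(1)] cl[OF x(2)] by (simp only: abs_less_iff abs_le_iff) (simp add: field_simps)
      qed
    qed
  qed
  then have "\<forall>\<^sub>F h in at 0. \<forall>b\<in>Basis. \<forall>y\<in>sphere 0 1. \<bar>?T b y h - ball_kernel_deriv2 b z y\<bar> \<le> \<epsilon>'"
    by (intro eventually_ball_finite) auto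
  then show ?thesis
  proof eventually_elim
    case (elim h)
    show ?case
    proof
      fix y :: 'a assume y: "y \<in> sphere 0 1"
      have "(\<Sum>b\<in>Basis. ball_kernel_deriv2 b z y) = 0"
        using y z by (intro ball_kernel_laplacian ball_sphere_neq) auto
      then have "diff_laplacian (\<lambda>w. ball_kernel w y) z h = (\<Sum>b\<in>Basis. ?T b y h - ball_kernel_deriv2 b z y)"
        by (simp add: diff_laplacian_def sum_subtractf)
      also have "\<bar>\<dots>\<bar> \<le> (\<Sum>b\<in>(Basis::'a set). \<epsilon>')"
        using elim y by (intro order_trans[OF sum_abs] sum_mono) auto
      also have "\<dots> = \<epsilon>" by (simp add: \<epsilon>'_def)
      finally show "\<bar>diff_laplacian (\<lambda>w. ball_kernel w y) z h\<bar> \<le> \<epsilon>" .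
    qed
  qed
qed

lemma harmonic_at_ball_kernel:
  fixes z y :: "'a::euclidean_space"
  assumes "norm z < 1" "norm y = 1"
  shows "harmonic_at (\<lambda>w. ball_kernel w y) z"
  unfolding harmonic_at_def
proof (rule tendstoI)
  fix e :: real assume "e > 0"
  then have "\<forall>\<^sub>F h in at 0. \<forall>y\<in>sphere 0 1. \<bar>diff_laplacian (\<lambda>w. ball_kernel w y) z h\<bar> \<le> e / 2"
    by (intro ball_kernel_laplacian_uniform assms) simp
  then show "\<forall>\<^sub>F h in at 0. dist (diff_laplacian (\<lambda>w. ball_kernel w y) z h) 0 < e"
    by eventually_elim (use assms \<open>e > 0\<close> in force)
qed

lemma harmonic_at_dilation:
  assumes u: "harmonic_at u (s *\<^sub>R z)"
  shows "harmonic_at (\<lambda>w. u (s *\<^sub>R w)) z"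
proof (cases "s = 0")
  case True then show ?thesis by (simp add: harmonic_at_const)
next
  case False
  have "diff_laplacian (\<lambda>w. u (s *\<^sub>R w)) z = (\<lambda>h. s\<^sup>2 * diff_laplacian u (s *\<^sub>R z) (s * h))"
    using False by (auto simp: diff_laplacian_def sum_distrib_left scaleR_add_right scaleR_diff_right
        power_mult_distrib intro!: sum.cong)
  moreover have "filterlim (\<lambda>h. s * h) (at 0) (at 0)"
    unfolding filterlim_at using False
    by (auto intro!: tendsto_eq_intros eventually_neq_at_within simp: eventually_at_filter)
  ultimately show ?thesis
    using u tendsto_mult_left[of "\<lambda>h. diff_laplacian u (s *\<^sub>R z) (s * h)" 0 "at 0" "s\<^sup>2"]
      filterlim_compose[of "diff_laplacian u (s *\<^sub>R z)" "nhds 0" "at 0" "\<lambda>h. s * h" "at 0"]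
    by (simp add: harmonic_at_def)
qed

section \<open>Poisson integrals over the sphere\<close>

lemma finite_measure_sphere_measure: "finite_measure (sphere_measure :: 'a::euclidean_space measure)"
  by (rule finite_measureI) (simp add: emeasure_sphere_measure_space)

lemma borel_measurable_sphere_measure:
  fixes f :: "'a::euclidean_space \<Rightarrow> 'b::topological_space"
  assumes "continuous_on (sphere 0 1) f"
  shows "f \<in> borel_measurable sphere_measure"
  using borel_measurable_continuous_on_restrict[OF assms]
  by (simp add: measurable_cong_sets[OF sets_sphere_measure refl])

lemma continuous_on_sphere_bounded:
  fixes f :: "'a::euclidean_space \<Rightarrow> 'b::real_normed_vector"
  assumes f: "continuous_on (sphere 0 1) f"
  obtains B where "\<And>x. x \<in> sphere 0 1 \<Longrightarrow> norm (f x) \<le> B" "B > 0"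
proof -
  have "bounded (f ` sphere 0 1)"
    by (rule compact_imp_bounded[OF compact_continuous_image[OF f compact_sphere]])
  then obtain B where "B > 0" "\<forall>x\<in>sphere 0 1. norm (f x) \<le> B"
    by (auto simp: bounded_pos)
  then show thesis by (intro that[of B]) auto
qed

lemma integrable_sphere_measure:
  fixes f :: "'a::euclidean_space \<Rightarrow> 'b::{banach, second_countable_topology}"
  assumes f: "continuous_on (sphere 0 1) f"
  shows "integrable sphere_measure f"
proof -
  interpret finite_measure "sphere_measure :: 'a measure" by (rule finite_measure_sphere_measure)
  obtain B where "\<And>x. x \<in> sphere 0 1 \<Longrightarrow> norm (f x) \<le> B" "B > 0"
    using continuous_on_sphere_bounded[OF f] by metis
  then show ?thesis
    by (intro integrable_const_bound[of _ B] borel_measurable_sphere_measure f AE_I2) simp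
qed

lemma sphere_integral_bound:
  fixes f :: "'a::euclidean_space \<Rightarrow> real"
  assumes "\<And>y. y \<in> sphere 0 1 \<Longrightarrow> \<bar>f y\<bar> \<le> c" "continuous_on (sphere 0 1) f"
  shows "\<bar>LINT y|sphere_measure. f y\<bar> \<le> c * measure (sphere_measure :: 'a measure) (sphere 0 1)"
proof -
  interpret finite_measure "sphere_measure :: 'a measure" by (rule finite_measure_sphere_measure)
  have i: "integrable sphere_measure f" by (rule integrable_sphere_measure[OF assms(2)])
  have "\<bar>LINT y|sphere_measure. f y\<bar> \<le> (LINT y|sphere_measure. \<bar>f y\<bar>)"
    using integral_norm_bound[of sphere_measure f] by simp
  also have "\<dots> \<le> (LINT y|(sphere_measure :: 'a measure). c)"
    using i assms(1) by (intro integral_mono) auto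
  finally show ?thesis by (simp add: mult.commute)
qed

lemma continuous_on_ball_kernel_sphere:
  assumes "norm w < 1"
  shows "continuous_on (sphere 0 1) (\<lambda>y. ball_kernel w y)"
  unfolding ball_kernel_def using assms by (intro continuous_intros) auto

lemma continuous_on_poisson_integral:
  fixes f :: "'a::euclidean_space \<Rightarrow> real"
  assumes f: "continuous_on (sphere 0 1) f" and \<rho>: "\<rho> < 1"
  shows "continuous_on (cball 0 \<rho>) (\<lambda>z. LINT y|sphere_measure. ball_kernel z y * f y)"
  unfolding continuous_on_iff
proof (intro ballI allI impI)
  fix z :: 'a and e :: real assume z: "z \<in> cball 0 \<rho>" and e: "e > 0"
  let ?S = "cball 0 \<rho> \<times> sphere (0::'a) 1"
  let ?m = "measure (sphere_measure :: 'a measure) (sphere 0 1)"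
  obtain B where B: "\<And>x. x \<in> sphere 0 1 \<Longrightarrow> norm (f x) \<le> B" "B > 0"
    using continuous_on_sphere_bounded[OF f] by metis
  define \<epsilon> where "\<epsilon> = e / (B * ?m + 1)"
  have Bm: "B * ?m + 1 > 0" using B by (intro add_nonneg_pos mult_nonneg_nonneg) auto
  then have \<epsilon>: "\<epsilon> > 0" using e by (simp add: \<epsilon>_def)
  have "uniformly_continuous_on ?S (\<lambda>(w, y). ball_kernel w y)"
    by (intro compact_uniformly_continuous continuous_on_ball_kernel \<rho> compact_Times) auto
  then obtain d where d: "d > 0"
    "\<And>p p'. p \<in> ?S \<Longrightarrow> p' \<in> ?S \<Longrightarrow> dist p' p < d \<Longrightarrow>
        dist ((\<lambda>(w, y). ball_kernel w y) p') ((\<lambda>(w, y). ball_kernel w y) p) < \<epsilon>"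
    using \<epsilon> unfolding uniformly_continuous_on_def by metis
  show "\<exists>d>0. \<forall>x\<in>cball 0 \<rho>. dist x z < d \<longrightarrow>
      dist (LINT y|sphere_measure. ball_kernel x y * f y) (LINT y|sphere_measure. ball_kernel z y * f y) < e"
  proof (intro exI[of _ d] conjI ballI impI)
    fix w assume w: "w \<in> cball 0 \<rho>" "dist w z < d"
    have n: "norm w < 1" "norm z < 1" using w z \<rho> by auto
    have c: "continuous_on (sphere 0 1) (\<lambda>y. ball_kernel w y * f y)"
        "continuous_on (sphere 0 1) (\<lambda>y. ball_kernel z y * f y)"
      using n f by (auto intro!: continuous_intros continuous_on_ball_kernel_sphere)
    have "dist (LINT y|sphere_measure. ball_kernel w y * f y) (LINT y|sphere_measure. ball_kernel z y * f y) =
       \<bar>LINT y|sphere_measure. ball_kernel w y * f y - ball_kernel z y * f y\<bar>"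
      using c by (subst Bochner_Integration.integral_diff) (auto simp: dist_real_def intro: integrable_sphere_measure)
    also have "\<dots> \<le> (\<epsilon> * B) * ?m"
    proof (rule sphere_integral_bound)
      fix y :: 'a assume y: "y \<in> sphere 0 1"
      have "\<bar>ball_kernel w y - ball_kernel z y\<bar> \<le> \<epsilon>"
        using d(2)[of "(z, y)" "(w, y)"] w z y by (auto simp: dist_Pair_Pair dist_real_def)
      then have "\<bar>ball_kernel w y - ball_kernel z y\<bar> * \<bar>f y\<bar> \<le> \<epsilon> * B"
        using B(1)[OF y] \<epsilon> by (intro mult_mono) auto
      then show "\<bar>ball_kernel w y * f y - ball_kernel z y * f y\<bar> \<le> \<epsilon> * B"
        by (simp add: abs_mult[symmetric] left_diff_distrib)
    qed (intro continuous_intros c)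
    also have "\<dots> < \<epsilon> * (B * ?m + 1)" using \<epsilon> by (simp add: algebra_simps)
    also have "\<dots> = e" using Bm by (simp add: \<epsilon>_def)
    finally show "dist (LINT y|sphere_measure. ball_kernel w y * f y) (LINT y|sphere_measure. ball_kernel z y * f y) < e" .
  qed (rule d)
qed

text \<open>
  The discrete Laplacian of the integral is the integral of the discrete Laplacians of the kernel,
  which are uniformly small.
\<close>

lemma harmonic_at_poisson_integral:
  fixes f :: "'a::euclidean_space \<Rightarrow> real"
  assumes f: "continuous_on (sphere 0 1) f" and z: "norm z < 1"
  shows "harmonic_at (\<lambda>z. LINT y|sphere_measure. ball_kernel z y * f y) z"
  unfolding harmonic_at_def
proof (rule tendstoI)
  fix e :: real assume e: "e > 0"
  let ?m = "measure (sphere_measure :: 'a measure) (sphere 0 1)"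
  let ?u = "\<lambda>z. LINT y|sphere_measure. ball_kernel z y * f y"
  obtain B where B: "\<And>x. x \<in> sphere 0 1 \<Longrightarrow> norm (f x) \<le> B" "B > 0"
    using continuous_on_sphere_bounded[OF f] by metis
  define \<epsilon> where "\<epsilon> = e / (B * ?m + 1)"
  have Bm: "B * ?m + 1 > 0" using B by (intro add_nonneg_pos mult_nonneg_nonneg) auto
  then have \<epsilon>: "\<epsilon> > 0" using e by (simp add: \<epsilon>_def)
  have "\<forall>\<^sub>F h in at 0. \<bar>h\<bar> < 1 - norm z"
    using z by (intro order_tendstoD(2)[of _ 0] tendsto_rabs_zero tendsto_ident_at) auto
  then show "\<forall>\<^sub>F h in at 0. dist (diff_laplacian ?u z h) 0 < e"
    using ball_kernel_laplacian_uniform[OF z \<epsilon>]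
  proof eventually_elim
    case (elim h)
    have c: "continuous_on (sphere 0 1) (\<lambda>y. ball_kernel w y * f y)" if "norm w < 1" for w
      using that f by (auto intro!: continuous_intros continuous_on_ball_kernel_sphere)
    have i: "integrable sphere_measure (\<lambda>y. ball_kernel w y * f y)" if "norm w < 1" for w
      using c[OF that] by (rule integrable_sphere_measure)
    have n: "norm (z + h *\<^sub>R b) < 1" "norm (z - h *\<^sub>R b) < 1" if "b \<in> Basis" for b
      using norm_triangle_ineq[of z "h *\<^sub>R b"] norm_triangle_ineq4[of z "h *\<^sub>R b"] elim that by auto
    let ?g = "\<lambda>y. \<Sum>b\<in>Basis. (ball_kernel (z + h *\<^sub>R b) y * f y + ball_kernel (z - h *\<^sub>R b) y * f y
          - 2 * (ball_kernel z y * f y)) / h\<^sup>2"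
    have g: "?g y = diff_laplacian (\<lambda>w. ball_kernel w y) z h * f y" for y
      unfolding diff_laplacian_def sum_distrib_right by (intro sum.cong refl) (simp add: algebra_simps)
    have "diff_laplacian ?u z h = (LINT y|sphere_measure. ?g y)"
      unfolding diff_laplacian_def by (simp add: i n z)
    also have "\<bar>\<dots>\<bar> \<le> (\<epsilon> * B) * ?m"
    proof (rule sphere_integral_bound)
      fix y :: 'a assume y: "y \<in> sphere 0 1"
      have "\<bar>diff_laplacian (\<lambda>w. ball_kernel w y) z h\<bar> * \<bar>f y\<bar> \<le> \<epsilon> * B"
        using B(1)[OF y] \<epsilon> elim y by (intro mult_mono) auto
      then show "\<bar>?g y\<bar> \<le> \<epsilon> * B" unfolding g by (simp add: abs_mult)
    next
      show "continuous_on (sphere 0 1) ?g"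
        unfolding divide_inverse using z n by (intro continuous_intros c) auto
    qed
    also have "\<dots> < \<epsilon> * (B * ?m + 1)" using \<epsilon> by (simp add: algebra_simps)
    also have "\<dots> = e" using Bm by (simp add: \<epsilon>_def)
    finally show ?case by (simp add: dist_real_def)
  qed
qed

lemma integral_sphere_measure_rotate:
  fixes T :: "'a::euclidean_space \<Rightarrow> 'a" and g :: "'a \<Rightarrow> real"
  assumes T: "orthogonal_transformation T" and g: "continuous_on (sphere 0 1) g"
  shows "(LINT y|sphere_measure. g (T y)) = (LINT y|sphere_measure. g y)"
proof -
  have nrm: "norm (T y) = norm y" for y using T by (rule orthogonal_transformation_norm)
  have "T \<in> borel_measurable borel"
    using orthogonal_transformation_linear[OF T]
    by (intro borel_measurable_continuous_onI linear_continuous_on)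
      (simp add: linear_conv_bounded_linear)
  then have "T \<in> restrict_space borel (sphere 0 1) \<rightarrow>\<^sub>M restrict_space borel (sphere 0 1)"
    by (intro measurable_restrict_space3) (auto simp: nrm)
  then have "T \<in> sphere_measure \<rightarrow>\<^sub>M sphere_measure"
    by (simp add: measurable_cong_sets[OF sets_sphere_measure sets_sphere_measure])
  then have "(LINT y|distr sphere_measure sphere_measure T. g y) = (LINT y|sphere_measure. g (T y))"
    by (intro integral_distr borel_measurable_sphere_measure g)
  then show ?thesis by (simp add: sphere_measure_rotation_invariant[OF T])
qed

lemma ball_kernel_orthogonal:
  fixes T :: "'a::euclidean_space \<Rightarrow> 'a"
  assumes T: "orthogonal_transformation T"
  shows "ball_kernel (T z) (T y) = ball_kernel z y"
proof -
  have "T z - T y = T (z - y)" using orthogonal_transformation_linear[OF T] by (simp add: linear_diff)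
  then show ?thesis using T by (simp add: ball_kernel_def orthogonal_transformation_def)
qed

text \<open>
  The reflection in the hyperplane orthogonal to \<open>z - w\<close> exchanges two vectors of equal norm.
\<close>

lemma orthogonal_transformation_moves:
  fixes z w :: "'a::euclidean_space"
  assumes "norm z = norm w"
  obtains T where "orthogonal_transformation T" "T z = w"
proof
  define v where "v = z - w"
  define T where "T x = x - (2 * (x \<bullet> v) / (v \<bullet> v)) *\<^sub>R v" for x
  have zw: "z \<bullet> z = w \<bullet> w" using assms by (simp add: dot_square_norm)
  show "orthogonal_transformation T"
    unfolding orthogonal_transformation_def
  proof
    show "linear T"
      by (rule linearI) (simp_all add: T_def algebra_simps inner_add_left add_divide_distrib)
    show "\<forall>x y. T x \<bullet> T y = x \<bullet> y"
      by (cases "v = 0") (simp_all add: T_def inner_diff_left inner_diff_right inner_commute)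
  qed
  show "T z = w"
  proof (cases "v = 0")
    case False
    have "v \<bullet> v = 2 * (z \<bullet> v)"
      unfolding v_def using zw by (simp add: inner_diff_left inner_diff_right inner_commute)
    then have "2 * (z \<bullet> v) / (v \<bullet> v) = 1" using False by (metis divide_self inner_eq_zero_iff)
    then have "T z = z - v" by (simp only: T_def scaleR_one)
    then show ?thesis by (simp add: v_def)
  qed (simp add: T_def v_def)
qed

text \<open>
  By rotation invariance the integral depends on \<open>|z|\<close> only. It is harmonic in \<open>z\<close> and constant on each
  sphere about the origin, so by the maximum principle it equals its value at the origin.
\<close>

lemma integral_ball_kernel:
  fixes z :: "'a::euclidean_space"
  assumes z: "norm z < 1"
  shows "(LINT y|sphere_measure. ball_kernel z y) = measure (sphere_measure :: 'a measure) (sphere 0 1)"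
proof -
  define v where "v z = (LINT y|sphere_measure. ball_kernel z y * 1)" for z :: 'a
  have eq: "v w = v z" if nw: "norm w = norm z" for w
  proof -
    obtain T where T: "orthogonal_transformation T" "T z = w"
      using orthogonal_transformation_moves[OF nw[symmetric]] by metis
    have "v w = (LINT y|sphere_measure. ball_kernel w (T y))"
      unfolding v_def mult_1_right
      by (rule integral_sphere_measure_rotate[symmetric, OF T(1)])
        (use that z in \<open>intro continuous_on_ball_kernel_sphere, simp\<close>)
    also have "\<dots> = v z" by (simp add: v_def T(2)[symmetric] ball_kernel_orthogonal[OF T(1)])
    finally show ?thesis .
  qed
  have h: "harmonic_at v w" if "norm w < norm z" for w
    unfolding v_def by (rule harmonic_at_poisson_integral) (use that z in auto)
  have c: "continuous_on (cball 0 (norm z)) v"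
    unfolding v_def by (rule continuous_on_poisson_integral) (use z in auto)
  have "v 0 - v z \<le> 0"
  proof (rule harmonic_maximum_principle[where \<rho> = "norm z" and u = "\<lambda>w. v w - v z"])
    show "continuous_on (cball 0 (norm z)) (\<lambda>w. v w - v z)" by (intro continuous_intros c)
    show "harmonic_at (\<lambda>w. v w - v z) w" if "norm w < norm z" for w
      by (intro harmonic_at_diff harmonic_at_const h that)
    show "v w - v z \<le> 0" if "norm w = norm z" for w using eq[OF that] by simp
  qed simp
  moreover have "v z - v 0 \<le> 0"
  proof (rule harmonic_maximum_principle[where \<rho> = "norm z" and u = "\<lambda>w. v z - v w"])
    show "continuous_on (cball 0 (norm z)) (\<lambda>w. v z - v w)" by (intro continuous_intros c)
    show "harmonic_at (\<lambda>w. v z - v w) w" if "norm w < norm z" for w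
      by (intro harmonic_at_diff harmonic_at_const h that)
    show "v z - v w \<le> 0" if "norm w = norm z" for w using eq[OF that] by simp
  qed simp
  moreover have "v 0 = measure (sphere_measure :: 'a measure) (sphere 0 1)"
  proof -
    have "v 0 = (LINT y|(sphere_measure :: 'a measure). 1)"
      unfolding v_def by (intro Bochner_Integration.integral_cong) (auto simp: ball_kernel_def dot_square_norm)
    then show ?thesis by simp
  qed
  ultimately show ?thesis by (simp add: v_def)
qed

text \<open>
  The difference of the two sides is harmonic in the open ball. Near the boundary it is small,
  because the kernel has constant total mass and its mass concentrates near \<open>z / |z|\<close>; the maximum
  principle carries this smallness into the interior.
\<close>

theorem poisson_integral_formula:
  fixes F :: "'a::euclidean_space \<Rightarrow> real"
  assumes cont: "continuous_on (cball 0 1) F" and harm: "\<And>w. norm w < 1 \<Longrightarrow> harmonic_at F w"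
    and z: "norm z < 1"
  shows "(LINT y|sphere_measure. ball_kernel z y * F y) =
    measure (sphere_measure :: 'a measure) (sphere 0 1) * F z"
proof -
  let ?m = "measure (sphere_measure :: 'a measure) (sphere 0 1)"
  define q where "q = real DIM('a) / 2"
  define W where "W z = (LINT y|sphere_measure. ball_kernel z y * F y) - ?m * F z" for z :: 'a
  have Fs: "continuous_on (sphere 0 1) F" using cont by (rule continuous_on_subset) auto
  have m0: "?m \<ge> 0" by simp
  obtain B where B: "\<And>x. x \<in> cball 0 1 \<Longrightarrow> \<bar>F x\<bar> \<le> B" "B > 0"
  proof -
    have "bounded (F ` cball 0 1)"
      by (rule compact_imp_bounded[OF compact_continuous_image[OF cont compact_cball]])
    then obtain B where "B > 0" "\<forall>x\<in>cball 0 1. \<bar>F x\<bar> \<le> B" by (auto simp: bounded_pos)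
    then show thesis by (intro that[of B]) auto
  qed
  have boundary: "\<exists>\<rho>0<1. \<forall>w. \<rho>0 \<le> norm w \<and> norm w < 1 \<longrightarrow> \<bar>W w\<bar> \<le> \<epsilon> * (2 * ?m)" if e: "\<epsilon> > 0" for \<epsilon>
  proof -
    have "uniformly_continuous_on (cball 0 1) F"
      by (intro compact_uniformly_continuous cont) auto
    then obtain d where d: "d > 0"
      "\<And>x x'. x \<in> cball 0 1 \<Longrightarrow> x' \<in> cball 0 1 \<Longrightarrow> dist x' x < d \<Longrightarrow> dist (F x') (F x) < \<epsilon>"
      using e unfolding uniformly_continuous_on_def by metis
    \<comment> \<open>at distance at least \<open>d\<close> from \<open>w\<close>, the kernel times \<open>|F y - F w|\<close> is at most \<open>(1 - |w|\<^sup>2) K\<close>\<close>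
    define K where "K = 2 * B * (d\<^sup>2) powr (- q)"
    have K: "K > 0" using B d by (simp add: K_def)
    have "((\<lambda>r::real. (1 - r\<^sup>2) * K) \<longlongrightarrow> (1 - 1\<^sup>2) * K) (at_left 1)" by (intro tendsto_intros)
    then have "\<forall>\<^sub>F r::real in at_left 1. (1 - r\<^sup>2) * K < \<epsilon>"
      using e by (intro order_tendstoD(2)) auto
    then obtain b where b: "b < 1" "\<And>r. b < r \<Longrightarrow> r < 1 \<Longrightarrow> (1 - r\<^sup>2) * K < \<epsilon>"
      unfolding eventually_at_left_field by blast
    define \<rho>0 where "\<rho>0 = (b + 1) / 2"
    have \<rho>0: "b < \<rho>0" "\<rho>0 < 1" using b by (auto simp: \<rho>0_def)
    have "\<bar>W w\<bar> \<le> \<epsilon> * (2 * ?m)" if w: "\<rho>0 \<le> norm w" "norm w < 1" for w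
    proof -
      have ww: "(1 - w \<bullet> w) * K < \<epsilon>" using b(2)[of "norm w"] w \<rho>0 by (simp add: dot_square_norm)
      have w1: "1 - w \<bullet> w > 0" using w by (simp add: dot_square_norm abs_square_less_1)
      have c: "continuous_on (sphere 0 1) (\<lambda>y. ball_kernel w y)"
        by (rule continuous_on_ball_kernel_sphere[OF w(2)])
      have "W w = (LINT y|sphere_measure. ball_kernel w y * F y) - (LINT y|sphere_measure. ball_kernel w y * F w)"
        using integral_ball_kernel[OF w(2)] by (simp add: W_def mult.commute)
      also have "\<dots> = (LINT y|sphere_measure. ball_kernel w y * F y - ball_kernel w y * F w)"
        by (rule Bochner_Integration.integral_diff[symmetric])
          (intro integrable_sphere_measure continuous_intros c Fs)+
      finally have Ww: "W w = (LINT y|sphere_measure. ball_kernel w y * F y - ball_kernel w y * F w)" .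
      have pt: "\<bar>ball_kernel w y * F y - ball_kernel w y * F w\<bar> \<le> \<epsilon> * ball_kernel w y + \<epsilon>"
        if y: "y \<in> sphere 0 1" for y
      proof -
        have pos: "ball_kernel w y \<ge> 0" using w1 by (simp add: ball_kernel_def)
        have eq: "\<bar>ball_kernel w y * F y - ball_kernel w y * F w\<bar> = ball_kernel w y * \<bar>F y - F w\<bar>"
          using pos by (simp add: abs_mult right_diff_distrib[symmetric])
        show ?thesis
        proof (cases "dist y w < d")
          case True
          then have "\<bar>F y - F w\<bar> \<le> \<epsilon>" using d(2)[of w y] w y by (simp add: dist_real_def)
          then have "ball_kernel w y * \<bar>F y - F w\<bar> \<le> ball_kernel w y * \<epsilon>" using pos by (rule mult_left_mono)
          then show ?thesis unfolding eq using e by (simp add: mult.commute)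
        next
          case False
          then have "d\<^sup>2 \<le> (w - y) \<bullet> (w - y)"
            using d(1) by (simp add: dot_square_norm dist_norm norm_minus_commute power_mono)
          then have "((w - y) \<bullet> (w - y)) powr (- q) \<le> (d\<^sup>2) powr (- q)"
            using d(1) by (intro powr_mono2') (auto simp: q_def)
          moreover have "\<bar>F y - F w\<bar> \<le> 2 * B" using B(1)[of y] B(1)[of w] y w by simp
          ultimately have "((w - y) \<bullet> (w - y)) powr (- q) * \<bar>F y - F w\<bar> \<le> (d\<^sup>2) powr (- q) * (2 * B)"
            by (intro mult_mono) auto
          then have "(1 - w \<bullet> w) * (((w - y) \<bullet> (w - y)) powr (- q) * \<bar>F y - F w\<bar>) \<le> (1 - w \<bullet> w) * ((d\<^sup>2) powr (- q) * (2 * B))"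
            using w1 by (intro mult_left_mono) auto
          then have "ball_kernel w y * \<bar>F y - F w\<bar> \<le> (1 - w \<bullet> w) * K"
            by (simp add: ball_kernel_def q_def K_def mult_ac)
          moreover have "\<epsilon> * ball_kernel w y \<ge> 0" using e pos by simp
          ultimately show ?thesis unfolding eq using ww by linarith
        qed
      qed
      have i1: "integrable sphere_measure (\<lambda>y. ball_kernel w y * F y - ball_kernel w y * F w)"
        by (intro integrable_sphere_measure continuous_intros c Fs)
      have i2: "integrable sphere_measure (\<lambda>y. \<epsilon> * ball_kernel w y + \<epsilon>)"
        by (intro integrable_sphere_measure continuous_intros c)
      have "\<bar>W w\<bar> \<le> (LINT y|sphere_measure. \<bar>ball_kernel w y * F y - ball_kernel w y * F w\<bar>)"
        unfolding Ww using integral_norm_bound by (simp flip: real_norm_def)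
      also have "\<dots> \<le> (LINT y|sphere_measure. \<epsilon> * ball_kernel w y + \<epsilon>)"
        using i1 i2 pt by (intro integral_mono) auto
      also have "\<dots> = (LINT y|sphere_measure. \<epsilon> * ball_kernel w y) + (LINT y|(sphere_measure :: 'a measure). \<epsilon>)"
        by (rule Bochner_Integration.integral_add) (intro integrable_sphere_measure continuous_intros c)+
      also have "\<dots> = \<epsilon> * (2 * ?m)" by (simp add: integral_ball_kernel[OF w(2)])
      finally show ?thesis .
    qed
    then show ?thesis using \<rho>0 by blast
  qed
  have hW: "harmonic_at W w" if "norm w < 1" for w
    unfolding W_def
    by (intro harmonic_at_diff harmonic_at_cmult harm harmonic_at_poisson_integral Fs that)
  have hW': "harmonic_at (\<lambda>w. - W w) w" if "norm w < 1" for w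
    using harmonic_at_cmult[OF hW[OF that], of "- 1"] by simp
  have cW: "continuous_on (cball 0 \<rho>) W" if "\<rho> < 1" for \<rho>
    unfolding W_def
    by (intro continuous_intros continuous_on_poisson_integral Fs that continuous_on_subset[OF cont])
      (use that in auto)
  have small: "\<bar>W z\<bar> \<le> \<epsilon> * (2 * ?m)" if e: "\<epsilon> > 0" for \<epsilon>
  proof -
    obtain \<rho>0 where \<rho>0: "\<rho>0 < 1" "\<And>w. \<rho>0 \<le> norm w \<Longrightarrow> norm w < 1 \<Longrightarrow> \<bar>W w\<bar> \<le> \<epsilon> * (2 * ?m)"
      using boundary[OF e] by blast
    define \<rho> where "\<rho> = max \<rho>0 (norm z)"
    have \<rho>: "\<rho>0 \<le> \<rho>" "norm z \<le> \<rho>" "\<rho> < 1" using \<rho>0 z by (auto simp: \<rho>_def)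
    have "W z \<le> \<epsilon> * (2 * ?m)"
      by (rule harmonic_maximum_principle[OF cW[OF \<rho>(3)] hW _ \<rho>(2)]) (use \<rho> \<rho>0(2) in force)+
    moreover have "- W z \<le> \<epsilon> * (2 * ?m)"
      by (rule harmonic_maximum_principle[OF continuous_on_minus[OF cW[OF \<rho>(3)]] hW' _ \<rho>(2)])
        (use \<rho> \<rho>0(2) in force)+
    ultimately show ?thesis by linarith
  qed
  have "\<bar>W z\<bar> \<le> 0"
  proof (rule field_le_epsilon)
    fix e :: real assume e: "e > 0"
    have p: "2 * ?m + 1 > 0" using m0 by linarith
    have "\<bar>W z\<bar> \<le> e / (2 * ?m + 1) * (2 * ?m)" by (rule small) (use e p in auto)
    also have "\<dots> \<le> e / (2 * ?m + 1) * (2 * ?m + 1)" using e p by (intro mult_left_mono) auto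
    also have "\<dots> = e" using p by simp
    finally show "\<bar>W z\<bar> \<le> 0 + e" by simp
  qed
  then show ?thesis by (simp add: W_def)
qed

text \<open>
  The Poisson integral formula for the harmonic function \<open>w \<mapsto> P(s w, e)\<close>, where \<open>P\<close> is the Poisson
  kernel.
\<close>

lemma ball_kernel_semigroup:
  fixes x e :: "'a::euclidean_space"
  assumes x: "norm x = 1" and e: "norm e = 1" and r: "\<bar>r\<bar> < 1" and s: "\<bar>s\<bar> < 1"
  shows "(LINT y|sphere_measure. ball_kernel (r *\<^sub>R x) y * ball_kernel (s *\<^sub>R y) e) =
    measure (sphere_measure :: 'a measure) (sphere 0 1) * ball_kernel ((s * r) *\<^sub>R x) e"
proof -
  have n: "norm (s *\<^sub>R w) < 1" if "norm w \<le> 1" for w :: 'a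
  proof -
    have "norm (s *\<^sub>R w) \<le> \<bar>s\<bar> * 1" using that mult_left_mono[of "norm w" 1 "\<bar>s\<bar>"] by simp
    then show ?thesis using s by linarith
  qed
  have "continuous_on (cball 0 1) (\<lambda>w. ball_kernel (s *\<^sub>R w) e)"
    unfolding ball_kernel_def using n ball_sphere_neq[OF _ e] by (intro continuous_intros) force+
  moreover have "harmonic_at (\<lambda>w. ball_kernel (s *\<^sub>R w) e) w" if "norm w < 1" for w
    using that by (intro harmonic_at_dilation[where u = "\<lambda>w. ball_kernel w e"] harmonic_at_ball_kernel n e) simp
  ultimately show ?thesis
    using poisson_integral_formula[of "\<lambda>w. ball_kernel (s *\<^sub>R w) e" "r *\<^sub>R x"] r x by simp
qed

section \<open>Gegenbauer kernels as coefficients of the Poisson density\<close>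

text \<open>
  The Poisson kernel of the ball at \<open>r x\<close> and a unit vector \<open>y\<close>, as a function of \<open>t = x \<bullet> y\<close>,
  if \<open>\<lambda> + 1\<close> is half the dimension of the space.
\<close>

definition poisson_density :: "real \<Rightarrow> real \<Rightarrow> real \<Rightarrow> real" where
  "poisson_density lam r t = (1 - r\<^sup>2) * (1 - 2 * t * r + r\<^sup>2) powr (- (lam + 1))"

lemma denominator_ge:
  fixes t r :: real
  assumes "t \<in> {-1..1}"
  shows "(1 - \<bar>r\<bar>)\<^sup>2 \<le> 1 - 2 * t * r + r\<^sup>2"
proof -
  have "\<bar>t\<bar> * \<bar>r\<bar> \<le> 1 * \<bar>r\<bar>" by (rule mult_right_mono) (use assms in auto)
  then have "t * r \<le> \<bar>r\<bar>" by (metis abs_le_D1 abs_mult mult_1)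
  then show ?thesis by (simp add: power2_diff)
qed

lemma denominator_pos:
  fixes t r :: real
  assumes "t \<in> {-1..1}" "\<bar>r\<bar> < 1"
  shows "1 - 2 * t * r + r\<^sup>2 > 0"
proof -
  have "(1 - \<bar>r\<bar>)\<^sup>2 > 0" using assms by simp
  then show ?thesis using denominator_ge[OF assms(1), of r] by linarith
qed

lemma poisson_density_pos:
  assumes "t \<in> {-1..1}" "\<bar>r\<bar> < 1"
  shows "poisson_density lam r t > 0"
proof -
  have "r\<^sup>2 < 1" using assms(2) by (simp add: abs_square_less_1)
  then show ?thesis
    using denominator_pos[OF assms] by (simp add: poisson_density_def)
qed

lemma sums_index_times:
  fixes c :: "nat \<Rightarrow> real"
  assumes c: "\<And>r. \<bar>r\<bar> < 1 \<Longrightarrow> (\<lambda>l. c l * r ^ l) sums F r"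
    and r: "\<bar>r\<bar> < 1" and D: "(F has_real_derivative D) (at r)"
  shows "(\<lambda>l. real l * c l * r ^ l) sums (r * D)"
proof -
  have sm: "\<And>z::real. norm z < 1 \<Longrightarrow> summable (\<lambda>n. c n * z ^ n)"
    using c by (auto simp: sums_iff)
  have "((\<lambda>z. \<Sum>n. c n * z ^ n) has_field_derivative (\<Sum>n. diffs c n * r ^ n)) (at r)"
    by (rule termdiffs_strong'[of 1]) (use sm r in auto)
  then have "(F has_field_derivative (\<Sum>n. diffs c n * r ^ n)) (at r)"
    by (rule has_field_derivative_transform_within_open[of _ _ _ "ball 0 1"])
      (use r c in \<open>auto simp: sums_iff\<close>)
  then have eq: "(\<Sum>n. diffs c n * r ^ n) = D" using D by (rule DERIV_unique)
  have "summable (\<lambda>n. diffs c n * r ^ n)"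
    by (rule termdiff_converges[of _ 1]) (use r sm in auto)
  then have "(\<lambda>n. r * (diffs c n * r ^ n)) sums (r * D)"
    unfolding eq[symmetric] by (intro sums_mult summable_sums)
  then have "(\<lambda>n. real (Suc n) * c (Suc n) * r ^ Suc n) sums (r * D)"
    by (simp add: diffs_def algebra_simps)
  then show ?thesis using sums_Suc[of "\<lambda>l. real l * c l * r ^ l"] by simp
qed

text \<open>
  With \<open>B = 1 - 2tr + r\<^sup>2\<close>, the factor \<open>(\<lambda> + l) / \<lambda>\<close> acts on the generating function \<open>B\<^bsup>-\<lambda>\<^esup>\<close> as
  \<open>1 + (r / \<lambda>) \<partial>\<^sub>r\<close>. The result is \<open>(B - r \<partial>\<^sub>r B) B\<^bsup>-\<lambda>-1\<^esup>\<close>, and \<open>B - r \<partial>\<^sub>r B = 1 - r\<^sup>2\<close>.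
\<close>

lemma gegenbauer_kernel_sums:
  assumes t: "t \<in> {-1..1}" and r: "\<bar>r\<bar> < 1" and lam: "lam > 0"
  shows "(\<lambda>l. gegenbauer_kernel lam l t * r ^ l) sums poisson_density lam r t"
proof -
  let ?B = "1 - 2 * t * r + r\<^sup>2"
  have B: "?B > 0" by (rule denominator_pos[OF t r])
  have D: "((\<lambda>r. (1 - 2 * t * r + r\<^sup>2) powr (- lam)) has_real_derivative
      (- lam * ?B powr (- lam - 1) * (2 * r - 2 * t))) (at r)"
    using B by (auto intro!: derivative_eq_intros)
  have s0: "(\<lambda>l. gegenbauer lam l t * r ^ l) sums ?B powr (- lam)"
    by (rule gegenbauer_generating[OF t r])
  have s1: "(\<lambda>l. real l * gegenbauer lam l t * r ^ l) sums
      (r * (- lam * ?B powr (- lam - 1) * (2 * r - 2 * t)))"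
    by (rule sums_index_times[OF gegenbauer_generating[OF t] r D])
  have "(\<lambda>l. gegenbauer lam l t * r ^ l + real l * gegenbauer lam l t * r ^ l * (1 / lam)) sums
     (?B powr (- lam) + r * (- lam * ?B powr (- lam - 1) * (2 * r - 2 * t)) * (1 / lam))"
    by (intro sums_add s0 sums_mult2 s1)
  moreover have "(\<lambda>l. gegenbauer lam l t * r ^ l + real l * gegenbauer lam l t * r ^ l * (1 / lam)) =
      (\<lambda>l. gegenbauer_kernel lam l t * r ^ l)"
    using lam by (auto simp: gegenbauer_kernel_def field_simps)
  moreover have "?B powr (- lam) + r * (- lam * ?B powr (- lam - 1) * (2 * r - 2 * t)) * (1 / lam) =
      poisson_density lam r t"
  proof -
    have "?B powr (- lam) = ?B powr (1 + (- (lam + 1)))" by simp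
    also have "\<dots> = ?B powr 1 * ?B powr (- (lam + 1))" by (rule powr_add)
    finally have e: "?B powr (- lam) = ?B * ?B powr (- (lam + 1))" using B by simp
    have e2: "- lam - 1 = - (lam + 1)" by simp
    show ?thesis unfolding e e2 poisson_density_def using lam
      by (simp add: field_simps power2_eq_square)
  qed
  ultimately show ?thesis by simp
qed

text \<open>
  The coefficients in \<open>r\<close> of the logarithmic derivative \<open>r \<partial>\<^sub>r log p\<^sub>r(t)\<close> of the Poisson density.
\<close>

definition log_coeff :: "real \<Rightarrow> real \<Rightarrow> nat \<Rightarrow> real" where
  "log_coeff lam t i =
     (if i = 0 then 0 else 2 * (lam + 1) * cos (real i * arccos t) - 1 - (-1) ^ i)"

lemma log_coeff_bound:
  assumes "lam > 0" shows "\<bar>log_coeff lam t i\<bar> \<le> 2 * lam + 4"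
proof -
  have "\<bar>2 * (lam + 1) * cos (real i * arccos t)\<bar> \<le> 2 * (lam + 1) * 1"
    unfolding abs_mult using assms by (intro mult_mono) auto
  moreover have "\<bar>(-1::real) ^ i\<bar> = 1" by (simp add: power_abs)
  moreover have "\<bar>a - 1 - b\<bar> \<le> 2 * lam + 4" if "\<bar>a\<bar> \<le> 2 * (lam + 1) * 1" "\<bar>b\<bar> = 1" for a b :: real
    using that abs_ge_zero[of a] by (simp add: abs_if split: if_splits)
  ultimately show ?thesis using assms unfolding log_coeff_def by auto
qed

text \<open>
  With \<open>t = cos \<theta>\<close>, the fraction with denominator \<open>1 - 2tr + r\<^sup>2\<close> is the real part of a geometric series
  in \<open>r e\<^bsup>i\<theta>\<^esup>\<close>, and the other one is a geometric series in \<open>r\<^sup>2\<close>.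
\<close>

lemma log_coeff_sums:
  assumes t: "t \<in> {-1..1}" and r: "\<bar>r\<bar> < 1"
  shows "(\<lambda>i. log_coeff lam t i * r ^ i) sums
     ((lam + 1) * (2 * t * r - 2 * r\<^sup>2) / (1 - 2 * t * r + r\<^sup>2) - 2 * r\<^sup>2 / (1 - r\<^sup>2))"
proof -
  let ?B = "1 - 2 * t * r + r\<^sup>2"
  have B: "?B > 0" by (rule denominator_pos[OF t r])
  define z where "z = cis (arccos t)"
  have Rez: "Re z = t" using t by (simp add: z_def)
  have zz: "(Re z)\<^sup>2 + (Im z)\<^sup>2 = 1" by (simp add: z_def)
  have "norm (z * of_real r) < 1" using r by (simp add: norm_mult z_def)
  then have "(\<lambda>i. Re ((z * of_real r) ^ i)) sums Re (1 / (1 - z * of_real r))"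
    by (intro sums_Re geometric_sums)
  moreover have "Re ((z * of_real r) ^ i) = cos (real i * arccos t) * r ^ i" for i
    unfolding z_def power_mult_distrib Complex.DeMoivre by (simp flip: of_real_power)
  moreover have "Re (1 / (1 - z * of_real r)) = (1 - t * r) / ?B"
  proof -
    have "(1 - Re z * r)\<^sup>2 + (Im z * r)\<^sup>2 = 1 - 2 * Re z * r + ((Re z)\<^sup>2 + (Im z)\<^sup>2) * r\<^sup>2"
      by (simp add: power2_eq_square algebra_simps)
    then have "(1 - Re z * r)\<^sup>2 + (Im z * r)\<^sup>2 = ?B" unfolding zz unfolding Rez by simp
    then show ?thesis by (simp add: Re_divide Rez)
  qed
  ultimately have c: "(\<lambda>i. cos (real i * arccos t) * r ^ i) sums ((1 - t * r) / ?B)" by simp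
  have g1: "(\<lambda>i. r ^ i) sums (1 / (1 - r))" using r by (intro geometric_sums) simp
  have g2: "(\<lambda>i. (- r) ^ i) sums (1 / (1 - - r))" using r by (intro geometric_sums) simp
  \<comment> \<open>the last summand removes the constant term \<open>2 \<lambda>\<close> of the three geometric series\<close>
  have s: "(\<lambda>i. 2 * (lam + 1) * (cos (real i * arccos t) * r ^ i) - r ^ i - (- r) ^ i
        - (if i = 0 then 2 * lam else 0)) sums
     (2 * (lam + 1) * ((1 - t * r) / ?B) - 1 / (1 - r) - 1 / (1 - - r) - 2 * lam)"
    by (intro sums_diff sums_mult c g1 g2 sums_single[of 0 "\<lambda>_. 2 * lam"])
  have "(- r) ^ i = (-1) ^ i * r ^ i" for i
    by (metis mult_minus1 power_mult_distrib)
  then have "2 * (lam + 1) * (cos (real i * arccos t) * r ^ i) - r ^ i - (- r) ^ i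
        - (if i = 0 then 2 * lam else 0) = log_coeff lam t i * r ^ i" for i
    by (simp add: log_coeff_def algebra_simps)
  moreover have "2 * (lam + 1) * ((1 - t * r) / ?B) - 1 / (1 - r) - 1 / (1 - - r) - 2 * lam
     = (lam + 1) * (2 * t * r - 2 * r\<^sup>2) / ?B - 2 * r\<^sup>2 / (1 - r\<^sup>2)"
  proof -
    have r1: "1 - r \<noteq> 0" "1 + r \<noteq> 0" using r by auto
    have e: "1 - r\<^sup>2 = (1 - r) * (1 + r)" by (simp add: power2_eq_square algebra_simps)
    have "1 / (1 - r) + 1 / (1 + r) = 2 / (1 - r\<^sup>2)"
      unfolding e using r1 by (simp add: field_simps)
    moreover have "2 * r\<^sup>2 / (1 - r\<^sup>2) = 2 / (1 - r\<^sup>2) - 2"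
    proof -
      have "1 - r\<^sup>2 \<noteq> 0" unfolding e using r1 by simp
      then show ?thesis by (simp add: divide_simps)
    qed
    moreover have "(lam + 1) * (2 * t * r - 2 * r\<^sup>2) / ?B = 2 * (lam + 1) * ((1 - t * r) / ?B) - 2 * (lam + 1)"
      using B by (simp add: field_simps)
    ultimately show ?thesis by simp
  qed
  ultimately show ?thesis using s by simp
qed

lemma powser_abs_summable:
  fixes c :: "nat \<Rightarrow> real"
  assumes c: "\<And>r. \<bar>r\<bar> < 1 \<Longrightarrow> summable (\<lambda>l. c l * r ^ l)" and r: "\<bar>r\<bar> < 1"
  shows "summable (\<lambda>l. norm (c l * r ^ l))"
proof -
  obtain s where "\<bar>r\<bar> < s" "s < 1" using r dense by blast
  then show ?thesis using c[of s] by (intro powser_insidea[of c s]) auto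
qed

text \<open>
  Coefficients of \<open>r \<partial>\<^sub>r p\<^sub>r = (r \<partial>\<^sub>r log p\<^sub>r) p\<^sub>r\<close>. This recurrence replaces explicit formulas for the
  Gegenbauer polynomials: bounds and continuity of the kernels follow from it by induction.
\<close>

lemma gegenbauer_kernel_recurrence:
  assumes t: "t \<in> {-1..1}" and lam: "lam > 0"
  shows "real l * gegenbauer_kernel lam l t =
    (\<Sum>i\<le>l. log_coeff lam t i * gegenbauer_kernel lam (l - i) t)"
proof -
  define L where "L r = (lam + 1) * (2 * t * r - 2 * r\<^sup>2) / (1 - 2 * t * r + r\<^sup>2) - 2 * r\<^sup>2 / (1 - r\<^sup>2)" for r
  have l: "(\<lambda>l. real l * gegenbauer_kernel lam l t * r ^ l) sums (L r * poisson_density lam r t)"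
    if r: "\<bar>r\<bar> < 1" for r
  proof -
    let ?B = "1 - 2 * t * r + r\<^sup>2"
    have B: "?B > 0" by (rule denominator_pos[OF t r])
    have r2: "1 - r\<^sup>2 \<noteq> 0" using r by (metis abs_square_less_1 diff_gt_0_iff_gt less_irrefl)
    have D: "((\<lambda>r. poisson_density lam r t) has_real_derivative
      ((0 - 2 * r) * ?B powr (- (lam + 1)) +
        (1 - r\<^sup>2) * (- (lam + 1) * ?B powr (- (lam + 1) - 1) * (2 * r - 2 * t)))) (at r)"
      unfolding poisson_density_def using B
      by (auto intro!: derivative_eq_intros simp: algebra_simps)
    have p: "?B powr (- (lam + 1) - 1) = ?B powr (- (lam + 1)) / ?B"
      using B by (simp only: powr_diff powr_one)
    have "r * ((0 - 2 * r) * ?B powr (- (lam + 1)) +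
        (1 - r\<^sup>2) * (- (lam + 1) * ?B powr (- (lam + 1) - 1) * (2 * r - 2 * t))) =
        L r * poisson_density lam r t"
    proof -
      have alg: "r * ((0 - 2 * r) * W + C * (- (lam + 1) * (W / b) * (2 * r - 2 * t))) =
          ((lam + 1) * (2 * t * r - 2 * r\<^sup>2) / b - 2 * r\<^sup>2 / C) * (C * W)"
        if "b \<noteq> 0" "C \<noteq> 0" for b C W :: real
        using that by (simp add: divide_simps) (simp add: algebra_simps power2_eq_square)
      show ?thesis unfolding p L_def poisson_density_def using B r2 by (intro alg) auto
    qed
    then show ?thesis
      using sums_index_times[OF gegenbauer_kernel_sums[OF t _ lam] r D] by simp
  qed
  have rr: "(\<lambda>l. (\<Sum>i\<le>l. log_coeff lam t i * gegenbauer_kernel lam (l - i) t) * r ^ l) sums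
      (L r * poisson_density lam r t)" if r: "\<bar>r\<bar> < 1" for r
  proof -
    have "summable (\<lambda>i. norm (log_coeff lam t i * r ^ i))"
      by (rule powser_abs_summable[OF _ r]) (use log_coeff_sums[OF t] in \<open>auto simp: sums_iff\<close>)
    moreover have "summable (\<lambda>i. norm (gegenbauer_kernel lam i t * r ^ i))"
      by (rule powser_abs_summable[OF _ r])
        (use gegenbauer_kernel_sums[OF t _ lam] in \<open>auto simp: sums_iff\<close>)
    ultimately have "(\<lambda>l. \<Sum>i\<le>l. (log_coeff lam t i * r ^ i) * (gegenbauer_kernel lam (l - i) t * r ^ (l - i)))
      sums ((\<Sum>i. log_coeff lam t i * r ^ i) * (\<Sum>i. gegenbauer_kernel lam i t * r ^ i))"
      by (rule Cauchy_product_sums)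
    moreover have "(\<Sum>i. log_coeff lam t i * r ^ i) = L r"
      using log_coeff_sums[OF t r] by (simp add: L_def sums_iff)
    moreover have "(\<Sum>i. gegenbauer_kernel lam i t * r ^ i) = poisson_density lam r t"
      using gegenbauer_kernel_sums[OF t r lam] by (simp add: sums_iff)
    moreover have "(\<Sum>i\<le>l. (log_coeff lam t i * r ^ i) * (gegenbauer_kernel lam (l - i) t * r ^ (l - i)))
       = (\<Sum>i\<le>l. log_coeff lam t i * gegenbauer_kernel lam (l - i) t) * r ^ l" for l
      unfolding sum_distrib_right
    proof (rule sum.cong[OF refl])
      fix i assume "i \<in> {..l}"
      then show "(log_coeff lam t i * r ^ i) * (gegenbauer_kernel lam (l - i) t * r ^ (l - i)) =
          log_coeff lam t i * gegenbauer_kernel lam (l - i) t * r ^ l"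
        using power_add[of r i "l - i"] by simp
    qed
    ultimately show ?thesis by simp
  qed
  show ?thesis using powser_coeffs_unique[OF l rr] by (rule fun_cong)
qed

lemma gegenbauer_kernel_0 [simp]:
  assumes t: "t \<in> {-1..1}" and lam: "lam > 0"
  shows "gegenbauer_kernel lam 0 t = 1"
  using gegenbauer_kernel_sums[OF t _ lam, of 0] by (simp add: poisson_density_def sums_iff)

text \<open>
  The recurrence is dominated by the one for the coefficients of \<open>(1 - r)\<^bsup>-M-1\<^esup>\<close>.
\<close>

lemma gegenbauer_kernel_bound:
  assumes t: "t \<in> {-1..1}" and lam: "lam > 0" and M: "2 * lam + 4 \<le> real M"
  shows "\<bar>gegenbauer_kernel lam l t\<bar> \<le> real ((l + M) choose M)"
proof (induction l rule: less_induct)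
  case (less l)
  show ?case
  proof (cases "l = 0")
    case True then show ?thesis using t lam by simp
  next
    case False
    have "real l * \<bar>gegenbauer_kernel lam l t\<bar> = \<bar>real l * gegenbauer_kernel lam l t\<bar>"
      by (simp add: abs_mult)
    also have "\<dots> = \<bar>\<Sum>i\<in>{..l}. log_coeff lam t i * gegenbauer_kernel lam (l - i) t\<bar>"
      by (simp only: gegenbauer_kernel_recurrence[OF t lam])
    also have "{..l} = insert 0 {1..l}" by auto
    also have "(\<Sum>i\<in>insert 0 {1..l}. log_coeff lam t i * gegenbauer_kernel lam (l - i) t) =
        (\<Sum>i\<in>{1..l}. log_coeff lam t i * gegenbauer_kernel lam (l - i) t)"
      by (simp add: log_coeff_def)
    also have "\<bar>\<dots>\<bar> \<le> (\<Sum>i\<in>{1..l}. real M * real ((l - i + M) choose M))"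
    proof (rule order_trans[OF sum_abs], rule sum_mono)
      fix i assume i: "i \<in> {1..l}"
      show "\<bar>log_coeff lam t i * gegenbauer_kernel lam (l - i) t\<bar> \<le> real M * real ((l - i + M) choose M)"
        unfolding abs_mult
      proof (rule mult_mono)
        show "\<bar>gegenbauer_kernel lam (l - i) t\<bar> \<le> real ((l - i + M) choose M)"
          using i False by (intro less) auto
      qed (use log_coeff_bound[OF lam, of t i] M in auto)
    qed
    also have "\<dots> = real M * (\<Sum>j<l. real ((j + M) choose M))"
      unfolding sum_distrib_left
      by (rule sum.reindex_bij_witness[of _ "\<lambda>j. l - j" "\<lambda>i. l - i"]) auto
    also have "(\<Sum>j<l. real ((j + M) choose M)) = real (\<Sum>j\<le>l-1. (M + j) choose M)"
      using False by (simp add: lessThan_Suc_atMost[symmetric] add.commute)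
    also have "(\<Sum>j\<le>l-1. (M + j) choose M) = (l + M) choose (Suc M)"
      using False choose_rising_sum(1)[where n = M and m = "l - 1"] by (simp add: ac_simps)
    also have "real M * real ((l + M) choose (Suc M)) \<le> real (Suc M) * real ((l + M) choose (Suc M))"
      by (intro mult_right_mono) auto
    also have "\<dots> = real (Suc M * ((l + M) choose (Suc M)))" by (rule of_nat_mult[symmetric])
    also have "Suc M * ((l + M) choose (Suc M)) = l * ((l + M) choose M)"
      using binomial_absorb_comp[of "l + M" M] binomial_absorption[of M "l + M"]
      by (simp only: add_diff_cancel_right')
    finally show ?thesis using False by simp
  qed
qed

lemma continuous_on_gegenbauer_kernel:
  assumes lam: "lam > 0"
  shows "continuous_on {-1..1} (gegenbauer_kernel lam l)"
proof (induction l rule: less_induct)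
  case (less l)
  show ?case
  proof (cases "l = 0")
    case True
    have "continuous_on {-1..1} (\<lambda>t. 1 :: real)" by simp
    then show ?thesis unfolding True
      by (rule continuous_on_eq) (use lam in auto)
  next
    case False
    have "continuous_on {-1..1} (\<lambda>t. (\<Sum>i\<in>{1..l}. log_coeff lam t i * gegenbauer_kernel lam (l - i) t) / real l)"
    proof (intro continuous_intros)
      fix i assume i: "i \<in> {1..l}"
      then show "continuous_on {-1..1} (gegenbauer_kernel lam (l - i))"
        using less False by simp
      show "continuous_on {-1..1} (\<lambda>t. log_coeff lam t i)"
        unfolding log_coeff_def using i by (auto intro!: continuous_intros)
    qed (use False in auto)
    moreover have "(\<Sum>i\<in>{1..l}. log_coeff lam t i * gegenbauer_kernel lam (l - i) t) / real l
       = gegenbauer_kernel lam l t" if t: "t \<in> {-1..1}" for t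
    proof -
      have "{..l} = insert 0 {1..l}" by auto
      then have "(\<Sum>i\<in>{..l}. log_coeff lam t i * gegenbauer_kernel lam (l - i) t) =
        (\<Sum>i\<in>{1..l}. log_coeff lam t i * gegenbauer_kernel lam (l - i) t)"
        by (simp add: log_coeff_def)
      then show ?thesis
        using gegenbauer_kernel_recurrence[OF t lam, of l] False by (simp add: field_simps)
    qed
    ultimately show ?thesis
      by (rule continuous_on_eq) auto
  qed
qed

section \<open>Radial derivatives of the Poisson density\<close>

text \<open>
  The \<open>k\<close>-th power series is \<open>p\<^sub>r\<^sup>-\<^sup>1 (r \<partial>\<^sub>r)\<^sup>k p\<^sub>r\<close>. The recursion is the product rule, with the logarithmic
  derivative of \<open>p\<^sub>r\<close> as the factor of the second summand.
\<close>

fun derivative_factor :: "real \<Rightarrow> real \<Rightarrow> nat \<Rightarrow> real fps" where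
  "derivative_factor lam t 0 = 1"
| "derivative_factor lam t (Suc k) =
     fps_XD (derivative_factor lam t k) + Abs_fps (log_coeff lam t) * derivative_factor lam t k"

lemma fps_XD_funpow_gegenbauer_kernel:
  assumes t: "t \<in> {-1..1}" and lam: "lam > 0"
  shows "(fps_XD ^^ k) (Abs_fps (\<lambda>l. gegenbauer_kernel lam l t)) =
    derivative_factor lam t k * Abs_fps (\<lambda>l. gegenbauer_kernel lam l t)"
proof (induction k)
  case (Suc k)
  let ?P = "Abs_fps (\<lambda>l. gegenbauer_kernel lam l t)"
  have P: "fps_XD ?P = Abs_fps (log_coeff lam t) * ?P"
    by (rule fps_ext, unfold fps_XD_nth fps_nth_Abs_fps fps_mult_nth atLeast0AtMost)
      (rule gegenbauer_kernel_recurrence[OF t lam])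
  have X: "fps_XD (a * b) = fps_XD a * b + a * fps_XD b" for a b :: "real fps"
    by (simp add: fps_XD_def ring_distribs mult_ac)
  have "(fps_XD ^^ Suc k) ?P = fps_XD (derivative_factor lam t k * ?P)"
    unfolding funpow.simps(2) comp_apply Suc ..
  also have "\<dots> = derivative_factor lam t (Suc k) * ?P"
    unfolding X P derivative_factor.simps(2) distrib_right mult.assoc mult.left_commute[of "derivative_factor lam t k"] ..
  finally show ?case .
qed simp

text \<open>
  The operator \<open>r \<partial>\<^sub>r\<close> multiplies the \<open>l\<close>-th coefficient by \<open>l\<close>, and a product with a series of bounded
  coefficients and zero constant term sums at most \<open>l\<close> earlier coefficients; both raise the order of
  growth by one.
\<close>

lemma derivative_factor_bound:
  assumes lam: "lam > 0"
  shows "\<exists>C\<ge>0. \<forall>t. fps_nth (derivative_factor lam t (Suc k)) 0 = 0 \<and>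
    (\<forall>l>0. \<bar>fps_nth (derivative_factor lam t (Suc k)) l\<bar> \<le> C * real l ^ k)"
proof (induction k)
  case 0
  have "fps_nth (derivative_factor lam t (Suc 0)) l = log_coeff lam t l" for t l
    by (cases "l = 0") (auto simp: log_coeff_def)
  moreover have "log_coeff lam t 0 = 0" for t by (simp add: log_coeff_def)
  ultimately show ?case
    using log_coeff_bound[OF lam] lam
    by (intro exI[of _ "2 * lam + 4"] conjI allI impI) (auto simp del: derivative_factor.simps)
next
  case (Suc k)
  then obtain C where C: "C \<ge> 0" "\<And>t. fps_nth (derivative_factor lam t (Suc k)) 0 = 0"
    "\<And>t l. l > 0 \<Longrightarrow> \<bar>fps_nth (derivative_factor lam t (Suc k)) l\<bar> \<le> C * real l ^ k" by blast
  let ?M = "2 * lam + 4"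
  have st: "fps_nth (derivative_factor lam t (Suc (Suc k))) l = real l * fps_nth (derivative_factor lam t (Suc k)) l
      + (\<Sum>i=0..l. log_coeff lam t i * fps_nth (derivative_factor lam t (Suc k)) (l - i))" for t l
  proof -
    define D where "D = derivative_factor lam t (Suc k)"
    have "derivative_factor lam t (Suc (Suc k)) = fps_XD D + Abs_fps (log_coeff lam t) * D"
      unfolding D_def by (rule derivative_factor.simps(2))
    then show ?thesis unfolding D_def[symmetric] by (simp add: fps_mult_nth)
  qed
  show ?case
  proof (intro exI[of _ "C + ?M * C"] conjI allI impI)
    show "0 \<le> C + ?M * C" using C lam by simp
    show "fps_nth (derivative_factor lam t (Suc (Suc k))) 0 = 0" for t
      unfolding st by (simp add: log_coeff_def)
    fix t and l :: nat assume l: "l > 0"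
    have "\<bar>\<Sum>i=0..l. log_coeff lam t i * fps_nth (derivative_factor lam t (Suc k)) (l - i)\<bar>
      = \<bar>\<Sum>i\<in>{0<..l}. log_coeff lam t i * fps_nth (derivative_factor lam t (Suc k)) (l - i)\<bar>"
      by (subst sum.head) (auto simp: log_coeff_def)
    also have "\<dots> \<le> (\<Sum>i\<in>{0<..l}. ?M * (C * real l ^ k))"
    proof (rule order_trans[OF sum_abs], rule sum_mono)
      fix i assume i: "i \<in> {0<..l}"
      have "\<bar>fps_nth (derivative_factor lam t (Suc k)) (l - i)\<bar> \<le> C * real l ^ k"
      proof (cases "l = i")
        case True then show ?thesis using C by (simp del: derivative_factor.simps)
      next
        case False
        then have "\<bar>fps_nth (derivative_factor lam t (Suc k)) (l - i)\<bar> \<le> C * real (l - i) ^ k"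
          using i by (intro C) auto
        also have "\<dots> \<le> C * real l ^ k" using C by (intro mult_left_mono power_mono) auto
        finally show ?thesis .
      qed
      then show "\<bar>log_coeff lam t i * fps_nth (derivative_factor lam t (Suc k)) (l - i)\<bar> \<le> ?M * (C * real l ^ k)"
        unfolding abs_mult using lam log_coeff_bound[OF lam] by (intro mult_mono) auto
    qed
    also have "\<dots> = ?M * C * real l ^ Suc k" by simp
    finally have "\<bar>\<Sum>i=0..l. log_coeff lam t i * fps_nth (derivative_factor lam t (Suc k)) (l - i)\<bar> \<le> ?M * C * real l ^ Suc k" .
    moreover have "\<bar>real l * fps_nth (derivative_factor lam t (Suc k)) l\<bar> \<le> C * real l ^ Suc k"
    proof -
      have "real l * \<bar>fps_nth (derivative_factor lam t (Suc k)) l\<bar> \<le> real l * (C * real l ^ k)"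
        using l by (intro mult_left_mono C) auto
      then show ?thesis by (simp add: abs_mult algebra_simps del: derivative_factor.simps)
    qed
    ultimately show "\<bar>fps_nth (derivative_factor lam t (Suc (Suc k))) l\<bar> \<le> (C + ?M * C) * real l ^ Suc k"
      unfolding st ring_distribs by linarith
  qed
qed

lemma power_times_exp_le:
  fixes x c :: real
  assumes "x \<ge> 0" "c > 0"
  shows "x ^ k * exp (- (c * x)) \<le> fact k / c ^ k"
proof -
  have "(\<Sum>n\<in>{k}. (c * x) ^ n /\<^sub>R fact n) \<le> (\<Sum>n. (c * x) ^ n /\<^sub>R fact n)"
    by (rule sum_le_suminf[OF summable_exp_generic]) (use assms in auto)
  then have "c ^ k * x ^ k / fact k \<le> exp (c * x)"
    by (simp add: exp_def power_mult_distrib divide_inverse mult.commute)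
  then have "c ^ k * x ^ k \<le> fact k * exp (c * x)"
    by (simp add: divide_le_eq mult.commute)
  then show ?thesis using assms by (simp add: exp_minus field_simps)
qed

lemma summable_power_exp:
  fixes \<rho> c :: real
  assumes "\<rho> > 0" "c \<ge> 0"
  shows "summable (\<lambda>l. (real l + c) ^ k * exp (- (\<rho> * real l)))"
proof (rule summable_comparison_test')
  have "summable (\<lambda>l. exp (- (\<rho> / 2)) ^ l)" using assms by (intro summable_geometric) simp
  then show "summable (\<lambda>l. fact k / (\<rho> / 2) ^ k * exp (\<rho> * c / 2) * exp (- (\<rho> / 2)) ^ l)"
    by (rule summable_mult)
  fix l :: nat
  have "(real l + c) ^ k * exp (- (\<rho> / 2 * (real l + c))) \<le> fact k / (\<rho> / 2) ^ k"
    using assms by (intro power_times_exp_le) auto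
  then have "((real l + c) ^ k * exp (- (\<rho> / 2 * (real l + c)))) * exp (\<rho> * c / 2 - \<rho> / 2 * real l)
     \<le> fact k / (\<rho> / 2) ^ k * exp (\<rho> * c / 2 - \<rho> / 2 * real l)"
    by (intro mult_right_mono) auto
  moreover have "exp (- (\<rho> / 2 * (real l + c))) * exp (\<rho> * c / 2 - \<rho> / 2 * real l) = exp (- (\<rho> * real l))"
    unfolding exp_add[symmetric] by (simp add: field_simps)
  moreover have "exp (\<rho> * c / 2 - \<rho> / 2 * real l) = exp (\<rho> * c / 2) * exp (- (\<rho> / 2)) ^ l"
    unfolding exp_of_nat_mult[symmetric] exp_add[symmetric] by (simp add: field_simps)
  ultimately show "norm ((real l + c) ^ k * exp (- (\<rho> * real l))) \<le>
      fact k / (\<rho> / 2) ^ k * exp (\<rho> * c / 2) * exp (- (\<rho> / 2)) ^ l"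
    using assms by (simp add: mult.assoc)
qed

lemma summable_power_binomial_exp:
  fixes \<rho> :: real
  assumes "\<rho> > 0"
  shows "summable (\<lambda>l. real l ^ k * real ((l + M) choose M) * exp (- (\<rho> * real l)))"
proof (rule summable_comparison_test'[OF summable_power_exp[OF assms, of "real M" "k + M"]])
  fix l :: nat
  have "real ((l + M) choose M) \<le> real ((l + M) ^ M)"
    by (intro of_nat_mono binomial_le_pow) simp
  then have "real l ^ k * real ((l + M) choose M) \<le> (real l + real M) ^ k * (real l + real M) ^ M"
    by (intro mult_mono power_mono) auto
  then show "norm (real l ^ k * real ((l + M) choose M) * exp (- (\<rho> * real l))) \<le>
    (real l + real M) ^ (k + M) * exp (- (\<rho> * real l))"
    by (simp add: power_add)
qed (simp)

text \<open>
  Half of the exponential absorbs the power, \<open>l\<^sup>k e\<^bsup>-\<rho>l/2\<^esup> \<le> k! (2/\<rho>)\<^sup>k\<close>; the other half leaves a geometric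
  series without its constant term, whose sum is at most \<open>2/\<rho>\<close>.
\<close>

lemma suminf_power_exp_bound:
  assumes r: "\<rho> > 0"
  shows "\<rho> ^ Suc k * (\<Sum>l. (if l = 0 then 0 else real l ^ k) * exp (- (\<rho> * real l))) \<le> 2 ^ Suc k * fact k"
proof -
  define q where "q = exp (- (\<rho> / 2))"
  have q: "0 < q" "q < 1" using r by (auto simp: q_def)
  have gs: "(\<lambda>l. q ^ l - (if l = 0 then 1 else 0)) sums (1 / (1 - q) - 1)"
    by (intro sums_diff geometric_sums sums_single[of 0 "\<lambda>_. 1"]) (use q in auto)
  let ?c = "fact k * (2 / \<rho>) ^ k"
  have le: "(if l = 0 then 0 else real l ^ k) * exp (- (\<rho> * real l)) \<le>
      ?c * (q ^ l - (if l = 0 then 1 else 0))" for l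
  proof (cases "l = 0")
    case False
    have "real l ^ k * exp (- (\<rho> / 2 * real l)) \<le> fact k / (\<rho> / 2) ^ k"
      using r by (intro power_times_exp_le) auto
    then have "(real l ^ k * exp (- (\<rho> / 2 * real l))) * q ^ l \<le> (fact k / (\<rho> / 2) ^ k) * q ^ l"
      using q by (intro mult_right_mono) auto
    moreover have "exp (- (\<rho> / 2 * real l)) * q ^ l = exp (- (\<rho> * real l))"
      unfolding q_def exp_of_nat_mult[symmetric] exp_add[symmetric] by (simp add: field_simps)
    moreover have "fact k / (\<rho> / 2) ^ k = ?c" by (simp add: power_divide)
    ultimately show ?thesis using False by (simp add: mult.assoc)
  qed simp
  have sm: "summable (\<lambda>l. (if l = 0 then 0 else real l ^ k) * exp (- (\<rho> * real l)))"
    by (rule summable_comparison_test'[OF summable_power_exp[OF r, of 0 k]]) auto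
  have "(\<Sum>l. (if l = 0 then 0 else real l ^ k) * exp (- (\<rho> * real l))) \<le>
      (\<Sum>l. ?c * (q ^ l - (if l = 0 then 1 else 0)))"
    by (rule suminf_le[OF le sm]) (use gs in \<open>auto simp: sums_iff intro!: summable_mult\<close>)
  also have "\<dots> = ?c * (1 / (1 - q) - 1)" using sums_mult[OF gs, of ?c] by (simp add: sums_iff)
  also have "1 / (1 - q) - 1 \<le> 2 / \<rho>"
  proof -
    have "1 + \<rho> / 2 \<le> exp (\<rho> / 2)" by (rule exp_ge_add_one_self)
    then have "1 + \<rho> / 2 \<le> 1 / q" by (simp add: q_def exp_minus field_simps)
    then have "q * \<rho> \<le> 2 * (1 - q)" using q by (simp add: field_simps)
    then show ?thesis using q r by (simp add: field_simps)
  qed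
  finally have "(\<Sum>l. (if l = 0 then 0 else real l ^ k) * exp (- (\<rho> * real l))) \<le> ?c * (2 / \<rho>)"
    by (simp add: mult_left_mono r less_imp_le)
  then have "\<rho> ^ Suc k * (\<Sum>l. (if l = 0 then 0 else real l ^ k) * exp (- (\<rho> * real l))) \<le>
     \<rho> ^ Suc k * (?c * (2 / \<rho>))" using r by (intro mult_left_mono) auto
  also have "\<dots> = 2 ^ Suc k * fact k" using r by (simp add: field_simps)
  finally show ?thesis .
qed

lemma summable_gegenbauer_kernel_exp:
  assumes t: "t \<in> {-1..1}" and lam: "lam > 0" and r: "\<rho> > 0"
  shows "summable (\<lambda>l. norm (real l ^ k * gegenbauer_kernel lam l t * exp (- (\<rho> * real l))))"
proof -
  obtain M :: nat where M: "2 * lam + 4 \<le> real M" using real_arch_simple by blast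
  show ?thesis
  proof (rule summable_comparison_test'[OF summable_power_binomial_exp[OF r, of k M]])
    fix l
    show "norm (norm (real l ^ k * gegenbauer_kernel lam l t * exp (- (\<rho> * real l)))) \<le>
        real l ^ k * real ((l + M) choose M) * exp (- (\<rho> * real l))"
      using gegenbauer_kernel_bound[OF t lam M, of l]
      by (simp add: abs_mult mult_mono mult_left_mono mult_right_mono)
  qed
qed

text \<open>
  The series without \<open>\<rho>\<^sup>k\<close> is \<open>(r \<partial>\<^sub>r)\<^sup>k p\<^sub>r\<close> at \<open>r = e\<^bsup>-\<rho>\<^esup>\<close>, which is \<open>p\<^sub>r\<close> times a factor of size \<open>O(\<rho>\<^bsup>-k\<^esup>)\<close>. The
  positivity of \<open>p\<^sub>r\<close> makes it a majorant whose weighted integral can be computed.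
\<close>

lemma gegenbauer_kernel_series_bound:
  assumes lam: "lam > 0"
  shows "\<exists>C\<ge>0. \<forall>t\<in>{-1..1}. \<forall>\<rho>>0.
    \<bar>\<rho> ^ k * (\<Sum>l. real l ^ k * gegenbauer_kernel lam l t * exp (- (\<rho> * real l)))\<bar>
      \<le> C * poisson_density lam (exp (- \<rho>)) t"
proof (cases k)
  case 0
  have "(\<Sum>l. gegenbauer_kernel lam l t * exp (- (\<rho> * real l))) = poisson_density lam (exp (- \<rho>)) t"
    if "t \<in> {-1..1}" "\<rho> > 0" for t \<rho>
    using gegenbauer_kernel_sums[OF that(1), of "exp (- \<rho>)" lam] that(2) lam
    by (simp add: sums_iff exp_of_nat_mult[symmetric] mult.commute)
  then show ?thesis using 0 poisson_density_pos by (intro exI[of _ 1]) (auto simp: abs_of_pos)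
next
  case (Suc j)
  obtain C where C: "C \<ge> 0" "\<And>t. fps_nth (derivative_factor lam t (Suc j)) 0 = 0"
    "\<And>t l. l > 0 \<Longrightarrow> \<bar>fps_nth (derivative_factor lam t (Suc j)) l\<bar> \<le> C * real l ^ j"
    using derivative_factor_bound[OF lam, of j] by blast
  have "\<bar>\<rho> ^ k * (\<Sum>l. real l ^ k * gegenbauer_kernel lam l t * exp (- (\<rho> * real l)))\<bar>
      \<le> (C * (2 ^ Suc j * fact j)) * poisson_density lam (exp (- \<rho>)) t"
    if t: "t \<in> {-1..1}" and r: "\<rho> > 0" for t \<rho>
  proof -
    let ?D = "\<lambda>l. fps_nth (derivative_factor lam t (Suc j)) l"
    let ?e = "\<lambda>l. exp (- (\<rho> * real l))"
    let ?K = "\<lambda>l. gegenbauer_kernel lam l t"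
    let ?b = "\<lambda>l. (if l = 0 then 0 else real l ^ j) * ?e l"
    have sb: "summable ?b"
      by (rule summable_comparison_test'[OF summable_power_exp[OF r, of 0 j]]) auto
    have le: "\<bar>?D l * ?e l\<bar> \<le> C * ?b l" for l
      using C(2)[of t] C(3)[of l t] by (cases "l = 0") (auto simp: abs_mult simp del: derivative_factor.simps)
    have sD: "summable (\<lambda>l. norm (?D l * ?e l))"
      by (rule summable_comparison_test'[OF summable_mult[OF sb, of C]]) (use le in auto)
    have sK: "summable (\<lambda>l. norm (?K l * ?e l))"
      using summable_gegenbauer_kernel_exp[OF t lam r, of 0] by simp
    have pK: "(\<Sum>l. ?K l * ?e l) = poisson_density lam (exp (- \<rho>)) t"
      using gegenbauer_kernel_sums[OF t, of "exp (- \<rho>)" lam] r lam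
      by (simp add: sums_iff exp_of_nat_mult[symmetric] mult.commute)
    have "(\<lambda>l. \<Sum>i\<le>l. (?D i * ?e i) * (?K (l - i) * ?e (l - i))) sums
      ((\<Sum>l. ?D l * ?e l) * (\<Sum>l. ?K l * ?e l))"
      by (rule Cauchy_product_sums[OF sD sK])
    moreover have "(\<Sum>i\<le>l. (?D i * ?e i) * (?K (l - i) * ?e (l - i))) = real l ^ k * ?K l * ?e l" for l
    proof -
      have "real l ^ k * ?K l = fps_nth ((fps_XD ^^ k) (Abs_fps ?K)) l"
        by (simp add: fps_mult_fps_XD_shift)
      also have "\<dots> = (\<Sum>i\<le>l. ?D i * ?K (l - i))"
        by (simp only: fps_XD_funpow_gegenbauer_kernel[OF t lam] Suc fps_mult_nth atLeast0AtMost
            fps_nth_Abs_fps)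
      finally have "real l ^ k * ?K l * ?e l = (\<Sum>i\<le>l. ?D i * ?K (l - i) * ?e l)"
        by (simp only: sum_distrib_right)
      also have "\<dots> = (\<Sum>i\<le>l. (?D i * ?e i) * (?K (l - i) * ?e (l - i)))"
      proof (rule sum.cong[OF refl])
        fix i assume "i \<in> {..l}"
        then have "?e l = ?e i * ?e (l - i)"
          unfolding exp_add[symmetric] by (simp add: of_nat_diff algebra_simps)
        then show "?D i * ?K (l - i) * ?e l = (?D i * ?e i) * (?K (l - i) * ?e (l - i))" by simp
      qed
      finally show ?thesis by simp
    qed
    ultimately have eq: "(\<Sum>l. real l ^ k * ?K l * ?e l) =
        (\<Sum>l. ?D l * ?e l) * poisson_density lam (exp (- \<rho>)) t"
      by (simp add: sums_iff pK)
    have "\<bar>\<Sum>l. ?D l * ?e l\<bar> \<le> (\<Sum>l. \<bar>?D l * ?e l\<bar>)"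
      using summable_rabs[of "\<lambda>l. ?D l * ?e l"] sD by simp
    also have "\<dots> \<le> (\<Sum>l. C * ?b l)"
      using sD by (intro suminf_le[OF le _ summable_mult[OF sb]]) simp
    also have "\<dots> = C * (\<Sum>l. ?b l)" by (rule suminf_mult[OF sb])
    finally have "\<rho> ^ k * \<bar>\<Sum>l. ?D l * ?e l\<bar> \<le> \<rho> ^ k * (C * (\<Sum>l. ?b l))"
      using r by (intro mult_left_mono) auto
    also have "\<dots> = C * (\<rho> ^ Suc j * (\<Sum>l. ?b l))" unfolding Suc by (simp only: ac_simps)
    also have "\<dots> \<le> C * (2 ^ Suc j * fact j)"
      by (intro mult_left_mono suminf_power_exp_bound[OF r] C)
    finally have "\<rho> ^ k * \<bar>\<Sum>l. ?D l * ?e l\<bar> * poisson_density lam (exp (- \<rho>)) t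
      \<le> C * (2 ^ Suc j * fact j) * poisson_density lam (exp (- \<rho>)) t"
      using poisson_density_pos[OF t, of "exp (- \<rho>)" lam] r by (intro mult_right_mono) auto
    then show ?thesis
      unfolding eq using poisson_density_pos[OF t, of "exp (- \<rho>)" lam] r
      by (simp add: abs_mult abs_of_pos mult.assoc)
  qed
  moreover have "C * (2 ^ Suc j * fact j) \<ge> 0" using C by simp
  ultimately show ?thesis by blast
qed

section \<open>Convolution of Gegenbauer series\<close>

lemma summable_abs_power_binomial:
  fixes r :: real
  assumes "\<bar>r\<bar> < 1"
  shows "summable (\<lambda>l. \<bar>r ^ l\<bar> * real ((l + M) choose M))"
proof -
  \<comment> \<open>the lower bound 1/2 keeps \<open>ln s\<close> meaningful when \<open>r = 0\<close>\<close>
  define s where "s = max \<bar>r\<bar> (1 / 2)"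
  have s: "0 < s" "s < 1" "\<bar>r\<bar> \<le> s" using assms by (auto simp: s_def)
  have e: "exp (- (- ln s * real l)) = s ^ l" for l
    using s by (simp add: exp_of_nat2_mult)
  have "summable (\<lambda>l. real l ^ 0 * real ((l + M) choose M) * exp (- (- ln s * real l)))"
    by (rule summable_power_binomial_exp) (use s in simp)
  then have "summable (\<lambda>l. real ((l + M) choose M) * s ^ l)" unfolding e by simp
  then show ?thesis
    by (rule summable_comparison_test')
      (use s in \<open>auto simp: power_abs mult.commute intro!: mult_left_mono power_mono\<close>)
qed

lemma gegenbauer_series_abs_summable:
  assumes t: "t \<in> {-1..1}" and lam: "lam > 0" and M: "2 * lam + 4 \<le> real M"
    and \<alpha>: "summable (\<lambda>l. \<bar>\<alpha> l\<bar> * real ((l + M) choose M))"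
  shows "summable (\<lambda>l. norm (\<alpha> l * gegenbauer_kernel lam l t))"
  by (rule summable_comparison_test'[OF \<alpha>])
    (use gegenbauer_kernel_bound[OF t lam M] in \<open>auto simp: abs_mult intro!: mult_left_mono\<close>)

lemma continuous_on_gegenbauer_series:
  assumes lam: "lam > 0" and M: "2 * lam + 4 \<le> real M"
    and \<alpha>: "summable (\<lambda>l. \<bar>\<alpha> l\<bar> * real ((l + M) choose M))"
  shows "continuous_on {-1..1} (\<lambda>t. \<Sum>l. \<alpha> l * gegenbauer_kernel lam l t)"
proof (rule uniform_limit_theorem)
  show "uniform_limit {-1..1} (\<lambda>n t. \<Sum>l<n. \<alpha> l * gegenbauer_kernel lam l t)
      (\<lambda>t. \<Sum>l. \<alpha> l * gegenbauer_kernel lam l t) sequentially"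
  proof (rule Weierstrass_m_test[OF _ \<alpha>])
    fix l :: nat and t :: real assume "t \<in> {-1..1}"
    then show "norm (\<alpha> l * gegenbauer_kernel lam l t) \<le> \<bar>\<alpha> l\<bar> * real ((l + M) choose M)"
      unfolding real_norm_def abs_mult by (intro mult_left_mono gegenbauer_kernel_bound lam M) auto
  qed
  show "\<forall>\<^sub>F n in sequentially. continuous_on {-1..1} (\<lambda>t. \<Sum>l<n. \<alpha> l * gegenbauer_kernel lam l t)"
    by (intro always_eventually allI continuous_on_sum continuous_on_mult continuous_on_const
        continuous_on_gegenbauer_kernel lam)
qed simp

lemma inner_sphere_bounds:
  fixes x y :: "'a::euclidean_space"
  assumes "norm x = 1" "norm y = 1"
  shows "x \<bullet> y \<in> {-1..1}"
  using Cauchy_Schwarz_ineq2[of x y] assms by (auto simp: abs_le_iff)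

lemma continuous_on_sphere_inner:
  fixes x :: "'a::euclidean_space"
  assumes "continuous_on {-1..1} g" "norm x = 1"
  shows "continuous_on (sphere 0 1) (\<lambda>y. g (x \<bullet> y))"
  by (rule continuous_on_compose2[OF assms(1)])
    (use inner_sphere_bounds[OF assms(2)] in \<open>auto intro!: continuous_intros\<close>)

lemma sphere_measure_total:
  "measure (sphere_measure :: 'a::euclidean_space measure) (sphere 0 1) = sphere_area ((real DIM('a) - 2) / 2)"
proof -
  have "Gamma (real DIM('a) / 2) > 0" by (rule Gamma_real_pos) simp
  then have "sphere_area ((real DIM('a) - 2) / 2) \<ge> 0"
    unfolding sphere_area_def by (simp add: field_simps)
  then show ?thesis unfolding measure_def emeasure_sphere_measure_space by simp
qed

text \<open>
  Termwise integration; the binomial coefficients dominate the kernels on \<open>[-1, 1]\<close>.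
\<close>

lemma sphere_integral_gegenbauer_series:
  fixes f :: "'a::euclidean_space \<Rightarrow> real"
  assumes lam: "lam > 0" and M: "2 * lam + 4 \<le> real M"
    and \<alpha>: "summable (\<lambda>l. \<bar>\<alpha> l\<bar> * real ((l + M) choose M))"
    and f: "continuous_on (sphere 0 1) f" and x: "norm x = 1"
  shows "(\<lambda>l. \<alpha> l * (LINT y|sphere_measure. f y * gegenbauer_kernel lam l (x \<bullet> y))) sums
    (LINT y|sphere_measure. f y * (\<Sum>l. \<alpha> l * gegenbauer_kernel lam l (x \<bullet> y)))"
proof -
  let ?m = "measure (sphere_measure :: 'a measure) (sphere 0 1)"
  let ?g = "\<lambda>l y. f y * (\<alpha> l * gegenbauer_kernel lam l (x \<bullet> y))"
  obtain B where B: "\<And>x. x \<in> sphere 0 1 \<Longrightarrow> norm (f x) \<le> B" "B > 0"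
    using continuous_on_sphere_bounded[OF f] by metis
  have c: "continuous_on (sphere 0 1) (?g l)" for l
    by (intro continuous_intros f continuous_on_sphere_inner continuous_on_gegenbauer_kernel lam x)
  have s: "summable (\<lambda>l. norm (?g l y))" if "y \<in> sphere 0 1" for y
  proof -
    have "summable (\<lambda>l. norm (\<alpha> l * gegenbauer_kernel lam l (x \<bullet> y)))"
      by (rule gegenbauer_series_abs_summable[OF _ lam M \<alpha>])
        (use inner_sphere_bounds[OF x] that in auto)
    then show ?thesis unfolding norm_mult[of "f y"] by (rule summable_mult)
  qed
  have bd: "norm (?g l y) \<le> B * (\<bar>\<alpha> l\<bar> * real ((l + M) choose M))" if "y \<in> sphere 0 1" for l y
  proof -
    have "\<bar>gegenbauer_kernel lam l (x \<bullet> y)\<bar> \<le> real ((l + M) choose M)"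
      by (rule gegenbauer_kernel_bound[OF _ lam M]) (use inner_sphere_bounds[OF x] that in auto)
    then show ?thesis using B that unfolding real_norm_def abs_mult
      by (intro mult_mono) auto
  qed
  have "(\<lambda>l. LINT y|sphere_measure. ?g l y) sums (LINT y|sphere_measure. (\<Sum>l. ?g l y))"
  proof (rule sums_integral)
    show "integrable sphere_measure (?g l)" for l using c by (rule integrable_sphere_measure)
    show "AE y in sphere_measure. summable (\<lambda>l. norm (?g l y))" using s by (intro AE_I2) simp
    show "summable (\<lambda>l. LINT y|sphere_measure. norm (?g l y))"
    proof (rule summable_comparison_test')
      show "summable (\<lambda>l. B * (\<bar>\<alpha> l\<bar> * real ((l + M) choose M)) * ?m)"
        by (intro summable_mult summable_mult2 \<alpha>)
      fix l
      have "\<bar>LINT y|sphere_measure. norm (?g l y)\<bar> \<le> B * (\<bar>\<alpha> l\<bar> * real ((l + M) choose M)) * ?m"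
        by (rule sphere_integral_bound) (use bd[of _ l] c[of l] in \<open>auto intro!: continuous_intros\<close>)
      then show "norm (LINT y|sphere_measure. norm (?g l y)) \<le> B * (\<bar>\<alpha> l\<bar> * real ((l + M) choose M)) * ?m"
        by simp
    qed
  qed
  moreover have "(LINT y|sphere_measure. ?g l y) =
      \<alpha> l * (LINT y|sphere_measure. f y * gegenbauer_kernel lam l (x \<bullet> y))" for l
    by (subst integral_mult_right_zero[symmetric]) (simp add: mult_ac)
  moreover have "(LINT y|sphere_measure. (\<Sum>l. ?g l y)) =
      (LINT y|sphere_measure. f y * (\<Sum>l. \<alpha> l * gegenbauer_kernel lam l (x \<bullet> y)))"
  proof (rule Bochner_Integration.integral_cong[OF refl])
    fix y :: 'a assume "y \<in> space sphere_measure"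
    then have "summable (\<lambda>l. norm (\<alpha> l * gegenbauer_kernel lam l (x \<bullet> y)))"
      by (intro gegenbauer_series_abs_summable[OF _ lam M \<alpha>]) (use inner_sphere_bounds[OF x] in auto)
    then show "(\<Sum>l. ?g l y) = f y * (\<Sum>l. \<alpha> l * gegenbauer_kernel lam l (x \<bullet> y))"
      by (rule suminf_mult[OF summable_norm_cancel])
  qed
  ultimately show ?thesis by simp
qed

lemma ball_kernel_eq_poisson_density:
  fixes x y :: "'a::euclidean_space"
  assumes "norm x = 1" "norm y = 1" and lam: "lam = (real DIM('a) - 2) / 2"
  shows "ball_kernel (r *\<^sub>R x) y = poisson_density lam r (x \<bullet> y)"
proof -
  have "x \<bullet> x = 1" "y \<bullet> y = 1" using assms by (auto simp: dot_square_norm)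
  then have "(r *\<^sub>R x - y) \<bullet> (r *\<^sub>R x - y) = 1 - 2 * (x \<bullet> y) * r + r\<^sup>2" "(r *\<^sub>R x) \<bullet> (r *\<^sub>R x) = r\<^sup>2"
    by (simp_all add: inner_diff_left inner_diff_right inner_commute power2_eq_square)
  moreover have "- (real DIM('a) / 2) = - (lam + 1)" using lam by (simp add: field_simps)
  ultimately show ?thesis by (simp only: ball_kernel_def poisson_density_def)
qed

lemma poisson_density_semigroup:
  fixes x e :: "'a::euclidean_space"
  assumes x: "norm x = 1" and e: "norm e = 1" and r: "\<bar>r\<bar> < 1" and s: "\<bar>s\<bar> < 1"
    and lam: "lam = (real DIM('a) - 2) / 2"
  shows "(LINT y|sphere_measure. poisson_density lam s (e \<bullet> y) * poisson_density lam r (x \<bullet> y)) =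
    sphere_area lam * poisson_density lam (s * r) (x \<bullet> e)"
proof -
  have "(LINT y|sphere_measure. poisson_density lam s (e \<bullet> y) * poisson_density lam r (x \<bullet> y)) =
     (LINT y|sphere_measure. ball_kernel (r *\<^sub>R x) y * ball_kernel (s *\<^sub>R y) e)"
    using x e by (intro Bochner_Integration.integral_cong)
      (auto simp: ball_kernel_eq_poisson_density[OF _ _ lam] inner_commute)
  then show ?thesis
    unfolding ball_kernel_semigroup[OF x e r s] sphere_measure_total lam[symmetric]
      ball_kernel_eq_poisson_density[OF x e lam] .
qed

text \<open>
  Both sides of \<open>p\<^sub>s * p\<^sub>r = p\<^sub>s\<^sub>r\<close> are power series in \<open>r\<close> and in \<open>s\<close>. Comparing the coefficients of \<open>r\<^sup>k\<close> gives
  the convolution of \<open>p\<^sub>s\<close> with the \<open>k\<close>-th kernel; comparing then those of \<open>s\<^sup>l\<close> gives the claim.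
\<close>

lemma gegenbauer_kernel_convolution:
  fixes x e :: "'a::euclidean_space"
  assumes x: "norm x = 1" and e: "norm e = 1" and lam: "lam = (real DIM('a) - 2) / 2" "lam > 0"
  shows "(LINT y|sphere_measure. gegenbauer_kernel lam k (x \<bullet> y) * gegenbauer_kernel lam l (e \<bullet> y)) =
    (if l = k then sphere_area lam * gegenbauer_kernel lam k (x \<bullet> e) else 0)"
proof -
  obtain M :: nat where M: "2 * lam + 4 \<le> real M" using real_arch_simple by blast
  have xe: "x \<bullet> e \<in> {-1..1}" by (rule inner_sphere_bounds[OF x e])
  have series: "(\<Sum>l. r ^ l * gegenbauer_kernel lam l t) = poisson_density lam r t"
    if "t \<in> {-1..1}" "\<bar>r\<bar> < 1" for r t
    using gegenbauer_kernel_sums[OF that lam(2)] by (simp add: sums_iff mult.commute)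
  have step1: "(LINT y|sphere_measure. poisson_density lam s (e \<bullet> y) * gegenbauer_kernel lam k (x \<bullet> y)) =
      sphere_area lam * s ^ k * gegenbauer_kernel lam k (x \<bullet> e)" if s: "\<bar>s\<bar> < 1" for s k
  proof -
    have cs: "continuous_on {-1..1} (poisson_density lam s)"
      unfolding poisson_density_def using denominator_pos[OF _ s]
      by (intro continuous_intros) (auto simp: less_imp_neq[symmetric])
    let ?I = "\<lambda>k. LINT y|sphere_measure. poisson_density lam s (e \<bullet> y) * gegenbauer_kernel lam k (x \<bullet> y)"
    have "(\<lambda>k. ?I k * r ^ k) sums (sphere_area lam * poisson_density lam (s * r) (x \<bullet> e))"
      if r: "\<bar>r\<bar> < 1" for r
    proof -
      have "(\<lambda>k. r ^ k * ?I k) sums (LINT y|sphere_measure. poisson_density lam s (e \<bullet> y) *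
          (\<Sum>l. r ^ l * gegenbauer_kernel lam l (x \<bullet> y)))"
        by (rule sphere_integral_gegenbauer_series[OF lam(2) M summable_abs_power_binomial[OF r] _ x])
          (intro continuous_on_sphere_inner cs e)
      also have "(LINT y|sphere_measure. poisson_density lam s (e \<bullet> y) *
          (\<Sum>l. r ^ l * gegenbauer_kernel lam l (x \<bullet> y))) =
         (LINT y|sphere_measure. poisson_density lam s (e \<bullet> y) * poisson_density lam r (x \<bullet> y))"
        by (intro Bochner_Integration.integral_cong refl)
          (use series[OF inner_sphere_bounds[OF x] r] in auto)
      also have "\<dots> = sphere_area lam * poisson_density lam (s * r) (x \<bullet> e)"
        by (rule poisson_density_semigroup[OF x e r s lam(1)])
      finally show ?thesis by (simp add: mult.commute)
    qed
    moreover have "(\<lambda>k. sphere_area lam * s ^ k * gegenbauer_kernel lam k (x \<bullet> e) * r ^ k) sums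
        (sphere_area lam * poisson_density lam (s * r) (x \<bullet> e))" if r: "\<bar>r\<bar> < 1" for r
    proof -
      have "\<bar>s * r\<bar> < 1" using s r by (metis abs_ge_zero abs_mult mult_strict_mono' mult_1)
      then have "(\<lambda>k. sphere_area lam * (gegenbauer_kernel lam k (x \<bullet> e) * (s * r) ^ k)) sums
        (sphere_area lam * poisson_density lam (s * r) (x \<bullet> e))"
        by (intro sums_mult gegenbauer_kernel_sums xe lam)
      then show ?thesis by (simp add: power_mult_distrib mult_ac)
    qed
    ultimately show ?thesis
      by (rule fun_cong[OF powser_coeffs_unique])
  qed
  let ?J = "\<lambda>l. LINT y|sphere_measure. gegenbauer_kernel lam k (x \<bullet> y) * gegenbauer_kernel lam l (e \<bullet> y)"
  have "(\<lambda>l. ?J l * s ^ l) sums (sphere_area lam * s ^ k * gegenbauer_kernel lam k (x \<bullet> e))"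
    if s: "\<bar>s\<bar> < 1" for s
  proof -
    have "(\<lambda>l. s ^ l * ?J l) sums (LINT y|sphere_measure. gegenbauer_kernel lam k (x \<bullet> y) *
          (\<Sum>l. s ^ l * gegenbauer_kernel lam l (e \<bullet> y)))"
      by (rule sphere_integral_gegenbauer_series[OF lam(2) M summable_abs_power_binomial[OF s] _ e])
        (intro continuous_on_sphere_inner continuous_on_gegenbauer_kernel lam x)
    also have "(LINT y|sphere_measure. gegenbauer_kernel lam k (x \<bullet> y) *
          (\<Sum>l. s ^ l * gegenbauer_kernel lam l (e \<bullet> y))) =
       (LINT y|sphere_measure. poisson_density lam s (e \<bullet> y) * gegenbauer_kernel lam k (x \<bullet> y))"
      by (intro Bochner_Integration.integral_cong refl)
        (use series[OF inner_sphere_bounds[OF e] s] in auto)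
    finally show ?thesis unfolding step1[OF s] by (simp add: mult.commute)
  qed
  moreover have "(\<lambda>l. (if l = k then sphere_area lam * gegenbauer_kernel lam k (x \<bullet> e) else 0) * s ^ l) sums
      (sphere_area lam * s ^ k * gegenbauer_kernel lam k (x \<bullet> e))" if s: "\<bar>s\<bar> < 1" for s
  proof -
    have "(\<lambda>l. if l = k then sphere_area lam * gegenbauer_kernel lam k (x \<bullet> e) * s ^ l else 0) sums
        (sphere_area lam * gegenbauer_kernel lam k (x \<bullet> e) * s ^ k)" by (rule sums_single)
    moreover have "(\<lambda>l. if l = k then sphere_area lam * gegenbauer_kernel lam k (x \<bullet> e) * s ^ l else 0) =
      (\<lambda>l. (if l = k then sphere_area lam * gegenbauer_kernel lam k (x \<bullet> e) else 0) * s ^ l)" by auto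
    ultimately show ?thesis by (simp add: mult_ac)
  qed
  ultimately show ?thesis by (rule fun_cong[OF powser_coeffs_unique])
qed

lemma gegenbauer_series_convolution:
  fixes x e :: "'a::euclidean_space"
  assumes x: "norm x = 1" and e: "norm e = 1" and lam: "lam = (real DIM('a) - 2) / 2" "lam > 0"
    and M: "2 * lam + 4 \<le> real M"
    and \<alpha>: "summable (\<lambda>l. \<bar>\<alpha> l\<bar> * real ((l + M) choose M))"
  defines "g \<equiv> \<lambda>t. \<Sum>l. \<alpha> l * gegenbauer_kernel lam l t"
  shows "(LINT y|sphere_measure. g (e \<bullet> y) * g (x \<bullet> y)) =
    sphere_area lam * (\<Sum>l. (\<alpha> l)\<^sup>2 * gegenbauer_kernel lam l (x \<bullet> e))"
proof -
  have g: "continuous_on {-1..1} g"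
    unfolding g_def by (rule continuous_on_gegenbauer_series[OF lam(2) M \<alpha>])
  have "(LINT y|sphere_measure. g (e \<bullet> y) * gegenbauer_kernel lam k (x \<bullet> y)) =
      sphere_area lam * \<alpha> k * gegenbauer_kernel lam k (x \<bullet> e)" for k
  proof -
    let ?J = "\<lambda>l. LINT y|sphere_measure. gegenbauer_kernel lam k (x \<bullet> y) * gegenbauer_kernel lam l (e \<bullet> y)"
    have a: "(\<lambda>l. \<alpha> l * ?J l) sums (LINT y|sphere_measure. gegenbauer_kernel lam k (x \<bullet> y) * g (e \<bullet> y))"
      unfolding g_def
      by (rule sphere_integral_gegenbauer_series[OF lam(2) M \<alpha> _ e])
        (intro continuous_on_sphere_inner continuous_on_gegenbauer_kernel lam x)
    have b: "(\<lambda>l. \<alpha> l * ?J l) =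
        (\<lambda>l. if l = k then \<alpha> l * (sphere_area lam * gegenbauer_kernel lam k (x \<bullet> e)) else 0)"
      unfolding gegenbauer_kernel_convolution[OF x e lam] by auto
    have c: "\<dots> sums (\<alpha> k * (sphere_area lam * gegenbauer_kernel lam k (x \<bullet> e)))"
      by (rule sums_single)
    have "(LINT y|sphere_measure. gegenbauer_kernel lam k (x \<bullet> y) * g (e \<bullet> y)) =
       \<alpha> k * (sphere_area lam * gegenbauer_kernel lam k (x \<bullet> e))"
      by (rule sums_unique2[OF a[unfolded b] c])
    then show ?thesis by (simp add: mult_ac)
  qed
  moreover have "(\<lambda>l. \<alpha> l * (LINT y|sphere_measure. g (e \<bullet> y) * gegenbauer_kernel lam l (x \<bullet> y))) sums
    (LINT y|sphere_measure. g (e \<bullet> y) * g (x \<bullet> y))"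
    unfolding g_def
    by (rule sphere_integral_gegenbauer_series[OF lam(2) M \<alpha> _ x])
      (use g in \<open>auto simp: g_def intro!: continuous_on_sphere_inner e\<close>)
  ultimately have s: "(\<lambda>l. sphere_area lam * ((\<alpha> l)\<^sup>2 * gegenbauer_kernel lam l (x \<bullet> e))) sums
    (LINT y|sphere_measure. g (e \<bullet> y) * g (x \<bullet> y))"
    by (simp add: power2_eq_square mult_ac)
  have "sphere_area lam > 0"
    unfolding sphere_area_def using lam(2) by (auto intro!: divide_pos_pos Gamma_real_pos)
  then have "summable (\<lambda>l. (\<alpha> l)\<^sup>2 * gegenbauer_kernel lam l (x \<bullet> e))"
    using sums_summable[OF s] by (subst (asm) summable_cmult_iff) auto
  then show ?thesis using s by (simp add: sums_iff suminf_mult)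
qed

section \<open>Integration over scales\<close>

text \<open>
  The regularized upper incomplete Gamma function \<open>\<Gamma>(n, s) / \<Gamma>(n)\<close>.
\<close>

definition exp_tail :: "nat \<Rightarrow> real \<Rightarrow> real" where
  "exp_tail n s = (\<Sum>k<n. s ^ k / fact k * exp (- s))"

lemma exp_tail_0: "n > 0 \<Longrightarrow> exp_tail n 0 = 1"
  by (induction n) (auto simp: exp_tail_def power_0_left)

lemma exp_tail_nonneg: "s \<ge> 0 \<Longrightarrow> exp_tail n s \<ge> 0"
  unfolding exp_tail_def by (intro sum_nonneg) auto

lemma has_real_derivative_exp_tail:
  "(exp_tail (Suc n) has_real_derivative - (s ^ n / fact n * exp (- s))) (at s)"
proof (induction n)
  case 0
  have "exp_tail (Suc 0) = (\<lambda>s. exp (- s))" by (simp add: exp_tail_def fun_eq_iff)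
  then show ?case by (auto intro!: derivative_eq_intros)
next
  case (Suc n)
  have e: "exp_tail (Suc (Suc n)) = (\<lambda>s. exp_tail (Suc n) s + s ^ Suc n / fact (Suc n) * exp (- s))"
    by (simp add: exp_tail_def fun_eq_iff)
  have D: "((\<lambda>s. s ^ Suc n / fact (Suc n) * exp (- s)) has_real_derivative
      real (Suc n) * s ^ n / fact (Suc n) * exp (- s) - s ^ Suc n / fact (Suc n) * exp (- s)) (at s)"
    by (rule derivative_eq_intros refl | simp)+
  have "real (Suc n) * s ^ n / fact (Suc n) = s ^ n / fact n" by simp
  then show ?case unfolding e using DERIV_add[OF Suc D] by (simp only:) simp
qed

lemma exp_tail_tendsto: "(exp_tail n \<longlongrightarrow> 0) at_top"
proof -
  have "((\<lambda>s::real. \<Sum>k<n. 1 / fact k * (s ^ k / exp s)) \<longlongrightarrow> (\<Sum>k<n. 1 / fact k * 0)) at_top"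
    by (rule tendsto_sum, rule tendsto_mult_left, rule tendsto_power_div_exp_0)
  moreover have "exp_tail n = (\<lambda>s. \<Sum>k<n. 1 / fact k * (s ^ k / exp s))"
    by (simp add: exp_tail_def fun_eq_iff exp_minus divide_inverse mult_ac)
  ultimately show ?thesis by simp
qed

lemma poisson_psi_square:
  assumes m: "m \<ge> 1"
  shows "(poisson_psi m (a * x))\<^sup>2 / a = 2 * x * ((2 * x * a) ^ (2 * m - 1) / fact (2 * m - 1) * exp (- (2 * x * a)))"
proof (cases "a = 0")
  case True then show ?thesis using m by (simp add: power_0_left)
next
  case False
  obtain j where j: "m = Suc j" using m by (cases m) auto
  have n: "2 * m = Suc (Suc (2 * j))" "2 * m - 1 = Suc (2 * j)" using j by auto
  have "2 * real m = 1 + real (Suc (2 * j))" using j by simp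
  then have G: "Gamma (2 * real m) = fact (Suc (2 * j))" by (simp only: Gamma_fact)
  have "(poisson_psi m (a * x))\<^sup>2 = (2 ^ m)\<^sup>2 / fact (Suc (2 * j)) * ((a * x) ^ m)\<^sup>2 * (exp (- (a * x)))\<^sup>2"
    unfolding poisson_psi_def G by (simp add: power_mult_distrib power_divide del: fact_Suc)
  also have "(2 ^ m)\<^sup>2 = (2::real) * 2 ^ (Suc (2 * j))" unfolding power_mult[symmetric] mult.commute[of m] n by simp
  also have "((a * x) ^ m)\<^sup>2 = (a * x) * (a * x) ^ Suc (2 * j)"
    unfolding power_mult[symmetric] mult.commute[of m] n by simp
  also have "(exp (- (a * x)))\<^sup>2 = exp (- (2 * x * a))"
    unfolding exp_of_nat_mult[symmetric] by (simp add: exp_double[symmetric] mult_ac)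
  finally have "(poisson_psi m (a * x))\<^sup>2 / a = 2 * 2 ^ Suc (2 * j) / fact (Suc (2 * j)) * (x * (a * x) ^ Suc (2 * j)) * exp (- (2 * x * a))"
    using False by (simp del: fact_Suc power_Suc)
  also have "\<dots> = 2 * x * ((2 * x * a) ^ Suc (2 * j) / fact (Suc (2 * j)) * exp (- (2 * x * a)))"
    by (simp add: power_mult_distrib mult_ac del: fact_Suc power_Suc)
  finally show ?thesis unfolding n(2) .
qed

text \<open>
  The integral of \<open>\<psi>\<^sub>m(al)\<^sup>2 / a\<close> over \<open>a \<ge> R\<close>. For \<open>l = 0\<close> it vanishes because \<open>\<psi>\<^sub>m(0) = 0\<close>, whereas the
  incomplete Gamma function would give 1.
\<close>

definition radial_factor :: "nat \<Rightarrow> real \<Rightarrow> nat \<Rightarrow> real" where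
  "radial_factor m R l = (if l = 0 then 0 else exp_tail (2 * m) (2 * R * real l))"

lemma radial_factor_nonneg: "R \<ge> 0 \<Longrightarrow> radial_factor m R l \<ge> 0"
  by (simp add: radial_factor_def exp_tail_nonneg)

text \<open>
  The integrand is minus the derivative of \<open>a \<mapsto> \<Gamma>(2m, 2al) / \<Gamma>(2m)\<close>.
\<close>

lemma has_bochner_integral_poisson_psi:
  assumes m: "m \<ge> 1" and R: "R \<ge> 0"
  shows "has_bochner_integral lborel (\<lambda>a. indicator {R..} a * ((poisson_psi m (a * real l))\<^sup>2 / a)) (radial_factor m R l)"
proof (cases "l = 0")
  case True
  have "(\<lambda>a. indicator {R..} a * ((poisson_psi m (a * real l))\<^sup>2 / a)) = (\<lambda>a. 0)"
    using True m by (simp add: poisson_psi_def power_0_left)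
  then show ?thesis using True by (simp add: radial_factor_def has_bochner_integral_zero)
next
  case False
  define x where "x = real l"
  have x: "x > 0" using False by (simp add: x_def)
  define f where "f a = 2 * x * ((2 * x * a) ^ (2 * m - 1) / fact (2 * m - 1) * exp (- (2 * x * a)))" for a
  have fm [measurable]: "f \<in> borel_measurable borel" unfolding f_def by measurable
  have f0: "f a \<ge> 0" if "R \<le> a" for a using that R x by (simp add: f_def)
  have "(\<integral>\<^sup>+a. ennreal (f a) * indicator {R..} a \<partial>lborel) = ennreal (0 - - exp_tail (2 * m) (2 * x * R))"
  proof (rule nn_integral_FTC_atLeast[OF fm])
    fix a
    have "2 * m = Suc (2 * m - 1)" using m by simp
    then have "(exp_tail (2 * m) has_real_derivative
        - ((2 * x * a) ^ (2 * m - 1) / fact (2 * m - 1) * exp (- (2 * x * a)))) (at (2 * x * a))"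
      using has_real_derivative_exp_tail[of "2 * m - 1" "2 * x * a"] by simp
    moreover have "((\<lambda>a. 2 * x * a) has_real_derivative 2 * x) (at a)"
      by (auto intro!: derivative_eq_intros)
    ultimately have "((\<lambda>a. exp_tail (2 * m) (2 * x * a)) has_real_derivative
        - ((2 * x * a) ^ (2 * m - 1) / fact (2 * m - 1) * exp (- (2 * x * a))) * (2 * x)) (at a)"
      by (rule DERIV_chain2)
    from DERIV_minus[OF this]
    show "((\<lambda>a. - exp_tail (2 * m) (2 * x * a)) has_real_derivative f a) (at a)"
      by (rule DERIV_cong) (simp add: f_def)
  next
    have "filterlim (\<lambda>a. 2 * x * a) at_top at_top"
      using x by (intro filterlim_tendsto_pos_mult_at_top[OF tendsto_const] filterlim_ident) auto
    from tendsto_minus[OF filterlim_compose[OF exp_tail_tendsto this]]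
    show "((\<lambda>a. - exp_tail (2 * m) (2 * x * a)) \<longlongrightarrow> 0) at_top" by simp
  qed (rule f0)
  moreover have "ennreal (f a) * indicator {R..} a = ennreal (indicator {R..} a * f a)" for a
    by (simp split: split_indicator)
  ultimately have "has_bochner_integral lborel (\<lambda>a. indicator {R..} a * f a) (exp_tail (2 * m) (2 * x * R))"
    using x R f0 by (intro has_bochner_integral_nn_integral)
      (auto intro!: AE_I2 exp_tail_nonneg split: split_indicator)
  then show ?thesis
    unfolding f_def poisson_psi_square[OF m, symmetric] using False
    by (simp add: radial_factor_def x_def mult_ac)
qed

lemma poisson_psi_nat:
  "poisson_psi m (a * real l) = (2 ^ m / sqrt (Gamma (2 * real m)) * a ^ m) * (real l ^ m * exp (- (a * real l)))"
  by (simp add: poisson_psi_def power_mult_distrib mult_ac)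

lemma summable_poisson_psi:
  assumes "a > 0"
  shows "summable (\<lambda>l. \<bar>poisson_psi m (a * real l)\<bar> * real ((l + M) choose M))"
proof -
  have "summable (\<lambda>l. \<bar>2 ^ m / sqrt (Gamma (2 * real m)) * a ^ m\<bar> * (real l ^ m * real ((l + M) choose M) * exp (- (a * real l))))"
    by (intro summable_mult summable_power_binomial_exp assms)
  then show ?thesis unfolding poisson_psi_nat by (simp add: abs_mult mult_ac)
qed

lemma summable_poisson_psi_square:
  assumes "a > 0"
  shows "summable (\<lambda>l. \<bar>(poisson_psi m (a * real l))\<^sup>2\<bar> * real ((l + M) choose M))"
proof -
  have "summable (\<lambda>l. (2 ^ m / sqrt (Gamma (2 * real m)) * a ^ m)\<^sup>2 *
      (real l ^ (2 * m) * real ((l + M) choose M) * exp (- (2 * a * real l))))"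
    by (intro summable_mult summable_power_binomial_exp) (use assms in simp)
  moreover have "(poisson_psi m (a * real l))\<^sup>2 = (2 ^ m / sqrt (Gamma (2 * real m)) * a ^ m)\<^sup>2 *
      (real l ^ (2 * m) * exp (- (2 * a * real l)))" for l
  proof -
    have "(exp (- (a * real l)))\<^sup>2 = exp (- (2 * a * real l))"
      by (simp add: exp_double[symmetric] mult_ac)
    moreover have "(real l ^ m)\<^sup>2 = real l ^ (2 * m)" by (simp add: power_mult[symmetric] mult.commute)
    ultimately show ?thesis unfolding poisson_psi_nat power_mult_distrib by simp
  qed
  ultimately show ?thesis by (simp add: mult_ac)
qed

lemma summable_radial_factor:
  assumes R: "R > 0"
  shows "summable (\<lambda>l. \<bar>radial_factor m R l\<bar> * real ((l + M) choose M))"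
proof (rule summable_comparison_test')
  show "summable (\<lambda>l. \<Sum>k<2*m. (2 * R) ^ k / fact k * (real l ^ k * real ((l + M) choose M) * exp (- (2 * R * real l))))"
    by (intro summable_sum summable_mult summable_power_binomial_exp) (use R in simp)
  fix l
  have "exp_tail (2 * m) (2 * R * real l) * real ((l + M) choose M) =
     (\<Sum>k<2*m. (2 * R) ^ k / fact k * (real l ^ k * real ((l + M) choose M) * exp (- (2 * R * real l))))"
    unfolding exp_tail_def sum_distrib_right by (intro sum.cong refl) (simp add: power_mult_distrib mult_ac)
  moreover have "\<bar>radial_factor m R l\<bar> \<le> exp_tail (2 * m) (2 * R * real l)"
    using R by (simp add: radial_factor_def exp_tail_nonneg)
  ultimately show "norm (\<bar>radial_factor m R l\<bar> * real ((l + M) choose M)) \<le>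
      (\<Sum>k<2*m. (2 * R) ^ k / fact k * (real l ^ k * real ((l + M) choose M) * exp (- (2 * R * real l))))"
    by (metis abs_abs abs_mult abs_of_nat mult_right_mono of_nat_0_le_iff real_norm_def)
qed

lemma radial_integral:
  assumes t: "t \<in> {-1..1}" and lam: "lam > 0" and m: "m \<ge> 1" and R: "R > 0"
  shows "has_bochner_integral lborel
      (\<lambda>a. indicator {R..} a * ((\<Sum>l. (poisson_psi m (a * real l))\<^sup>2 * gegenbauer_kernel lam l t) / a))
      (\<Sum>l. radial_factor m R l * gegenbauer_kernel lam l t)"
proof -
  obtain M :: nat where M: "2 * lam + 4 \<le> real M" using real_arch_simple by blast
  define h where "h l a = indicator {R..} a * ((poisson_psi m (a * real l))\<^sup>2 / a)" for l and a :: real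
  define f where "f l a = h l a * gegenbauer_kernel lam l t" for l a
  have h: "has_bochner_integral lborel (h l) (radial_factor m R l)" for l
    unfolding h_def using R by (intro has_bochner_integral_poisson_psi m) simp
  have h0: "h l a \<ge> 0" for l a using R by (simp add: h_def split: split_indicator)
  have i: "integrable lborel (f l)" for l
    unfolding f_def using h[of l] by (intro integrable_mult_left) (simp add: has_bochner_integral_iff)
  have If: "(LINT a|lborel. f l a) = radial_factor m R l * gegenbauer_kernel lam l t" for l
    unfolding f_def using h[of l] by (simp add: has_bochner_integral_iff)
  have In: "(LINT a|lborel. norm (f l a)) = radial_factor m R l * \<bar>gegenbauer_kernel lam l t\<bar>" for l
    unfolding f_def norm_mult using h[of l] h0 by (simp add: has_bochner_integral_iff)
  have sf: "f l a = (indicator {R..} a / a) * ((poisson_psi m (a * real l))\<^sup>2 * gegenbauer_kernel lam l t)" for l a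
    by (simp add: f_def h_def)
  have psi: "summable (\<lambda>l. norm ((poisson_psi m (a * real l))\<^sup>2 * gegenbauer_kernel lam l t))" if "a > 0" for a
    by (rule gegenbauer_series_abs_summable[OF t lam M summable_poisson_psi_square[OF that]])
  have ae: "AE a in lborel. summable (\<lambda>l. norm (f l a))"
  proof (rule AE_I2)
    fix a :: real
    show "summable (\<lambda>l. norm (f l a))"
    proof (cases "R \<le> a")
      case True
      then show ?thesis unfolding sf norm_mult[of "indicator {R..} a / a"] using R
        by (intro summable_mult psi) simp
    qed (simp add: sf)
  qed
  have sn: "summable (\<lambda>l. LINT a|lborel. norm (f l a))"
  proof -
    have "summable (\<lambda>l. norm (radial_factor m R l * gegenbauer_kernel lam l t))"
      by (rule gegenbauer_series_abs_summable[OF t lam M summable_radial_factor[OF R]])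
    then show ?thesis unfolding In using R by (simp add: abs_mult radial_factor_nonneg)
  qed
  have eq: "(\<Sum>l. f l a) = indicator {R..} a * ((\<Sum>l. (poisson_psi m (a * real l))\<^sup>2 * gegenbauer_kernel lam l t) / a)" for a
  proof (cases "R \<le> a")
    case True
    then have "a > 0" using R by simp
    then have "(\<Sum>l. f l a) = indicator {R..} a / a * (\<Sum>l. (poisson_psi m (a * real l))\<^sup>2 * gegenbauer_kernel lam l t)"
      unfolding sf by (rule suminf_mult[OF summable_norm_cancel[OF psi]])
    then show ?thesis by simp
  qed (simp add: sf)
  have int: "integrable lborel (\<lambda>a. \<Sum>l. f l a)" by (rule integrable_suminf[OF i ae sn])
  have "(\<lambda>l. LINT a|lborel. f l a) sums (LINT a|lborel. (\<Sum>l. f l a))"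
    by (rule sums_integral[OF i ae sn])
  then have "(LINT a|lborel. (\<Sum>l. f l a)) = (\<Sum>l. radial_factor m R l * gegenbauer_kernel lam l t)"
    unfolding If by (rule sums_unique)
  with int have "has_bochner_integral lborel (\<lambda>a. \<Sum>l. f l a)
      (\<Sum>l. radial_factor m R l * gegenbauer_kernel lam l t)"
    unfolding has_bochner_integral_iff by blast
  then show ?thesis unfolding eq .
qed

section \<open>Poisson wavelets\<close>

lemma norm_pole [simp]: "norm (pole :: real \<times> (real ^ 'n)) = 1"
  by (simp add: pole_def norm_prod_def)

lemma poisson_wavelet_eq:
  assumes t: "t \<in> {-1..1}" and lam: "lam > 0" and a: "a > 0"
  shows "poisson_wavelet lam m a t =
    complex_of_real (\<Sum>l. poisson_psi m (a * real l) * gegenbauer_kernel lam l t)"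
proof -
  obtain M :: nat where M: "2 * lam + 4 \<le> real M" using real_arch_simple by blast
  have "summable (\<lambda>l. poisson_psi m (a * real l) * gegenbauer_kernel lam l t)"
    by (rule summable_norm_cancel[OF gegenbauer_series_abs_summable[OF t lam M summable_poisson_psi[OF a]]])
  then show ?thesis unfolding poisson_wavelet_def by (rule suminf_of_real[symmetric])
qed

lemma continuous_on_poisson_wavelet:
  assumes lam: "lam > 0" and a: "a > 0"
  shows "continuous_on {-1..1} (poisson_wavelet lam m a)"
proof -
  obtain M :: nat where M: "2 * lam + 4 \<le> real M" using real_arch_simple by blast
  have "continuous_on {-1..1} (\<lambda>t. complex_of_real (\<Sum>l. poisson_psi m (a * real l) * gegenbauer_kernel lam l t))"
    by (intro continuous_on_of_real continuous_on_gegenbauer_series[OF lam M] summable_poisson_psi a)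
  then show ?thesis
    by (rule continuous_on_eq) (simp add: poisson_wavelet_eq[OF _ lam a])
qed

lemma poisson_wavelet_convolution:
  fixes x :: "real \<times> (real ^ 'n)"
  assumes x: "norm x = 1" and lam: "lam = (real CARD('n) - 1) / 2" "lam > 0" and a: "a > 0"
  shows "sphere_convolution (zonal (\<lambda>t. cnj (poisson_wavelet lam m a t))) (poisson_wavelet lam m a) x =
    complex_of_real (\<Sum>l. (poisson_psi m (a * real l))\<^sup>2 * gegenbauer_kernel lam l (pole \<bullet> x))"
proof -
  obtain M :: nat where M: "2 * lam + 4 \<le> real M" using real_arch_simple by blast
  let ?g = "\<lambda>t. \<Sum>l. poisson_psi m (a * real l) * gegenbauer_kernel lam l t"
  have dim: "lam = (real DIM(real \<times> (real ^ 'n)) - 2) / 2" using lam(1) by simp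
  have "(LINT y|sphere_measure. zonal (\<lambda>t. cnj (poisson_wavelet lam m a t)) y * poisson_wavelet lam m a (x \<bullet> y)) =
      (LINT y|sphere_measure. complex_of_real (?g (pole \<bullet> y) * ?g (x \<bullet> y)))"
  proof (rule Bochner_Integration.integral_cong[OF refl])
    fix y :: "real \<times> (real ^ 'n)" assume "y \<in> space sphere_measure"
    then have y: "norm y = 1" by simp
    show "zonal (\<lambda>t. cnj (poisson_wavelet lam m a t)) y * poisson_wavelet lam m a (x \<bullet> y) =
        complex_of_real (?g (pole \<bullet> y) * ?g (x \<bullet> y))"
      unfolding zonal_def poisson_wavelet_eq[OF inner_sphere_bounds[OF norm_pole y] lam(2) a]
        poisson_wavelet_eq[OF inner_sphere_bounds[OF x y] lam(2) a] by simp
  qed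
  also have "\<dots> = complex_of_real (LINT y|sphere_measure. ?g (pole \<bullet> y) * ?g (x \<bullet> y))"
    by (rule integral_complex_of_real)
  also have "(LINT y|sphere_measure. ?g (pole \<bullet> y) * ?g (x \<bullet> y)) =
      sphere_area lam * (\<Sum>l. (poisson_psi m (a * real l))\<^sup>2 * gegenbauer_kernel lam l (x \<bullet> pole))"
    by (rule gegenbauer_series_convolution[OF x norm_pole dim lam(2) M summable_poisson_psi[OF a]])
  finally have eq: "(LINT y|sphere_measure. zonal (\<lambda>t. cnj (poisson_wavelet lam m a t)) y * poisson_wavelet lam m a (x \<bullet> y)) =
     complex_of_real (sphere_area lam * (\<Sum>l. (poisson_psi m (a * real l))\<^sup>2 * gegenbauer_kernel lam l (x \<bullet> pole)))" .
  have "sphere_area lam > 0"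
    unfolding sphere_area_def using lam(2) by (auto intro!: divide_pos_pos Gamma_real_pos)
  then show ?thesis
    unfolding sphere_convolution_def lam(1)[symmetric] eq by (simp add: inner_commute)
qed

lemma zonal_profile_poisson_wavelet_convolution:
  assumes t: "t \<in> {-1..1}" and lam: "lam = (real CARD('n::finite) - 1) / 2" "lam > 0" and a: "a > 0"
  shows "zonal_profile (sphere_convolution
      (zonal (\<lambda>t. cnj (poisson_wavelet lam m a t)) :: real \<times> (real ^ 'n) \<Rightarrow> complex)
      (poisson_wavelet lam m a)) t =
    complex_of_real (\<Sum>l. (poisson_psi m (a * real l))\<^sup>2 * gegenbauer_kernel lam l t)"
proof -
  let ?F = "sphere_convolution (zonal (\<lambda>t. cnj (poisson_wavelet lam m a t)) :: real \<times> (real ^ 'n) \<Rightarrow> complex)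
      (poisson_wavelet lam m a)"
  have F: "?F x = complex_of_real (\<Sum>l. (poisson_psi m (a * real l))\<^sup>2 * gegenbauer_kernel lam l (pole \<bullet> x))"
    if "x \<in> sphere 0 1" for x
    using that by (intro poisson_wavelet_convolution lam a) simp
  obtain x :: "real \<times> (real ^ 'n)" where x: "x \<in> sphere 0 1" "pole \<bullet> x = t"
    using ex_sphere_pole_inner[OF t] by blast
  have "zonal_profile ?F (pole \<bullet> x) = ?F x"
    by (rule zonal_profile_eq[OF _ x(1)]) (simp only: F)
  then show ?thesis unfolding F[OF x(1)] x(2) .
qed

text \<open>
  The integral over scales for \<open>l = 1\<close> and \<open>R = 0\<close>.
\<close>

lemma poisson_psi_admissible:
  assumes m: "m \<ge> 1"
  shows "(LINT t:{0<..}|lborel. \<bar>poisson_psi m t\<bar>\<^sup>2 / t) = 1"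
proof -
  have "has_bochner_integral lborel (\<lambda>a. indicator {0..} a * ((poisson_psi m (a * real 1))\<^sup>2 / a)) (radial_factor m 0 1)"
    by (rule has_bochner_integral_poisson_psi[OF m]) simp
  moreover have "radial_factor m 0 1 = 1" using m by (simp add: radial_factor_def exp_tail_0)
  moreover have "indicator {0<..} a *\<^sub>R (\<bar>poisson_psi m a\<bar>\<^sup>2 / a) = indicator {0..} a * ((poisson_psi m (a * real 1))\<^sup>2 / a)" for a :: real
    by (cases "a = 0") (auto split: split_indicator)
  ultimately show ?thesis unfolding set_lebesgue_integral_def by (simp only: has_bochner_integral_iff)
qed

lemma radial_integral_poisson_wavelet:
  fixes t :: real
  assumes t: "t \<in> {-1..1}" and lam: "lam = (real CARD('n::finite) - 1) / 2" "lam > 0"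
    and m: "m \<ge> 1" and R: "R > 0"
  defines "conv \<equiv> \<lambda>a. zonal_profile (sphere_convolution
      (zonal (\<lambda>t. cnj (poisson_wavelet lam m a t)) :: real \<times> (real ^ 'n) \<Rightarrow> complex)
      (poisson_wavelet lam m a))"
  shows "set_integrable lborel {R..} (\<lambda>a. conv a t / of_real a)"
    and "(LINT a:{R..}|lborel. conv a t / of_real a) =
      complex_of_real (\<Sum>l. radial_factor m R l * gegenbauer_kernel lam l t)"
proof -
  let ?f = "\<lambda>a. indicator {R..} a * ((\<Sum>l. (poisson_psi m (a * real l))\<^sup>2 * gegenbauer_kernel lam l t) / a)"
  have eq: "indicator {R..} a *\<^sub>R (conv a t / complex_of_real a) = complex_of_real (?f a)" for a :: real
  proof (cases "R \<le> a")
    case True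
    then have "a > 0" using R by simp
    then have "conv a t = complex_of_real (\<Sum>l. (poisson_psi m (a * real l))\<^sup>2 * gegenbauer_kernel lam l t)"
      unfolding conv_def by (rule zonal_profile_poisson_wavelet_convolution[OF t lam])
    then show ?thesis using True by simp
  qed simp
  have "has_bochner_integral lborel ?f (\<Sum>l. radial_factor m R l * gegenbauer_kernel lam l t)"
    by (rule radial_integral[OF t lam(2) m R])
  then have i: "integrable lborel ?f"
    and I: "(LINT a|lborel. ?f a) = (\<Sum>l. radial_factor m R l * gegenbauer_kernel lam l t)"
    unfolding has_bochner_integral_iff by auto
  show "set_integrable lborel {R..} (\<lambda>a. conv a t / of_real a)"
    unfolding set_integrable_def eq using i by (rule integrable_of_real)
  show "(LINT a:{R..}|lborel. conv a t / of_real a) =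
      complex_of_real (\<Sum>l. radial_factor m R l * gegenbauer_kernel lam l t)"
    unfolding set_lebesgue_integral_def eq integral_complex_of_real I ..
qed

section \<open>The uniform bound\<close>

text \<open>
  The series splits into \<open>2m\<close> weighted radial derivatives of the Poisson density at \<open>r = e\<^bsup>-2R\<^esup>\<close>; the summand
  1 accounts for the missing term \<open>l = 0\<close>.
\<close>

lemma radial_series_bound:
  assumes lam: "lam > 0" and m: "m \<ge> 1"
  shows "\<exists>C\<ge>0. \<forall>t\<in>{-1..1}. \<forall>R>0. \<bar>\<Sum>l. radial_factor m R l * gegenbauer_kernel lam l t\<bar> \<le>
    C * poisson_density lam (exp (- (2 * R))) t + 1"
proof -
  let ?S = "\<lambda>k (\<rho>::real) (t::real). \<rho> ^ k * (\<Sum>l. real l ^ k * gegenbauer_kernel lam l t * exp (- (\<rho> * real l)))"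
  have "\<forall>k. \<exists>C. C \<ge> 0 \<and> (\<forall>t\<in>{-1..1}. \<forall>\<rho>>0. \<bar>?S k \<rho> t\<bar> \<le> C * poisson_density lam (exp (- \<rho>)) t)"
    using gegenbauer_kernel_series_bound[OF lam] by (intro allI) blast
  from choice[OF this] obtain C where C: "\<And>k. C k \<ge> 0"
    "\<And>k t \<rho>. t \<in> {-1..1} \<Longrightarrow> \<rho> > 0 \<Longrightarrow> \<bar>?S k \<rho> t\<bar> \<le> C k * poisson_density lam (exp (- \<rho>)) t"
    by blast
  have "\<bar>\<Sum>l. radial_factor m R l * gegenbauer_kernel lam l t\<bar> \<le>
    (\<Sum>k<2*m. C k / fact k) * poisson_density lam (exp (- (2 * R))) t + 1"
    if t: "t \<in> {-1..1}" and R: "R > 0" for t R :: real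
  proof -
    define \<rho> where "\<rho> = 2 * R"
    have \<rho>: "\<rho> > 0" using R by (simp add: \<rho>_def)
    let ?K = "\<lambda>l. gegenbauer_kernel lam l t"
    have "(\<lambda>l. \<Sum>k<2*m. \<rho> ^ k / fact k * (real l ^ k * ?K l * exp (- (\<rho> * real l)))) sums
        (\<Sum>k<2*m. \<rho> ^ k / fact k * (\<Sum>l. real l ^ k * ?K l * exp (- (\<rho> * real l))))"
      by (intro sums_sum sums_mult summable_sums summable_norm_cancel[OF summable_gegenbauer_kernel_exp[OF t lam \<rho>]])
    moreover have "(\<Sum>k<2*m. \<rho> ^ k / fact k * (real l ^ k * ?K l * exp (- (\<rho> * real l)))) =
        exp_tail (2 * m) (\<rho> * real l) * ?K l" for l
      unfolding exp_tail_def sum_distrib_right by (intro sum.cong refl) (simp add: power_mult_distrib)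
    moreover have "(\<Sum>k<2*m. \<rho> ^ k / fact k * (\<Sum>l. real l ^ k * ?K l * exp (- (\<rho> * real l)))) =
        (\<Sum>k<2*m. ?S k \<rho> t / fact k)" by (intro sum.cong refl) simp
    ultimately have "(\<lambda>l. exp_tail (2 * m) (\<rho> * real l) * ?K l) sums (\<Sum>k<2*m. ?S k \<rho> t / fact k)" by simp
    from sums_diff[OF this sums_single[of 0 "\<lambda>_. 1"]]
    have "(\<lambda>l. exp_tail (2 * m) (\<rho> * real l) * ?K l - (if l = 0 then 1 else 0)) sums ((\<Sum>k<2*m. ?S k \<rho> t / fact k) - 1)" .
    moreover have "exp_tail (2 * m) (\<rho> * real l) * ?K l - (if l = 0 then 1 else 0) = radial_factor m R l * ?K l" for l
      using m t lam by (simp add: radial_factor_def \<rho>_def exp_tail_0)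
    ultimately have "(\<Sum>l. radial_factor m R l * ?K l) = (\<Sum>k<2*m. ?S k \<rho> t / fact k) - 1"
      by (simp add: sums_iff)
    also have "\<bar>\<dots>\<bar> \<le> \<bar>\<Sum>k<2*m. ?S k \<rho> t / fact k\<bar> + 1" by linarith
    also have "\<bar>\<Sum>k<2*m. ?S k \<rho> t / fact k\<bar> \<le> (\<Sum>k<2*m. C k * poisson_density lam (exp (- \<rho>)) t / fact k)"
    proof (rule order_trans[OF sum_abs], rule sum_mono)
      fix k
      show "\<bar>?S k \<rho> t / fact k\<bar> \<le> C k * poisson_density lam (exp (- \<rho>)) t / fact k"
        unfolding abs_divide abs_of_pos[OF fact_gt_zero[where 'a = real]]
        by (rule divide_right_mono[OF C(2)[OF t \<rho>]]) simp
    qed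
    also have "\<dots> = (\<Sum>k<2*m. C k / fact k) * poisson_density lam (exp (- (2 * R))) t"
      unfolding sum_distrib_right \<rho>_def by (intro sum.cong refl) simp
    finally show ?thesis by simp
  qed
  moreover have "(\<Sum>k<2*m. C k / fact k) \<ge> 0" using C(1) by (intro sum_nonneg) simp
  ultimately show ?thesis by blast
qed

text \<open>
  \<open>1 - 2tr + r\<^sup>2\<close> exceeds \<open>1 - t\<^sup>2\<close> by \<open>(r - t)\<^sup>2\<close>, and the exponent of the weight is nonnegative.
\<close>

lemma poisson_density_weight_le:
  assumes t: "t \<in> {-1..1}" and r: "\<bar>r\<bar> < 1" and lam: "lam \<ge> 1 / 2"
  shows "poisson_density lam r t * (1 - t\<^sup>2) powr (lam - 1 / 2) \<le>
    (1 - r\<^sup>2) * (1 - 2 * t * r + r\<^sup>2) powr (- (3 / 2))"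
proof -
  let ?B = "1 - 2 * t * r + r\<^sup>2"
  have B: "?B > 0" by (rule denominator_pos[OF t r])
  have r2: "1 - r\<^sup>2 \<ge> 0" using r by (simp add: abs_square_le_1)
  have "?B - (1 - t\<^sup>2) = (r - t)\<^sup>2" by (simp add: power2_eq_square algebra_simps)
  then have "1 - t\<^sup>2 \<le> ?B" using zero_le_power2[of "r - t"] by linarith
  moreover have "1 - t\<^sup>2 \<ge> 0" using t by (simp add: abs_square_le_1 abs_le_iff)
  ultimately have "(1 - t\<^sup>2) powr (lam - 1 / 2) \<le> ?B powr (lam - 1 / 2)"
    using lam by (intro powr_mono2) auto
  then have "(1 - r\<^sup>2) * ?B powr (- (lam + 1)) * (1 - t\<^sup>2) powr (lam - 1 / 2) \<le>
      (1 - r\<^sup>2) * ?B powr (- (lam + 1)) * ?B powr (lam - 1 / 2)"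
    using r2 by (intro mult_left_mono) auto
  also have "\<dots> = (1 - r\<^sup>2) * ?B powr (- (3 / 2))"
    by (simp add: mult.assoc powr_add[symmetric])
  finally show ?thesis unfolding poisson_density_def .
qed

text \<open>
  An antiderivative is \<open>(1 - r\<^sup>2) / r\<close> times \<open>(1 - 2tr + r\<^sup>2)\<^bsup>-1/2\<^esup>\<close>, which is \<open>(1 \<mp> r)\<^sup>-\<^sup>1\<close> at \<open>t = \<plusminus>1\<close>.
\<close>

lemma has_bochner_integral_poisson_weight:
  fixes r :: real
  assumes r: "0 < r" "r < 1"
  shows "has_bochner_integral lborel
    (\<lambda>t. (1 - r\<^sup>2) * (1 - 2 * t * r + r\<^sup>2) powr (- (3 / 2)) * indicator {-1..1} t) 2"
proof -
  let ?B = "\<lambda>t::real. 1 - 2 * t * r + r\<^sup>2"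
  let ?F = "\<lambda>t::real. (1 - r\<^sup>2) / r * ?B t powr (- (1 / 2))"
  have B: "?B t > 0" if "-1 \<le> t" "t \<le> 1" for t using denominator_pos[of t r] that r by simp
  have "has_bochner_integral lborel
    (\<lambda>t. (1 - r\<^sup>2) * ?B t powr (- (3 / 2)) * indicator {-1..1} t) (?F 1 - ?F (-1))"
  proof (rule has_bochner_integral_FTC_Icc_real)
    fix t :: real assume t: "-1 \<le> t" "t \<le> 1"
    have e: "- (1 / 2) - 1 = (- (3 / 2) :: real)" by simp
    have "(?B has_real_derivative - 2 * r) (at t)" by (auto intro!: derivative_eq_intros)
    from DERIV_cmult[OF DERIV_fun_powr[OF this B[OF t], of "- (1 / 2)"], of "(1 - r\<^sup>2) / r"]
    show "(?F has_real_derivative (1 - r\<^sup>2) * ?B t powr (- (3 / 2))) (at t)"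
      using r e by simp
    show "isCont (\<lambda>t. (1 - r\<^sup>2) * ?B t powr (- (3 / 2))) t"
      using B[OF t] by (intro continuous_intros) auto
  qed simp
  moreover have "?F 1 - ?F (-1) = 2"
  proof -
    have sq: "(x\<^sup>2) powr (- (1 / 2)) = 1 / x" if "x > 0" for x :: real
    proof -
      have "(x\<^sup>2) powr (- (1 / 2)) = (x powr 2) powr (- (1 / 2))" using that by (simp only: powr_numeral)
      also have "\<dots> = x powr (- 1)" unfolding powr_powr by simp
      finally show ?thesis using that by (simp add: powr_minus_divide)
    qed
    have B1: "?B 1 = (1 - r)\<^sup>2" "?B (-1) = (1 + r)\<^sup>2" by (simp_all add: power2_eq_square algebra_simps)
    have "?F 1 - ?F (-1) = (1 - r\<^sup>2) / r * (1 / (1 - r)) - (1 - r\<^sup>2) / r * (1 / (1 + r))"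
      unfolding B1 using sq[of "1 - r"] sq[of "1 + r"] r by (simp only: diff_gt_0_iff_gt add_pos_pos zero_less_one)
    also have "\<dots> = 2"
    proof -
      have e: "1 - r\<^sup>2 = (1 - r) * (1 + r)" by (simp add: power2_eq_square algebra_simps)
      have "1 - r \<noteq> 0" "1 + r \<noteq> 0" "r \<noteq> 0" using r by auto
      then have "(1 - r) * (1 + r) / r * (1 / (1 - r)) = (1 + r) / r"
        "(1 - r) * (1 + r) / r * (1 / (1 + r)) = (1 - r) / r" by simp_all
      then show ?thesis unfolding e using r by (simp add: diff_divide_distrib[symmetric])
    qed
    finally show ?thesis .
  qed
  ultimately show ?thesis by (simp only:)
qed

lemma weighted_radial_series_bound:
  assumes lam: "lam \<ge> 1 / 2" and m: "m \<ge> 1"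
  shows "\<exists>c. \<forall>R>0.
    set_integrable lborel {-1..1} (\<lambda>t. \<bar>\<Sum>l. radial_factor m R l * gegenbauer_kernel lam l t\<bar> * (1 - t\<^sup>2) powr (lam - 1 / 2)) \<and>
    (LINT t:{-1..1}|lborel. \<bar>\<Sum>l. radial_factor m R l * gegenbauer_kernel lam l t\<bar> * (1 - t\<^sup>2) powr (lam - 1 / 2)) \<le> c"
proof -
  have lam0: "lam > 0" using lam by simp
  obtain M :: nat where M: "2 * lam + 4 \<le> real M" using real_arch_simple by blast
  obtain C where C: "C \<ge> 0"
    "\<And>t R. t \<in> {-1..1} \<Longrightarrow> R > 0 \<Longrightarrow> \<bar>\<Sum>l. radial_factor m R l * gegenbauer_kernel lam l t\<bar> \<le>
      C * poisson_density lam (exp (- (2 * R))) t + 1"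
    using radial_series_bound[OF lam0 m] by blast
  have "set_integrable lborel {-1..1} (\<lambda>t. \<bar>\<Sum>l. radial_factor m R l * gegenbauer_kernel lam l t\<bar> * (1 - t\<^sup>2) powr (lam - 1 / 2)) \<and>
    (LINT t:{-1..1}|lborel. \<bar>\<Sum>l. radial_factor m R l * gegenbauer_kernel lam l t\<bar> * (1 - t\<^sup>2) powr (lam - 1 / 2)) \<le> 2 * C + 2"
    if R: "R > 0" for R
  proof -
    define r where "r = exp (- (2 * R))"
    have r: "0 < r" "r < 1" using R by (auto simp: r_def)
    let ?J = "\<lambda>t. \<Sum>l. radial_factor m R l * gegenbauer_kernel lam l t"
    let ?w = "\<lambda>t::real. (1 - t\<^sup>2) powr (lam - 1 / 2)"
    let ?b = "\<lambda>t. (1 - r\<^sup>2) * (1 - 2 * t * r + r\<^sup>2) powr (- (3 / 2))"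
    have b: "set_integrable lborel {-1..1} ?b" "(LINT t:{-1..1}|lborel. ?b t) = 2"
    proof -
      have e: "indicator {-1..1} t *\<^sub>R ?b t = ?b t * indicator {-1..1} t" for t by simp
      show "set_integrable lborel {-1..1} ?b" "(LINT t:{-1..1}|lborel. ?b t) = 2"
        unfolding set_integrable_def set_lebesgue_integral_def e
        using has_bochner_integral_poisson_weight[OF r] unfolding has_bochner_integral_iff by blast+
    qed
    have one: "set_integrable lborel {-1..1::real} (\<lambda>t. 1::real)" "(LINT t:{-1..1::real}|lborel. 1::real) = 2"
      by (simp_all add: set_integrable_def set_lebesgue_integral_def)
    have g: "set_integrable lborel {-1..1} (\<lambda>t. C * ?b t + 1)"
      by (intro set_integral_add(1) set_integrable_mult_right b one)
    have le: "\<bar>?J t\<bar> * ?w t \<le> C * ?b t + 1" if t: "t \<in> {-1..1}" for t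
    proof -
      have t2: "0 \<le> 1 - t\<^sup>2" "1 - t\<^sup>2 \<le> 1" using t by (simp_all add: abs_square_le_1 abs_le_iff)
      have "\<bar>?J t\<bar> * ?w t \<le> (C * poisson_density lam r t + 1) * ?w t"
        unfolding r_def by (intro mult_right_mono C t R) simp
      also have "\<dots> = C * (poisson_density lam r t * ?w t) + ?w t" by (simp add: algebra_simps)
      also have "\<dots> \<le> C * ?b t + 1"
        using poisson_density_weight_le[OF t _ lam, of r] r C(1) t2 lam powr_le1[of "lam - 1 / 2" "1 - t\<^sup>2"]
        by (intro add_mono mult_left_mono) auto
      finally show ?thesis .
    qed
    have "continuous_on {-1..1} (\<lambda>t. \<bar>?J t\<bar>)"
      by (intro continuous_intros continuous_on_gegenbauer_series[OF lam0 M] summable_radial_factor R)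
    then have "(\<lambda>t. indicator {-1..1} t *\<^sub>R \<bar>?J t\<bar>) \<in> borel_measurable borel"
      by (rule borel_measurable_continuous_on_indicator[rotated]) simp
    then have mJ: "(\<lambda>t. indicator {-1..1} t *\<^sub>R \<bar>?J t\<bar>) \<in> borel_measurable lborel" by simp
    have "(\<lambda>t. (indicator {-1..1} t *\<^sub>R \<bar>?J t\<bar>) * ?w t) \<in> borel_measurable lborel"
      by (intro borel_measurable_times mJ) measurable
    then have mI: "set_borel_measurable lborel {-1..1} (\<lambda>t. \<bar>?J t\<bar> * ?w t)"
      by (simp add: set_borel_measurable_def mult.assoc)
    have si: "set_integrable lborel {-1..1} (\<lambda>t. \<bar>?J t\<bar> * ?w t)"
    proof (rule set_integrable_bound[OF g mI], rule AE_I2, rule impI)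
      fix t :: real assume "t \<in> {-1..1}"
      from le[OF this] show "norm (\<bar>?J t\<bar> * ?w t) \<le> norm (C * ?b t + 1)"
        by (simp add: abs_mult)
    qed
    have "(LINT t:{-1..1}|lborel. \<bar>?J t\<bar> * ?w t) \<le> (LINT t:{-1..1}|lborel. C * ?b t + 1)"
      by (rule set_integral_mono[OF si g le])
    also have "\<dots> = (LINT t:{-1..1}|lborel. C * ?b t) + (LINT t:{-1..1::real}|lborel. 1)"
      by (intro set_integral_add(2) set_integrable_mult_right b one)
    also have "(LINT t:{-1..1}|lborel. C * ?b t) = C * (LINT t:{-1..1}|lborel. ?b t)"
      by (rule set_integral_mult_right)
    also have "C * (LINT t:{-1..1}|lborel. ?b t) + (LINT t:{-1..1::real}|lborel. 1) = C * 2 + 2"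
      by (simp only: b(2) one(2))
    finally show ?thesis using si by (simp add: mult.commute)
  qed
  then show ?thesis by blast
qed

theorem theorem8p2:
  fixes n m :: nat and lam :: real
  assumes "n = CARD('n::finite)" and "n \<ge> 2" and "lam = (real n - 1) / 2" and "m \<ge> 1"
  shows
    "(\<forall>a>0. integrable (sphere_measure :: (real \<times> (real ^ 'n)) measure)
              (zonal (poisson_wavelet lam m a)))
     \<and> (LINT t:{0<..}|lborel. \<bar>poisson_psi m t\<bar>\<^sup>2 / t) = 1
     \<and> (\<exists>c::real. \<forall>R>0.
          (let conv = (\<lambda>a. zonal_profile
                 (sphere_convolution
                    (zonal (\<lambda>t. cnj (poisson_wavelet lam m a t)) :: real \<times> (real ^ 'n) \<Rightarrow> complex)
                    (poisson_wavelet lam m a)));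
               I = (\<lambda>t. norm (LINT a:{R..}|lborel. conv a t / of_real a)
                           * (1 - t\<^sup>2) powr (lam - 1 / 2))
           in (\<forall>t\<in>{-1..1}. set_integrable lborel {R..} (\<lambda>a. conv a t / of_real a))
              \<and> set_integrable lborel {-1..1} I
              \<and> (LINT t:{-1..1}|lborel. I t) \<le> c))"
proof (intro conjI allI impI)
  have lam: "lam \<ge> 1 / 2" "lam > 0" using assms(2,3) by auto
  have lam': "lam = (real CARD('n) - 1) / 2" using assms(1,3) by simp
  show "integrable (sphere_measure :: (real \<times> (real ^ 'n)) measure) (zonal (poisson_wavelet lam m a))"
    if "a > 0" for a
    unfolding zonal_def[abs_def] using that lam
    by (intro integrable_sphere_measure continuous_on_sphere_inner continuous_on_poisson_wavelet) auto
  show "(LINT t:{0<..}|lborel. \<bar>poisson_psi m t\<bar>\<^sup>2 / t) = 1"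
    by (rule poisson_psi_admissible[OF assms(4)])
  define conv where "conv = (\<lambda>a. zonal_profile
                 (sphere_convolution
                    (zonal (\<lambda>t. cnj (poisson_wavelet lam m a t)) :: real \<times> (real ^ 'n) \<Rightarrow> complex)
                    (poisson_wavelet lam m a)))"
  let ?J = "\<lambda>R t. \<Sum>l. radial_factor m R l * gegenbauer_kernel lam l t"
  let ?w = "\<lambda>t::real. (1 - t\<^sup>2) powr (lam - 1 / 2)"
  have J: "norm (LINT a:{R..}|lborel. conv a t / of_real a) * ?w t = \<bar>?J R t\<bar> * ?w t"
    if "t \<in> {-1..1}" "R > 0" for t R
    unfolding conv_def radial_integral_poisson_wavelet(2)[OF that(1) lam' lam(2) assms(4) that(2)] by simp
  obtain c where c: "\<And>R. R > 0 \<Longrightarrow> set_integrable lborel {-1..1} (\<lambda>t. \<bar>?J R t\<bar> * ?w t)"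
    "\<And>R. R > 0 \<Longrightarrow> (LINT t:{-1..1}|lborel. \<bar>?J R t\<bar> * ?w t) \<le> c"
    using weighted_radial_series_bound[OF lam(1) assms(4)] by blast
  show "\<exists>c::real. \<forall>R>0.
          (let conv = (\<lambda>a. zonal_profile
                 (sphere_convolution
                    (zonal (\<lambda>t. cnj (poisson_wavelet lam m a t)) :: real \<times> (real ^ 'n) \<Rightarrow> complex)
                    (poisson_wavelet lam m a)));
               I = (\<lambda>t. norm (LINT a:{R..}|lborel. conv a t / of_real a)
                           * (1 - t\<^sup>2) powr (lam - 1 / 2))
           in (\<forall>t\<in>{-1..1}. set_integrable lborel {R..} (\<lambda>a. conv a t / of_real a))
              \<and> set_integrable lborel {-1..1} I
              \<and> (LINT t:{-1..1}|lborel. I t) \<le> c)"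
    unfolding conv_def[symmetric] Let_def
  proof (intro exI[of _ c] allI impI conjI ballI)
    fix R :: real assume R: "R > 0"
    show "set_integrable lborel {R..} (\<lambda>a. conv a t / of_real a)" if "t \<in> {-1..1}" for t
      unfolding conv_def by (rule radial_integral_poisson_wavelet(1)[OF that lam' lam(2) assms(4) R])
    show "set_integrable lborel {-1..1} (\<lambda>t. norm (LINT a:{R..}|lborel. conv a t / of_real a) * ?w t)"
      using c(1)[OF R] by (subst set_integrable_cong[OF refl refl J[OF _ R]])
    have "(LINT t:{-1..1}|lborel. norm (LINT a:{R..}|lborel. conv a t / of_real a) * ?w t) =
        (LINT t:{-1..1}|lborel. \<bar>?J R t\<bar> * ?w t)"
      by (rule set_lebesgue_integral_cong) (use J[OF _ R] in auto)
    then show "(LINT t:{-1..1}|lborel. norm (LINT a:{R..}|lborel. conv a t / of_real a) * ?w t) \<le> c"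
      using c(2)[OF R] by (simp only:)
  qed
qed

end
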